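(* Let $G$ be a bridgeless cubic graph with $m_G^* \geq 6$. If $\mu_2(G) \leq 2$, then $G$ has a nowhere-zero 5-flow.
   Context: A cubic graph is a graph all of whose vertices have degree 3 (graphs are finite). A 1-factor of $G$ is a perfect matching, regarded as a set of edges; a 2-factor is a spanning 2-regular subgraph, i.e. a disjoint union of circuits covering all vertices. For a bridgeless cubic graph $G$ (which has 1-factors and 2-factors by Petersen's theorem): - $\mu_2(G) = \min\{|M_1 \cap M_2| : M_1 \text{ and } M_2 \text{ are 1-factors of } G\}$. - The oddness $\omega(G)$ is the minimum number of odd circuits in a 2-factor of $G$. A minimum 2-factor of $G$ is a 2-factor with precisely $\omega(G)$ odd circuits. - If $\omega(G) \geq 2$ and $\mathcal{F}$ is a minimum 2-factor of $G$, then $m_G(\mathcal{F})$ is the maximum number $k$ such that $G$ has no edge cut $E$ with fewer than $k$ edges such that two components of $G-E$ contain odd circuits of $\mathcal{F}$. (The oddness of a cubic graph is even, so $\omega(G)>0$ means $\omega(G)\ge 2$.) - $m_G^* = \infty$ if $\omega(G)=0$, and $m_G^* = \max\{m_G(\mathcal{F}) : \mathcal{F} \text{ is a minimum 2-factor of } G\}$ if $\omega(G)>0$. A nowhere-zero $k$-flow on $G$ is an assignment of a direction and a value from $\{1,\dots,k-1\}$ to each edge of $G$ such that Kirchhoff's law holds at every vertex (the sum of the values on incoming edges equals the sum of the values on outgoing edges). *)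

theory Defs
  imports Main "HOL-Library.Extended_Nat"
begin

text \<open>
  Undirected graphs, with parallel edges and loops allowed. The set of ends of an edge has two
  elements, or one if the edge is a loop. (A bridgeless cubic graph has no loops: the third edge at
  a vertex with a loop is a bridge.)
\<close>

record ('v, 'e) multigraph =
  verts :: "'v set"
  edges :: "'e set"
  ends :: "'e \<Rightarrow> 'v set"

locale fin_multigraph =
  fixes G :: "('v, 'e) multigraph"
  assumes finite_verts: "finite (verts G)"
    and finite_edges: "finite (edges G)"
    and ends_in_verts: "e \<in> edges G \<Longrightarrow> ends G e \<subseteq> verts G"
    and card_ends: "e \<in> edges G \<Longrightarrow> card (ends G e) = 1 \<or> card (ends G e) = 2"

text \<open>A loop contributes 2 to the degree of its vertex.\<close>

definition degree :: "('v, 'e) multigraph \<Rightarrow> 'v \<Rightarrow> nat" where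
  "degree G v = card {e \<in> edges G. v \<in> ends G e} + card {e \<in> edges G. ends G e = {v}}"

definition regular :: "nat \<Rightarrow> ('v, 'e) multigraph \<Rightarrow> bool" where
  "regular k G \<longleftrightarrow> (\<forall>v \<in> verts G. degree G v = k)"

definition cubic :: "('v, 'e) multigraph \<Rightarrow> bool" where
  "cubic G \<longleftrightarrow> regular 3 G"

definition delete_edges :: "('v, 'e) multigraph \<Rightarrow> 'e set \<Rightarrow> ('v, 'e) multigraph" where
  "delete_edges G S = G\<lparr>edges := edges G - S\<rparr>"

definition spanning_subgraph :: "('v, 'e) multigraph \<Rightarrow> 'e set \<Rightarrow> ('v, 'e) multigraph" where
  "spanning_subgraph G F = G\<lparr>edges := F\<rparr>"

definition adjacent :: "('v, 'e) multigraph \<Rightarrow> ('v \<times> 'v) set" where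
  "adjacent G = {(u, v). \<exists>e \<in> edges G. ends G e = {u, v}}"

text \<open>Components are represented by their vertex sets.\<close>

definition components :: "('v, 'e) multigraph \<Rightarrow> 'v set set" where
  "components G = verts G // ((adjacent G)\<^sup>* \<inter> verts G \<times> verts G)"

definition induced_edges :: "('v, 'e) multigraph \<Rightarrow> 'v set \<Rightarrow> 'e set" where
  "induced_edges G X = {e \<in> edges G. ends G e \<subseteq> X}"

definition bridge :: "('v, 'e) multigraph \<Rightarrow> 'e \<Rightarrow> bool" where
  "bridge G e \<longleftrightarrow>
     e \<in> edges G \<and> card (components (delete_edges G {e})) > card (components G)"

definition bridgeless :: "('v, 'e) multigraph \<Rightarrow> bool" where
  "bridgeless G \<longleftrightarrow> \<not> (\<exists>e. bridge G e)"

definition edge_cut :: "('v, 'e) multigraph \<Rightarrow> 'e set \<Rightarrow> bool" where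
  "edge_cut G S \<longleftrightarrow>
     (\<exists>X. X \<noteq> {} \<and> X \<subset> verts G \<and>
          S = {e \<in> edges G. ends G e \<inter> X \<noteq> {} \<and> ends G e \<inter> (verts G - X) \<noteq> {}})"

text \<open>Factors are represented by their edge sets.\<close>

definition factor :: "nat \<Rightarrow> ('v, 'e) multigraph \<Rightarrow> 'e set \<Rightarrow> bool" where
  "factor k G F \<longleftrightarrow> F \<subseteq> edges G \<and> regular k (spanning_subgraph G F)"

abbreviation one_factor :: "('v, 'e) multigraph \<Rightarrow> 'e set \<Rightarrow> bool" where
  "one_factor \<equiv> factor 1"

abbreviation two_factor :: "('v, 'e) multigraph \<Rightarrow> 'e set \<Rightarrow> bool" where
  "two_factor \<equiv> factor 2"

text \<open>
  The circuits of a 2-factor \<open>F\<close> are the components of the 2-regular graph with edge set \<open>F\<close>;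
  each is represented by its edge set, so that its cardinality is the length of the circuit.
\<close>

definition circuits :: "('v, 'e) multigraph \<Rightarrow> 'e set \<Rightarrow> 'e set set" where
  "circuits G F =
     induced_edges (spanning_subgraph G F) ` components (spanning_subgraph G F)"

definition odd_circuits :: "('v, 'e) multigraph \<Rightarrow> 'e set \<Rightarrow> 'e set set" where
  "odd_circuits G F = {C \<in> circuits G F. odd (card C)}"

text \<open>
  The minima and maxima in the next definitions are written as infima and suprema in \<^typ>\<open>enat\<close>.
  An infimum of a nonempty set of natural numbers is its minimum, and a supremum of a nonempty
  bounded set of natural numbers is its maximum; for bridgeless cubic graphs the sets of factors
  are nonempty by Petersen's theorem.
\<close>

definition mu2 :: "('v, 'e) multigraph \<Rightarrow> enat" where
  "mu2 G = Inf {enat (card (M1 \<inter> M2)) |M1 M2. one_factor G M1 \<and> one_factor G M2}"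

definition oddness :: "('v, 'e) multigraph \<Rightarrow> enat" where
  "oddness G = Inf {enat (card (odd_circuits G F)) |F. two_factor G F}"

definition minimum_two_factor :: "('v, 'e) multigraph \<Rightarrow> 'e set \<Rightarrow> bool" where
  "minimum_two_factor G F \<longleftrightarrow>
     two_factor G F \<and> enat (card (odd_circuits G F)) = oddness G"

definition separates_odd_circuits :: "('v, 'e) multigraph \<Rightarrow> 'e set \<Rightarrow> 'e set \<Rightarrow> bool" where
  "separates_odd_circuits G F S \<longleftrightarrow>
     (\<exists>K1 \<in> components (delete_edges G S). \<exists>K2 \<in> components (delete_edges G S). K1 \<noteq> K2 \<and>
        (\<exists>C \<in> odd_circuits G F. C \<subseteq> induced_edges (delete_edges G S) K1) \<and>
        (\<exists>C \<in> odd_circuits G F. C \<subseteq> induced_edges (delete_edges G S) K2))"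

text \<open>
  Only of interest if \<open>F\<close> has at least two odd circuits; then the edges leaving one of them form a
  separating edge cut, so the supremum is finite.
\<close>

definition m_factor :: "('v, 'e) multigraph \<Rightarrow> 'e set \<Rightarrow> enat" where
  "m_factor G F =
     Sup {enat k |k. \<not> (\<exists>S. edge_cut G S \<and> card S < k \<and> separates_odd_circuits G F S)}"

definition m_star :: "('v, 'e) multigraph \<Rightarrow> enat" where
  "m_star G =
     (if oddness G = 0 then \<infinity> else Sup {m_factor G F |F. minimum_two_factor G F})"

text \<open>The functions \<open>tl\<close> and \<open>hd\<close> give the direction of each edge, \<open>f\<close> its value.\<close>

definition has_nowhere_zero_flow :: "('v, 'e) multigraph \<Rightarrow> nat \<Rightarrow> bool" where
  "has_nowhere_zero_flow G k \<longleftrightarrow>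
     (\<exists>(tl :: 'e \<Rightarrow> 'v) (hd :: 'e \<Rightarrow> 'v) (f :: 'e \<Rightarrow> nat).
        (\<forall>e \<in> edges G. ends G e = {tl e, hd e} \<and> 1 \<le> f e \<and> f e \<le> k - 1) \<and>
        (\<forall>v \<in> verts G. (\<Sum>e | e \<in> edges G \<and> hd e = v. f e) = (\<Sum>e | e \<in> edges G \<and> tl e = v. f e)))"

end

theory Submission imports Defs begin

text \<open>
  Two 1-factors meeting in at most two edges give a 2-factor with at most four odd circuits, so the
  oddness is 0, 2 or 4. By Hoffman's circulation theorem a cubic graph has a nowhere-zero 5-flow as
  soon as its vertices can be coloured \<open>\<plusminus>1\<close> such that \<open>5 \<bar>\<phi>(S)\<bar> \<le> 3 \<bar>\<partial>S\<bar>\<close> for every vertex set \<open>S\<close>.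

  Let \<open>F\<close> be a minimum 2-factor, with \<open>m_factor G F \<ge> 6\<close> unless the oddness is 0, and \<open>M\<close> its complement. Choose one vertex on each odd circuit and
  let \<open>R\<close> be the matching of \<open>F\<close> that misses exactly the chosen vertices. Colour the vertices such
  that all edges of \<open>M\<close> and \<open>R\<close> are bichromatic; the sign pattern on the chosen vertices can be
  prescribed up to a pairing. If this fails, counting \<open>\<phi>\<close> along \<open>M\<close> and along \<open>R\<close> shows that there
  are four odd circuits and that the violating cut consists of four \<open>M\<close>-edges and two \<open>R\<close>-edges and
  separates the chosen vertices two from two. Two such cuts, for different sign patterns, cross;
  since fewer than six edges do not separate odd circuits, one of the quadrants \<open>T\<close> is bounded by
  five edges: one of \<open>M\<close> and two of each of two odd circuits. Take \<open>T\<close> minimal and choose the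
  vertices on these two circuits next to the boundary of \<open>T\<close>, so that no \<open>R\<close>-edge leaves \<open>T\<close>. Then
  every violating cut yields a cut with at most five edges separating odd circuits, or a smaller \<open>T\<close>.
\<close>

section \<open>Flows from balanced vertex colourings\<close>

text \<open>The ratio 5 : 3 is Hoffman's condition in disguise. Orient the edges so that out-degree
  minus in-degree is \<phi> at every vertex. If p edges leave a set S and q enter it, values between
  1 and 4 require p <= 4q and q <= 4p; since p - q = \<phi>(S) and p + q = |cut S|, this is the
  inequality for S.

  The number 6 is the borderline. Counted along M, \<phi>(S) is at most the number of M-edges in the
  cut; counted along R, it exceeds the number of R-edges by at most 2, because there are at most
  four chosen vertices and their colours sum to 0. Parity then leaves violating cuts with two or six
  edges. Two edges contradict the hypothesis on separating cuts, six do not, so one sign pattern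
  need not succeed and cuts of two patterns are played against each other. Each quadrant has an odd
  number of vertices, hence an odd boundary; as 6 + 6 < 7 + 7, submodularity pushes one of two
  opposite quadrants down to five edges.\<close>

definition capacity :: "'e set \<Rightarrow> ('e \<Rightarrow> 'v) \<Rightarrow> ('e \<Rightarrow> 'v) \<Rightarrow> ('e \<Rightarrow> int) \<Rightarrow> ('e \<Rightarrow> int) \<Rightarrow> 'v set \<Rightarrow> int" where
  "capacity E src tgt l u X =
     (\<Sum>e\<in>E. if src e \<in> X \<and> tgt e \<notin> X then u e else if tgt e \<in> X \<and> src e \<notin> X then - l e else 0)"

lemma sum_fun_upd:
  fixes g :: "'e \<Rightarrow> int"
  assumes "finite E" "a \<in> E" "\<And>e. e \<noteq> a \<Longrightarrow> g' e = g e"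
  shows "sum g' E = sum g E + (g' a - g a)"
proof -
  have "sum g' (E - {a}) = sum g (E - {a})" using assms(3) by (intro sum.cong) auto
  then show ?thesis using assms(1,2) by (simp add: sum.remove[of E a])
qed

text \<open>The inequality holds edge by edge. An edge from \<open>X - Y\<close> to
  \<open>Y - X\<close> counts \<open>u - l\<close> on the right and nothing for the intersection and
  the union; the surplus of the edge \<open>a\<close> is retained.\<close>

lemma capacity_submodular:
  fixes l u :: "'e \<Rightarrow> int"
  assumes "finite E" "\<And>e. e \<in> E \<Longrightarrow> l e \<le> u e"
    and "a \<in> E" "src a \<in> X" "tgt a \<notin> X" "tgt a \<in> Y" "src a \<notin> Y"
  shows "capacity E src tgt l u (X \<inter> Y) + capacity E src tgt l u (X \<union> Y) + (u a - l a)
    \<le> capacity E src tgt l u X + capacity E src tgt l u Y"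
proof -
  let ?c = "\<lambda>X e. if src e \<in> X \<and> tgt e \<notin> X then u e else if tgt e \<in> X \<and> src e \<notin> X then - l e else 0"
  let ?d = "\<lambda>e. ?c X e + ?c Y e - ?c (X \<inter> Y) e - ?c (X \<union> Y) e"
  have "u a - l a = ?d a" using assms(4-7) by simp
  also have "\<dots> \<le> sum ?d E"
  proof (rule member_le_sum[OF \<open>a \<in> E\<close> _ \<open>finite E\<close>])
    fix e assume "e \<in> E - {a}"
    then have "l e \<le> u e" using assms(2) by blast
    then show "0 \<le> ?d e" by (auto split: if_splits)
  qed
  finally show ?thesis unfolding capacity_def sum_subtractf sum.distrib by linarith
qed

text \<open>
  Shrink the interval of one edge at a time. If neither end of an interval can be moved, there are
  two tight sets that the edge crosses in opposite directions, against strict submodularity.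
\<close>

theorem feasible_flow_exists:
  fixes l u :: "'e \<Rightarrow> int" and b :: "'v \<Rightarrow> int"
  assumes "finite V" "finite E" and ends: "\<And>e. e \<in> E \<Longrightarrow> src e \<in> V \<and> tgt e \<in> V"
    and b0: "sum b V = 0"
    and "\<And>e. e \<in> E \<Longrightarrow> l e \<le> u e"
    and "\<And>X. X \<subseteq> V \<Longrightarrow> sum b X \<le> capacity E src tgt l u X"
  shows "\<exists>f. (\<forall>e\<in>E. l e \<le> f e \<and> f e \<le> u e) \<and>
    (\<forall>v\<in>V. (\<Sum>e | e \<in> E \<and> src e = v. f e) - (\<Sum>e | e \<in> E \<and> tgt e = v. f e) = b v)"
  using assms(5,6)
proof (induction "nat (\<Sum>e\<in>E. u e - l e)" arbitrary: l u rule: less_induct)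
  case less
  note fin = \<open>finite V\<close> \<open>finite E\<close>
  show ?case
  proof (cases "\<exists>a\<in>E. l a < u a")
    case False
    then have eq: "u e = l e" if "e \<in> E" for e using less.prems(1)[OF that] that by force
    let ?x = "\<lambda>v. (\<Sum>e | e \<in> E \<and> src e = v. l e) - (\<Sum>e | e \<in> E \<and> tgt e = v. l e)"
    have x: "?x v = capacity E src tgt l u {v}" for v
    proof -
      have "?x v = (\<Sum>e\<in>E. (if src e = v then l e else 0) - (if tgt e = v then l e else 0))"
        using fin by (simp add: sum_subtractf sum.inter_filter)
      also have "\<dots> = capacity E src tgt l u {v}"
        unfolding capacity_def by (intro sum.cong) (auto simp: eq)
      finally show ?thesis .
    qed
    \<comment> \<open>Singletons give one inequality at each vertex; it is an equality because both
      sides have total 0 over \<open>V\<close>.\<close>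
    have ge: "0 \<le> ?x v - b v" if "v \<in> V" for v
      using less.prems(2)[of "{v}"] that unfolding x by simp
    have "(\<Sum>v\<in>V. \<Sum>e | e \<in> E \<and> src e = v. l e) = sum l E"
      using fin ends by (intro sum.group) auto
    moreover have "(\<Sum>v\<in>V. \<Sum>e | e \<in> E \<and> tgt e = v. l e) = sum l E"
      using fin ends by (intro sum.group) auto
    ultimately have "(\<Sum>v\<in>V. ?x v - b v) = 0" using b0 by (simp add: sum_subtractf)
    then have "?x v = b v" if "v \<in> V" for v
      using sum_nonneg_eq_0_iff[OF fin(1), of "\<lambda>v. ?x v - b v"] ge that by simp
    then show ?thesis using eq by (intro exI[of _ l]) auto
  next
    case True
    then obtain a where a: "a \<in> E" "l a < u a" by blast
    define u' where "u' = u(a := u a - 1)"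
    define l' where "l' = l(a := l a + 1)"
    have lu': "l e \<le> u' e" "l' e \<le> u e" if "e \<in> E" for e
      using less.prems(1)[OF that] a by (auto simp: u'_def l'_def)
    have less_u: "nat (\<Sum>e\<in>E. u' e - l e) < nat (\<Sum>e\<in>E. u e - l e)"
    proof -
      have "(\<Sum>e\<in>E. u' e - l e) = (\<Sum>e\<in>E. u e - l e) - 1"
        by (subst sum_fun_upd[OF fin(2) a(1), of _ "\<lambda>e. u e - l e"]) (auto simp: u'_def)
      moreover have "0 \<le> (\<Sum>e\<in>E. u' e - l e)" using lu' by (intro sum_nonneg) auto
      ultimately show ?thesis by linarith
    qed
    have less_l: "nat (\<Sum>e\<in>E. u e - l' e) < nat (\<Sum>e\<in>E. u e - l e)"
    proof -
      have "(\<Sum>e\<in>E. u e - l' e) = (\<Sum>e\<in>E. u e - l e) - 1"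
        by (subst sum_fun_upd[OF fin(2) a(1), of _ "\<lambda>e. u e - l e"]) (auto simp: l'_def)
      moreover have "0 \<le> (\<Sum>e\<in>E. u e - l' e)" using lu' by (intro sum_nonneg) auto
      ultimately show ?thesis by linarith
    qed
    show ?thesis
    proof (cases "(\<forall>X\<subseteq>V. sum b X \<le> capacity E src tgt l u' X) \<or>
        (\<forall>X\<subseteq>V. sum b X \<le> capacity E src tgt l' u X)")
      case True
      then show ?thesis
      proof
        assume "\<forall>X\<subseteq>V. sum b X \<le> capacity E src tgt l u' X"
        then obtain f where f: "\<forall>e\<in>E. l e \<le> f e \<and> f e \<le> u' e"
          "\<forall>v\<in>V. (\<Sum>e | e \<in> E \<and> src e = v. f e) - (\<Sum>e | e \<in> E \<and> tgt e = v. f e) = b v"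
          using less.hyps[OF less_u lu'(1)] by blast
        have "u' e \<le> u e" for e by (simp add: u'_def)
        then show ?thesis using f by (meson order_trans)
      next
        assume "\<forall>X\<subseteq>V. sum b X \<le> capacity E src tgt l' u X"
        then obtain f where f: "\<forall>e\<in>E. l' e \<le> f e \<and> f e \<le> u e"
          "\<forall>v\<in>V. (\<Sum>e | e \<in> E \<and> src e = v. f e) - (\<Sum>e | e \<in> E \<and> tgt e = v. f e) = b v"
          using less.hyps[OF less_l lu'(2)] by blast
        have "l e \<le> l' e" for e by (simp add: l'_def)
        then show ?thesis using f by (meson order_trans)
      qed
    next
      case False
      then obtain X Y where X: "X \<subseteq> V" "capacity E src tgt l u' X < sum b X"
        and Y: "Y \<subseteq> V" "capacity E src tgt l' u Y < sum b Y" by (auto simp: not_le)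
      have cX: "capacity E src tgt l u' X = capacity E src tgt l u X - (if src a \<in> X \<and> tgt a \<notin> X then 1 else 0)"
        unfolding capacity_def
        by (subst sum_fun_upd[OF fin(2) a(1), of _ "\<lambda>e. if src e \<in> X \<and> tgt e \<notin> X then u e
          else if tgt e \<in> X \<and> src e \<notin> X then - l e else 0"]) (auto simp: u'_def)
      have cY: "capacity E src tgt l' u Y = capacity E src tgt l u Y - (if tgt a \<in> Y \<and> src a \<notin> Y then 1 else 0)"
        unfolding capacity_def
        by (subst sum_fun_upd[OF fin(2) a(1), of _ "\<lambda>e. if src e \<in> Y \<and> tgt e \<notin> Y then u e
          else if tgt e \<in> Y \<and> src e \<notin> Y then - l e else 0"]) (auto simp: l'_def)
      note bX = less.prems(2)[OF X(1)] and bY = less.prems(2)[OF Y(1)]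
      have aX: "src a \<in> X" "tgt a \<notin> X" and aY: "tgt a \<in> Y" "src a \<notin> Y"
        using X(2) bX Y(2) bY unfolding cX cY by (auto split: if_splits)
      have fXY: "finite X" "finite Y" using X(1) Y(1) fin(1) finite_subset by auto
      have "sum b X + sum b Y = sum b (X \<inter> Y) + sum b (X \<union> Y)"
        using sum.union_inter[OF fXY, of b] by simp
      also have "\<dots> \<le> capacity E src tgt l u (X \<inter> Y) + capacity E src tgt l u (X \<union> Y)"
        using X(1) Y(1) by (intro add_mono less.prems(2)) auto
      also have "\<dots> < capacity E src tgt l u X + capacity E src tgt l u Y - (u a - l a) + 1"
        using capacity_submodular[where src = src and tgt = tgt and l = l and u = u,
          OF fin(2) less.prems(1) a(1) aX aY] by simp
      finally show ?thesis using X(2) Y(2) aX aY a(2) unfolding cX cY by simp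
    qed
  qed
qed


section \<open>From vertex colourings to nowhere-zero 5-flows\<close>

lemma sum_net_outflow:
  fixes g :: "'e \<Rightarrow> int"
  assumes "finite E" "finite X"
  shows "(\<Sum>v\<in>X. (\<Sum>e | e \<in> E \<and> src e = v. g e) - (\<Sum>e | e \<in> E \<and> tgt e = v. g e))
    = capacity E src tgt g g X"
proof -
  have "(\<Sum>v\<in>X. (\<Sum>e | e \<in> E \<and> src e = v. g e) - (\<Sum>e | e \<in> E \<and> tgt e = v. g e))
      = (\<Sum>v\<in>X. \<Sum>e\<in>E. (if src e = v then g e else 0) - (if tgt e = v then g e else 0))"
    using assms by (simp add: sum_subtractf sum.inter_filter)
  also have "\<dots> = (\<Sum>e\<in>E. \<Sum>v\<in>X. (if src e = v then g e else 0) - (if tgt e = v then g e else 0))"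
    by (rule sum.swap)
  also have "\<dots> = capacity E src tgt g g X"
    unfolding capacity_def using assms(2) by (intro sum.cong) (auto simp: sum_subtractf sum.delta')
  finally show ?thesis .
qed

text \<open>\<open>feasible_flow_exists\<close> is applied twice. The first time, with values 0 and
  1, it decides which edges of an arbitrary reference orientation are reversed so that the net
  out-degree becomes \<phi>. The second time it finds values from 1 to 4 along the new
  orientation.\<close>

theorem nowhere_zero_5_flow_if_balanced:
  fixes G :: "('v, 'e) multigraph" and \<phi> :: "'v \<Rightarrow> int"
  assumes "fin_multigraph G" and no_loops: "\<And>e. e \<in> edges G \<Longrightarrow> card (ends G e) = 2"
    and deg3: "\<And>v. v \<in> verts G \<Longrightarrow> card {e \<in> edges G. v \<in> ends G e} = 3"
    and sgn: "\<And>v. v \<in> verts G \<Longrightarrow> \<phi> v = 1 \<or> \<phi> v = - 1"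
    and bal: "\<And>X. X \<subseteq> verts G \<Longrightarrow> 5 * \<bar>sum \<phi> X\<bar>
      \<le> 3 * int (card {e \<in> edges G. ends G e \<inter> X \<noteq> {} \<and> ends G e - X \<noteq> {}})"
  shows "has_nowhere_zero_flow G 5"
proof -
  interpret fin_multigraph G by fact
  let ?V = "verts G" and ?E = "edges G"
  note fin = finite_verts finite_edges
  have "\<exists>p. ends G e = {fst p, snd p} \<and> fst p \<noteq> snd p" if "e \<in> ?E" for e
    using no_loops[OF that] unfolding card_2_iff by force
  then obtain p where p: "ends G e = {fst (p e), snd (p e)}" "fst (p e) \<noteq> snd (p e)" if "e \<in> ?E" for e
    by metis
  define src tgt where "src e = fst (p e)" and "tgt e = snd (p e)" for e
  have st: "ends G e = {src e, tgt e}" "src e \<noteq> tgt e" if "e \<in> ?E" for e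
    using p[OF that] by (auto simp: src_def tgt_def)
  have stV: "src e \<in> ?V \<and> tgt e \<in> ?V" if "e \<in> ?E" for e using ends_in_verts[OF that] st[OF that] by auto
  define cut where "cut X = {e \<in> ?E. ends G e \<inter> X \<noteq> {} \<and> ends G e - X \<noteq> {}}" for X
  define out inn where "out v = (\<Sum>e | e \<in> ?E \<and> src e = v. 1::int)"
    and "inn v = (\<Sum>e | e \<in> ?E \<and> tgt e = v. 1::int)" for v
  have out_inn: "out v + inn v = 3" if "v \<in> ?V" for v
  proof -
    have "{e \<in> ?E. v \<in> ends G e} = {e. e \<in> ?E \<and> src e = v} \<union> {e. e \<in> ?E \<and> tgt e = v}"
      using st by auto
    moreover have "{e. e \<in> ?E \<and> src e = v} \<inter> {e. e \<in> ?E \<and> tgt e = v} = {}"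
      using st(2) by (fastforce dest: sym)
    ultimately show ?thesis using deg3[OF that] fin(2)
      by (simp add: out_def inn_def card_Un_disjoint)
  qed
  have cut_card: "int (card (cut X)) = (\<Sum>e\<in>?E. if src e \<in> X \<and> tgt e \<notin> X then 1 else
      if tgt e \<in> X \<and> src e \<notin> X then 1 else 0)" for X
  proof -
    have "int (card (cut X)) = (\<Sum>e\<in>?E. if e \<in> cut X then 1 else 0)"
      using fin(2) by (simp add: sum.If_cases cut_def Int_def)
    also have "\<dots> = (\<Sum>e\<in>?E. if src e \<in> X \<and> tgt e \<notin> X then 1 else
      if tgt e \<in> X \<and> src e \<notin> X then 1 else 0)"
      using st by (intro sum.cong) (auto simp: cut_def)
    finally show ?thesis .
  qed
  have finX: "finite X" if "X \<subseteq> ?V" for X using that fin(1) finite_subset by auto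
  \<comment> \<open>Reversing the edges with value 0 turns a net outflow x of the 0/1 flow into
    \<open>2 * x - (out v - inn v)\<close>. This is to equal \<open>\<phi> v\<close>; with
    \<open>out v + inn v = 3\<close> solving for x gives \<open>b v\<close>, and the division is
    exact because \<open>\<phi> v\<close> is odd.\<close>
  define b where "b v = (\<phi> v + 3) div 2 - inn v" for v
  have b2: "2 * b v = \<phi> v + (out v - inn v)" if "v \<in> ?V" for v
    using sgn[OF that] out_inn[OF that] by (auto simp: b_def)
  have sum_b: "2 * sum b X = sum \<phi> X + capacity ?E src tgt (\<lambda>_. 1) (\<lambda>_. 1) X" if "X \<subseteq> ?V" for X
  proof -
    have "2 * sum b X = (\<Sum>v\<in>X. \<phi> v + (out v - inn v))"
      unfolding sum_distrib_left using that by (intro sum.cong refl b2) auto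
    also have "\<dots> = sum \<phi> X + (\<Sum>v\<in>X. out v - inn v)" by (simp add: sum.distrib)
    finally show ?thesis using sum_net_outflow[where src = src and tgt = tgt and g = "\<lambda>_. 1", OF fin(2) finX[OF that]]
      by (simp only: out_def inn_def)
  qed
  have "\<exists>z. (\<forall>e\<in>?E. 0 \<le> z e \<and> z e \<le> 1) \<and>
    (\<forall>v\<in>?V. (\<Sum>e | e \<in> ?E \<and> src e = v. z e) - (\<Sum>e | e \<in> ?E \<and> tgt e = v. z e) = b v)"
  proof (rule feasible_flow_exists[OF fin stV])
    have "cut ?V = {}" using ends_in_verts by (auto simp: cut_def)
    then have "sum \<phi> ?V = 0" using bal[of ?V, folded cut_def] by simp
    moreover have "capacity ?E src tgt (\<lambda>_. 1) (\<lambda>_. 1) ?V = 0"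
      unfolding capacity_def using stV by (intro sum.neutral) auto
    ultimately show "sum b ?V = 0" using sum_b[of ?V] by simp
    fix X assume X: "X \<subseteq> ?V"
    have "sum \<phi> X \<le> int (card (cut X))" using bal[OF X, folded cut_def] by simp
    also have "int (card (cut X)) = 2 * capacity ?E src tgt (\<lambda>_. 0) (\<lambda>_. 1) X
        - capacity ?E src tgt (\<lambda>_. 1) (\<lambda>_. 1) X"
      unfolding cut_card capacity_def sum_distrib_left sum_subtractf[symmetric]
      by (intro sum.cong) auto
    finally show "sum b X \<le> capacity ?E src tgt (\<lambda>_. 0) (\<lambda>_. 1) X" using sum_b[OF X] by simp
  qed auto
  then obtain z where z: "\<forall>e\<in>?E. 0 \<le> z e \<and> z e \<le> (1::int)" and
    zb': "\<forall>v\<in>?V. (\<Sum>e | e \<in> ?E \<and> src e = v. z e) - (\<Sum>e | e \<in> ?E \<and> tgt e = v. z e) = b v"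
    by blast
  have z01: "z e = 0 \<or> z e = 1" if "e \<in> ?E" for e using bspec[OF z that] by linarith
  note zb = bspec[OF zb']
  define src' tgt' where "src' e = (if z e = 1 then src e else tgt e)"
    and "tgt' e = (if z e = 1 then tgt e else src e)" for e
  have st': "ends G e = {src' e, tgt' e}" if "e \<in> ?E" for e
    using st[OF that] by (auto simp: src'_def tgt'_def)
  have stV': "src' e \<in> ?V \<and> tgt' e \<in> ?V" if "e \<in> ?E" for e
    using stV[OF that] by (auto simp: src'_def tgt'_def)
  have net': "(\<Sum>e | e \<in> ?E \<and> src' e = v. 1) - (\<Sum>e | e \<in> ?E \<and> tgt' e = v. 1) = \<phi> v" if "v \<in> ?V" for v
  proof -
    have flt: "(\<Sum>e | e \<in> ?E \<and> h e = v. g e) = (\<Sum>e\<in>?E. if h e = v then g e else 0)"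
      for h and g :: "'e \<Rightarrow> int" using fin(2) by (simp add: sum.inter_filter)
    have "(\<Sum>e | e \<in> ?E \<and> src' e = v. 1) - (\<Sum>e | e \<in> ?E \<and> tgt' e = v. 1::int) =
       2 * ((\<Sum>e | e \<in> ?E \<and> src e = v. z e) - (\<Sum>e | e \<in> ?E \<and> tgt e = v. z e)) - (out v - inn v)"
      unfolding flt out_def inn_def sum_distrib_left sum_subtractf[symmetric]
      using z01 by (intro sum.cong) (auto simp: src'_def tgt'_def)
    then show ?thesis unfolding zb[OF that] using b2[OF that] by simp
  qed
  have net_sum: "sum \<phi> X = capacity ?E src' tgt' (\<lambda>_. 1) (\<lambda>_. 1) X" if "X \<subseteq> ?V" for X
  proof -
    have "sum \<phi> X = (\<Sum>v\<in>X. (\<Sum>e | e \<in> ?E \<and> src' e = v. 1) - (\<Sum>e | e \<in> ?E \<and> tgt' e = v. 1))"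
      using that by (intro sum.cong refl net'[symmetric]) auto
    then show ?thesis using sum_net_outflow[where src = src' and tgt = tgt' and g = "\<lambda>_. 1", OF fin(2) finX[OF that]] by simp
  qed
  have "\<exists>f. (\<forall>e\<in>?E. 1 \<le> f e \<and> f e \<le> 4) \<and>
    (\<forall>v\<in>?V. (\<Sum>e | e \<in> ?E \<and> src' e = v. f e) - (\<Sum>e | e \<in> ?E \<and> tgt' e = v. f e) = (0::int))"
  proof (rule feasible_flow_exists[OF fin stV'])
    fix X assume X: "X \<subseteq> ?V"
    \<comment> \<open>A leaving edge counts 2 * 4 = 3 + 5, an entering one 2 * (-1) = 3 - 5. So
      Hoffman's condition for the bounds 1 and 4 is the balance condition.\<close>
    have "2 * capacity ?E src' tgt' (\<lambda>_. 1) (\<lambda>_. 4) X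
      = 3 * int (card (cut X)) + 5 * capacity ?E src' tgt' (\<lambda>_. 1) (\<lambda>_. 1) X"
      unfolding cut_card capacity_def sum_distrib_left sum.distrib[symmetric]
      by (intro sum.cong) (auto simp: src'_def tgt'_def)
    then show "(\<Sum>v\<in>X. 0) \<le> capacity ?E src' tgt' (\<lambda>_. 1) (\<lambda>_. 4) X"
      using bal[OF X, folded cut_def] net_sum[OF X] by simp
  qed auto
  then obtain f where f: "\<And>e. e \<in> ?E \<Longrightarrow> 1 \<le> f e \<and> f e \<le> (4::int)"
    "\<And>v. v \<in> ?V \<Longrightarrow> (\<Sum>e | e \<in> ?E \<and> src' e = v. f e) - (\<Sum>e | e \<in> ?E \<and> tgt' e = v. f e) = 0"
    by blast
  have nat_sum: "int (\<Sum>e | e \<in> ?E \<and> h e = v. nat (f e)) = (\<Sum>e | e \<in> ?E \<and> h e = v. f e)" for h v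
    unfolding of_nat_sum using f(1) by (intro sum.cong) force+
  show ?thesis unfolding has_nowhere_zero_flow_def
  proof (intro exI conjI ballI)
    fix e assume e: "e \<in> ?E"
    show "ends G e = {src' e, tgt' e}" by (rule st'[OF e])
    show "1 \<le> nat (f e)" "nat (f e) \<le> 5 - 1" using f(1)[OF e] by auto
  next
    fix v assume v: "v \<in> ?V"
    show "(\<Sum>e | e \<in> ?E \<and> tgt' e = v. nat (f e)) = (\<Sum>e | e \<in> ?E \<and> src' e = v. nat (f e))"
      unfolding of_nat_eq_iff[where 'a = int, symmetric] nat_sum using f(2)[OF v] by simp
  qed
qed

section \<open>Loopless multigraphs\<close>

lemma card_sym_diff_parity:
  assumes "finite A" "finite B"
  shows "odd (card (A - B \<union> (B - A))) \<longleftrightarrow> odd (card A) \<noteq> odd (card B)"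
proof -
  have "card A = card (A - B) + card (A \<inter> B)" "card B = card (B - A) + card (A \<inter> B)"
    using assms by (metis card_Diff_subset_Int Int_commute add.commute card_mono finite_Int inf_le1
      le_add_diff_inverse2)+
  moreover have "card (A - B \<union> (B - A)) = card (A - B) + card (B - A)"
    using assms by (intro card_Un_disjoint) auto
  ultimately show ?thesis by presburger
qed

text \<open>The union of two perfect matchings consists of alternating, hence even, cycles. The
  induction avoids speaking of cycles: it removes \<open>v\<close> and \<open>w = \<mu> v\<close>
  and lets \<open>\<rho>'\<close> join their former \<rho>-partners. This replaces a path of three
  edges by one edge, so colours extend back to \<open>v\<close> and \<open>w\<close>.\<close>

lemma involutions_bipartite:
  assumes "finite V"
    and "\<And>v. v \<in> V \<Longrightarrow> \<mu> v \<in> V \<and> \<mu> v \<noteq> v \<and> \<mu> (\<mu> v) = v"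
    and "\<And>v. v \<in> V \<Longrightarrow> \<rho> v \<in> V \<and> \<rho> v \<noteq> v \<and> \<rho> (\<rho> v) = v"
  shows "\<exists>\<phi> :: 'v \<Rightarrow> int. \<forall>v\<in>V. (\<phi> v = 1 \<or> \<phi> v = - 1) \<and> \<phi> (\<mu> v) = - \<phi> v \<and> \<phi> (\<rho> v) = - \<phi> v"
  using assms
proof (induction "card V" arbitrary: V \<rho> rule: less_induct)
  case less
  note mu = less.prems(2) and rho = less.prems(3)
  show ?case
  proof (cases "V = {}")
    case False
    then obtain v where v: "v \<in> V" by blast
    define w where "w = \<mu> v"
    have w: "w \<in> V" "w \<noteq> v" "\<mu> w = v" using mu[OF v] by (auto simp: w_def)
    let ?U = "V - {v, w}"
    define \<rho>' where "\<rho>' = (\<lambda>u. if u = \<rho> v then \<rho> w else if u = \<rho> w then \<rho> v else \<rho> u)"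
    have mu_inj: "\<mu> a = \<mu> b \<Longrightarrow> a = b" if "a \<in> V" "b \<in> V" for a b using mu that by metis
    have rho_inj: "\<rho> a = \<rho> b \<Longrightarrow> a = b" if "a \<in> V" "b \<in> V" for a b using rho that by metis
    have rho_swap: "\<rho> v = w \<longleftrightarrow> \<rho> w = v" using rho[OF v] rho[OF w(1)] by metis
    have rv: "\<rho> v \<in> V" "\<rho> v \<noteq> v" "\<rho> (\<rho> v) = v" and rw: "\<rho> w \<in> V" "\<rho> w \<noteq> w" "\<rho> (\<rho> w) = w"
      using rho[OF v] rho[OF w(1)] by blast+
    have rvw: "\<rho> v \<noteq> \<rho> w" using rho_inj[OF v w(1)] w(2) by blast
    have card: "card ?U < card V" using v less.prems(1) by (intro psubset_card_mono) auto
    have mu': "\<mu> u \<in> ?U \<and> \<mu> u \<noteq> u \<and> \<mu> (\<mu> u) = u" if "u \<in> ?U" for u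
      using mu[of u] that mu_inj[of u v] mu_inj[of u w] v w by (auto simp: w_def)
    have rho': "\<rho>' u \<in> ?U \<and> \<rho>' u \<noteq> u \<and> \<rho>' (\<rho>' u) = u" if "u \<in> ?U" for u
    proof (cases "u = \<rho> v \<or> u = \<rho> w")
      case True
      then have "\<rho> v \<in> ?U \<and> \<rho> w \<in> ?U"
        using that rho_swap rv(1,2) rw(1,2) by blast
      then show ?thesis using True rvw by (elim disjE) (simp_all add: \<rho>'_def)
    next
      case False
      moreover have "\<rho> u \<noteq> \<rho> v" "\<rho> u \<noteq> \<rho> w" using rho_inj[of u v] rho_inj[of u w] that v w(1) by blast+
      moreover have "\<rho> u \<noteq> v" "\<rho> u \<noteq> w" using False rho[of u] that by auto
      ultimately have "\<rho> u \<noteq> v" "\<rho> u \<noteq> w" "\<rho> u \<noteq> \<rho> v" "\<rho> u \<noteq> \<rho> w" by blast+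
      then show ?thesis using False that rho[of u] by (simp add: \<rho>'_def)
    qed
    obtain \<phi> :: "'v \<Rightarrow> int" where phi: "\<And>u. u \<in> ?U \<Longrightarrow>
        (\<phi> u = 1 \<or> \<phi> u = - 1) \<and> \<phi> (\<mu> u) = - \<phi> u \<and> \<phi> (\<rho>' u) = - \<phi> u"
      using less.hyps[OF card _ mu' rho'] less.prems(1) by (metis finite_Diff)
    have rho_out: "\<rho> u \<in> ?U" if "u \<in> ?U" "u \<noteq> \<rho> v" "u \<noteq> \<rho> w" for u
      using rho[of u] that by (metis Diff_iff insert_iff singletonD)
    show ?thesis
    proof (cases "\<rho> v = w")
      case True
      then have rw: "\<rho> w = v" using rho_swap by blast
      define \<psi> where "\<psi> = \<phi>(v := 1, w := - 1)"
      have *: "\<psi> v = 1" "\<psi> w = - 1" "\<And>u. u \<in> ?U \<Longrightarrow> \<psi> u = \<phi> u" using w(2) by (simp_all add: \<psi>_def)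
      have "(\<psi> u = 1 \<or> \<psi> u = - 1) \<and> \<psi> (\<mu> u) = - \<psi> u \<and> \<psi> (\<rho> u) = - \<psi> u"
        if "u \<in> V" for u
      proof (cases "u \<in> ?U")
        case u: True
        have ne: "u \<noteq> \<rho> v" "u \<noteq> \<rho> w" using u True rw by auto
        have "\<rho>' u = \<rho> u" using ne by (simp add: \<rho>'_def)
        then show ?thesis using phi[OF u] *(3)[OF u] *(3)[OF rho_out[OF u ne]] *(3)[of "\<mu> u"] mu'[OF u] by simp
      next
        case False
        then have "u = v \<or> u = w" using that by blast
        then show ?thesis using *(1,2) w(3) w_def True rw by (elim disjE) simp_all
      qed
      then show ?thesis by blast
    next
      case False
      then have rU: "\<rho> v \<in> ?U" "\<rho> w \<in> ?U" using rho_swap rv rw by blast+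
      define \<psi> where "\<psi> = \<phi>(v := - \<phi> (\<rho> v), w := - \<phi> (\<rho> w))"
      have "\<phi> (\<rho> w) = - \<phi> (\<rho> v)" using phi[OF rU(1)] by (simp add: \<rho>'_def)
      moreover have "\<psi> (\<rho> v) = - \<psi> v" "\<psi> (\<rho> w) = - \<psi> w"
        using rU w(2) by (simp_all add: \<psi>_def)
      moreover have "\<psi> (\<rho> u) = - \<psi> u" if "u \<in> ?U" for u
      proof (cases "u = \<rho> v \<or> u = \<rho> w")
        case True
        then show ?thesis using rv rw that w(2) by (elim disjE) (simp_all add: \<psi>_def)
      next
        case False
        then have "\<rho>' u = \<rho> u" by (simp add: \<rho>'_def)
        then show ?thesis using phi[OF that] rho_out[OF that] False that by (auto simp: \<psi>_def)
      qed
      moreover have "\<psi> u = \<phi> u" "\<mu> u \<in> ?U" if "u \<in> ?U" for u using mu'[OF that] that by (auto simp: \<psi>_def)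
      moreover have "\<psi> v = - \<phi> (\<rho> v)" "\<psi> w = - \<phi> (\<rho> w)" using w(2) by (simp_all add: \<psi>_def)
      moreover note phi[OF rU(1)] phi[OF rU(2)]
      ultimately have *: "\<phi> (\<rho> w) = - \<phi> (\<rho> v)" "\<psi> (\<rho> v) = - \<psi> v" "\<psi> (\<rho> w) = - \<psi> w"
        "\<psi> v = - \<phi> (\<rho> v)" "\<psi> w = - \<phi> (\<rho> w)" "\<phi> (\<rho> v) = 1 \<or> \<phi> (\<rho> v) = - 1"
        "\<And>u. u \<in> ?U \<Longrightarrow> \<psi> (\<rho> u) = - \<psi> u" "\<And>u. u \<in> ?U \<Longrightarrow> \<psi> u = \<phi> u"
        "\<And>u. u \<in> ?U \<Longrightarrow> \<mu> u \<in> ?U" by blast+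
      have "(\<psi> u = 1 \<or> \<psi> u = - 1) \<and> \<psi> (\<mu> u) = - \<psi> u \<and> \<psi> (\<rho> u) = - \<psi> u"
        if "u \<in> V" for u
      proof (cases "u \<in> ?U")
        case True
        then show ?thesis using phi[OF True] *(7)[OF True] *(8)[OF True] *(8)[OF *(9)[OF True]] by simp
      next
        case False
        then have "u = v \<or> u = w" using that by blast
        then show ?thesis using *(1-6) w(3) w_def by (elim disjE) simp_all
      qed
      then show ?thesis by blast
    qed
  qed simp
qed

locale loopless_multigraph =
  fixes V :: "'v set" and E :: "'e set" and ends :: "'e \<Rightarrow> 'v set"
  assumes finite_V: "finite V" and finite_E: "finite E"
    and ends_V: "e \<in> E \<Longrightarrow> ends e \<subseteq> V" and card_ends: "e \<in> E \<Longrightarrow> card (ends e) = 2"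
begin

definition cut :: "'v set \<Rightarrow> 'e set" where
  "cut S = {e \<in> E. ends e \<inter> S \<noteq> {} \<and> ends e - S \<noteq> {}}"

definition deg :: "'e set \<Rightarrow> 'v \<Rightarrow> nat" where
  "deg A v = card {e \<in> A. v \<in> ends e}"

lemma ends_obtain:
  assumes "e \<in> E" obtains a b where "ends e = {a, b}" "a \<noteq> b" "a \<in> V" "b \<in> V"
  using card_ends[OF assms] ends_V[OF assms] unfolding card_2_iff by blast

lemma ends_obtain_other:
  assumes "e \<in> E" "a \<in> ends e" obtains b where "ends e = {a, b}" "a \<noteq> b" "a \<in> V" "b \<in> V"
proof -
  obtain p q where pq: "ends e = {p, q}" "p \<noteq> q" "p \<in> V" "q \<in> V" using ends_obtain[OF assms(1)] .
  then consider "a = p" | "a = q" using assms(2) by blast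
  then show thesis
  proof cases
    case 1 then show thesis using that[of q] pq by blast
  next
    case 2 then show thesis using that[of p] pq by (simp add: insert_commute)
  qed
qed

lemma finite_sub_E: "A \<subseteq> E \<Longrightarrow> finite A" using finite_E finite_subset by blast
lemma finite_sub_V: "S \<subseteq> V \<Longrightarrow> finite S" using finite_V finite_subset by blast
lemma cut_sub: "cut S \<subseteq> E" by (auto simp: cut_def)
lemma finite_cut [simp]: "finite (cut S)" using cut_sub finite_sub_E by blast

lemma cut_compl: "cut (V - S) = cut S"
  using ends_V by (auto simp: cut_def)

lemma cut_iff:
  assumes "e \<in> E" "ends e = {a, b}" shows "e \<in> cut S \<longleftrightarrow> (a \<in> S) \<noteq> (b \<in> S)"
  using assms by (auto simp: cut_def)

lemma cut_obtain:
  assumes "e \<in> cut S" obtains a b where "e \<in> E" "ends e = {a, b}" "a \<noteq> b" "a \<in> S" "b \<notin> S" "a \<in> V" "b \<in> V"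
proof -
  have e: "e \<in> E" using assms cut_sub by blast
  obtain a b where ab: "ends e = {a, b}" "a \<noteq> b" "a \<in> V" "b \<in> V" using ends_obtain[OF e] .
  then show thesis using that[of a b] that[of b a] assms cut_iff[OF e ab(1)] e by (auto simp: insert_commute)
qed

lemma cut_inner:
  assumes "e \<in> cut S" obtains a where "ends e \<inter> S = {a}" "a \<in> S"
proof -
  obtain a b where "ends e = {a, b}" "a \<in> S" "b \<notin> S" using cut_obtain[OF assms] .
  then show thesis using that[of a] by auto
qed

text \<open>Double counting of incidences with a weight on the vertices. The weight 1 gives the
  handshake lemma; a colouring as weight makes the bichromatic edges inside \<open>S\<close>
  vanish.\<close>

lemma sum_deg:
  fixes w :: "'v \<Rightarrow> int"
  assumes "A \<subseteq> E" "S \<subseteq> V"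
  shows "(\<Sum>v\<in>S. w v * int (deg A v)) =
    (\<Sum>e | e \<in> A \<and> ends e \<subseteq> S. sum w (ends e)) + (\<Sum>e\<in>A \<inter> cut S. sum w (ends e \<inter> S))"
proof -
  have fin: "finite A" "finite S" using assms finite_sub_E finite_sub_V by auto
  have "(\<Sum>v\<in>S. w v * int (deg A v)) = (\<Sum>v\<in>S. \<Sum>e\<in>A. if v \<in> ends e then w v else 0)"
  proof (intro sum.cong refl)
    fix v
    show "w v * int (deg A v) = (\<Sum>e\<in>A. if v \<in> ends e then w v else 0)"
      using fin by (simp add: deg_def sum.inter_filter[symmetric])
  qed
  also have "\<dots> = (\<Sum>e\<in>A. \<Sum>v\<in>S. if v \<in> ends e then w v else 0)" by (rule sum.swap)
  also have "\<dots> = (\<Sum>e\<in>A. sum w (ends e \<inter> S))"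
    using fin by (simp add: sum.inter_restrict[symmetric] Int_commute)
  also have "\<dots> = (\<Sum>e\<in>{e. e \<in> A \<and> ends e \<subseteq> S} \<union> (A \<inter> cut S). sum w (ends e \<inter> S))"
  proof (rule sum.mono_neutral_right)
    show "\<forall>e\<in>A - ({e. e \<in> A \<and> ends e \<subseteq> S} \<union> A \<inter> cut S). sum w (ends e \<inter> S) = 0"
    proof
      fix e assume "e \<in> A - ({e. e \<in> A \<and> ends e \<subseteq> S} \<union> A \<inter> cut S)"
      then have "ends e \<inter> S = {}" using assms by (auto simp: cut_def)
      then show "sum w (ends e \<inter> S) = 0" by simp
    qed
  qed (use fin in auto)
  also have "\<dots> = (\<Sum>e | e \<in> A \<and> ends e \<subseteq> S. sum w (ends e \<inter> S)) + (\<Sum>e\<in>A \<inter> cut S. sum w (ends e \<inter> S))"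
    using fin by (intro sum.union_disjoint) (auto simp: cut_def)
  also have "(\<Sum>e | e \<in> A \<and> ends e \<subseteq> S. sum w (ends e \<inter> S)) = (\<Sum>e | e \<in> A \<and> ends e \<subseteq> S. sum w (ends e))"
    by (intro sum.cong) (auto simp: Int_absorb2)
  finally show ?thesis .
qed

lemma handshake:
  assumes "A \<subseteq> E" "S \<subseteq> V"
  shows "(\<Sum>v\<in>S. deg A v) = 2 * card {e \<in> A. ends e \<subseteq> S} + card (A \<inter> cut S)"
proof -
  have "(\<Sum>e | e \<in> A \<and> ends e \<subseteq> S. sum (\<lambda>_. 1::int) (ends e)) = (\<Sum>e | e \<in> A \<and> ends e \<subseteq> S. 2)"
    using assms card_ends by (intro sum.cong) auto
  moreover have "(\<Sum>e\<in>A \<inter> cut S. sum (\<lambda>_. 1::int) (ends e \<inter> S)) = (\<Sum>e\<in>A \<inter> cut S. 1)"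
  proof (intro sum.cong refl)
    fix e assume "e \<in> A \<inter> cut S"
    then obtain a where "ends e \<inter> S = {a}" using cut_inner by blast
    then show "sum (\<lambda>_. 1::int) (ends e \<inter> S) = 1" by simp
  qed
  ultimately have "int (\<Sum>v\<in>S. deg A v) = int (2 * card {e \<in> A. ends e \<subseteq> S} + card (A \<inter> cut S))"
    using sum_deg[OF assms, of "\<lambda>_. 1"] by simp
  then show ?thesis by (simp only: of_nat_eq_iff)
qed

lemma deg_mono: "A \<subseteq> B \<Longrightarrow> B \<subseteq> E \<Longrightarrow> deg A v \<le> deg B v"
  unfolding deg_def by (intro card_mono) (auto dest: finite_sub_E)

lemma deg_diff:
  assumes "A \<subseteq> B" "B \<subseteq> E" shows "deg (B - A) v = deg B v - deg A v"
proof -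
  have "{e \<in> B - A. v \<in> ends e} = {e \<in> B. v \<in> ends e} - {e \<in> A. v \<in> ends e}" by auto
  then show ?thesis unfolding deg_def using assms finite_sub_E[of A]
    by (simp add: card_Diff_subset Collect_mono subset_iff)
qed

lemma card_cut_submodular:
  "card (cut (X \<inter> Y)) + card (cut (X \<union> Y)) \<le> card (cut X) + card (cut Y)"
proof -
  have c: "card (cut S) = (\<Sum>e\<in>E. if e \<in> cut S then 1 else 0)" for S
    using finite_E cut_sub[of S] by (simp add: sum.If_cases Int_absorb1)
  show ?thesis unfolding c sum.distrib[symmetric]
  proof (rule sum_mono)
    fix e assume e: "e \<in> E"
    obtain a b where ab: "ends e = {a, b}" using ends_obtain[OF e] .
    show "(if e \<in> cut (X \<inter> Y) then 1 else 0) + (if e \<in> cut (X \<union> Y) then 1 else 0)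
      \<le> (if e \<in> cut X then 1 else 0) + (if e \<in> cut Y then 1 else (0::nat))"
      unfolding cut_iff[OF e ab] by auto
  qed
qed

lemma deg_sym_diff:
  assumes "A \<subseteq> E" "B \<subseteq> E"
  shows "odd (deg (A - B \<union> (B - A)) v) \<longleftrightarrow> odd (deg A v) \<noteq> odd (deg B v)"
proof -
  have "{e \<in> A - B \<union> (B - A). v \<in> ends e} =
    ({e \<in> A. v \<in> ends e} - {e \<in> B. v \<in> ends e}) \<union> ({e \<in> B. v \<in> ends e} - {e \<in> A. v \<in> ends e})" by auto
  then show ?thesis unfolding deg_def using assms finite_sub_E by (simp add: card_sym_diff_parity)
qed

text \<open>Converts a set of edges with degree 1 on \<open>U\<close> into a fixed-point-free
  involution, the form that \<open>involutions_bipartite\<close> works with.\<close>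

lemma matching_partner:
  assumes "A \<subseteq> E" "U \<subseteq> V" and deg: "\<And>v. v \<in> V \<Longrightarrow> deg A v = (if v \<in> U then 1 else 0)"
  obtains \<rho> where "\<And>v. v \<in> U \<Longrightarrow> \<rho> v \<in> U \<and> \<rho> v \<noteq> v \<and> \<rho> (\<rho> v) = v"
    "\<And>e v. e \<in> A \<Longrightarrow> v \<in> ends e \<Longrightarrow> v \<in> U \<and> ends e = {v, \<rho> v}"
proof -
  have U: "v \<in> U" if "e \<in> A" "v \<in> ends e" for e v
  proof (rule ccontr)
    assume "v \<notin> U"
    then have "deg A v = 0" using deg that assms(1) ends_V by (metis subsetD)
    then have "{e \<in> A. v \<in> ends e} = {}" using finite_sub_E[OF assms(1)] by (simp add: deg_def)
    then show False using that by blast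
  qed
  have "\<exists>e. {e \<in> A. v \<in> ends e} = {e}" if "v \<in> U" for v
    using deg[of v] that assms(2) by (auto simp: deg_def card_1_singleton_iff)
  then obtain g where g: "\<And>v. v \<in> U \<Longrightarrow> {e \<in> A. v \<in> ends e} = {g v}" by metis
  have "\<exists>w. ends (g v) = {v, w} \<and> w \<noteq> v" if "v \<in> U" for v
  proof -
    have "g v \<in> E" "v \<in> ends (g v)" using g[OF that] assms(1) by auto
    then show ?thesis using ends_obtain_other by metis
  qed
  then obtain \<rho> where rho: "\<And>v. v \<in> U \<Longrightarrow> ends (g v) = {v, \<rho> v} \<and> \<rho> v \<noteq> v" by metis
  have e_g: "e = g v" if "e \<in> A" "v \<in> ends e" for e v
    using g[OF U[OF that]] that by auto
  show thesis
  proof (rule that[of \<rho>])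
    fix v assume v: "v \<in> U"
    have gA: "g v \<in> A" using g[OF v] by blast
    have r: "\<rho> v \<in> ends (g v)" using rho[OF v] by blast
    have rU: "\<rho> v \<in> U" using U[OF gA r] .
    have "g v = g (\<rho> v)" using e_g[OF gA r] .
    then have "{v, \<rho> v} = {\<rho> v, \<rho> (\<rho> v)}" using rho[OF v] rho[OF rU] by simp
    then have "\<rho> (\<rho> v) = v" using rho[OF v] rho[OF rU] by (metis doubleton_eq_iff)
    then show "\<rho> v \<in> U \<and> \<rho> v \<noteq> v \<and> \<rho> (\<rho> v) = v" using rU rho[OF v] by blast
  next
    fix e v assume "e \<in> A" "v \<in> ends e"
    then show "v \<in> U \<and> ends e = {v, \<rho> v}" using U e_g rho by metis
  qed
qed

end

section \<open>Cubic graphs with a 2-factor\<close>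

text \<open>\<open>\<K>\<close> holds the vertex sets of the circuits of the 2-factor
  \<open>E - M\<close>. Connectedness is expressed by cuts: no edge of the 2-factor leaves a member,
  but some edge leaves each of its nonempty proper parts. Circuits thus enter through parity and
  cuts, without a cyclic order of their vertices.\<close>

locale cubic_two_factor = loopless_multigraph V E ends
  for V :: "'v set" and E :: "'e set" and ends :: "'e \<Rightarrow> 'v set" +
  fixes M :: "'e set" and \<K> :: "'v set set"
  assumes M_sub: "M \<subseteq> E"
    and deg_M: "v \<in> V \<Longrightarrow> deg M v = 1"
    and deg_F: "v \<in> V \<Longrightarrow> deg (E - M) v = 2"
    and no_bridge: "S \<subseteq> V \<Longrightarrow> card (cut S) \<noteq> 1"
    and union_\<K>: "\<Union>\<K> = V"
    and empty_\<K>: "{} \<notin> \<K>"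
    and disjoint_\<K>: "\<lbrakk>K \<in> \<K>; K' \<in> \<K>; K \<noteq> K'\<rbrakk> \<Longrightarrow> K \<inter> K' = {}"
    and closed_\<K>: "K \<in> \<K> \<Longrightarrow> (E - M) \<inter> cut K = {}"
    and connected_\<K>: "\<lbrakk>K \<in> \<K>; S \<subseteq> K; S \<noteq> {}; S \<noteq> K\<rbrakk> \<Longrightarrow> (E - M) \<inter> cut S \<noteq> {}"
begin

definition F :: "'e set" where "F = E - M"

definition odd_comps :: "'v set set" where "odd_comps = {K \<in> \<K>. odd (card K)}"

lemma F_sub: "F \<subseteq> E" by (auto simp: F_def)
lemma odd_compsD: "K \<in> odd_comps \<Longrightarrow> K \<in> \<K>" by (auto simp: odd_comps_def)
lemma finite_F_cut [simp]: "finite (F \<inter> cut S)" "finite (M \<inter> cut S)" by auto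
lemma \<K>_sub: "K \<in> \<K> \<Longrightarrow> K \<subseteq> V" using union_\<K> by blast
lemma finite_\<K>: "finite \<K>" using union_\<K> finite_V finite_UnionD by metis
lemma deg_F2: "v \<in> V \<Longrightarrow> deg F v = 2" unfolding F_def by (rule deg_F)

lemma \<K>_eq: "\<lbrakk>K \<in> \<K>; K' \<in> \<K>; v \<in> K; v \<in> K'\<rbrakk> \<Longrightarrow> K = K'"
  using disjoint_\<K> by blast

lemma card_cut_split: "card (cut S) = card (M \<inter> cut S) + card (F \<inter> cut S)"
proof -
  have "cut S = (M \<inter> cut S) \<union> (F \<inter> cut S)" using cut_sub[of S] by (auto simp: F_def)
  then have "card (cut S) = card ((M \<inter> cut S) \<union> (F \<inter> cut S))" by simp
  also have "\<dots> = card (M \<inter> cut S) + card (F \<inter> cut S)"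
    by (intro card_Un_disjoint) (auto simp: F_def)
  finally show ?thesis .
qed

section \<open>Parity of cuts along M and along the circuits\<close>

lemma F_cut_even:
  assumes "S \<subseteq> V" shows "even (card (F \<inter> cut S))"
proof -
  have "(\<Sum>v\<in>S. deg F v) = (\<Sum>v\<in>S. 2)" using assms by (intro sum.cong refl deg_F2) auto
  then have "2 * card S = 2 * card {e \<in> F. ends e \<subseteq> S} + card (F \<inter> cut S)"
    using handshake[OF F_sub assms] by simp
  then have "even (2 * card {e \<in> F. ends e \<subseteq> S} + card (F \<inter> cut S))" by (metis dvd_triv_left)
  then show ?thesis by simp
qed

lemma M_cut_parity:
  assumes "S \<subseteq> V" shows "even (card (M \<inter> cut S)) \<longleftrightarrow> even (card S)"
proof -
  have "(\<Sum>v\<in>S. deg M v) = (\<Sum>v\<in>S. 1)" using assms by (intro sum.cong refl deg_M) auto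
  then have "card S = 2 * card {e \<in> M. ends e \<subseteq> S} + card (M \<inter> cut S)"
    using handshake[OF M_sub assms] by simp
  then show ?thesis by presburger
qed

lemma F_edge_comp:
  assumes "e \<in> F" "K \<in> \<K>" "v \<in> ends e" "v \<in> K" shows "ends e \<subseteq> K"
proof -
  have "e \<notin> cut K" using closed_\<K>[OF assms(2)] assms(1) by (auto simp: F_def)
  then show ?thesis using assms F_sub by (auto simp: cut_def)
qed

lemma F_edge_obtain:
  assumes "e \<in> F" obtains K where "K \<in> \<K>" "ends e \<subseteq> K"
proof -
  have "e \<in> E" using assms F_sub by blast
  then obtain a b where "ends e = {a, b}" "a \<in> V" using ends_obtain by blast
  then obtain K where "K \<in> \<K>" "a \<in> K" using union_\<K> by blast
  then show thesis using that F_edge_comp[OF assms] \<open>ends e = {a, b}\<close> by blast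
qed

lemma F_cut_comp:
  assumes "K \<in> \<K>" shows "F \<inter> cut (S \<inter> K) = {e \<in> F \<inter> cut S. ends e \<subseteq> K}"
  using F_edge_comp[OF _ assms] by (fastforce simp: cut_def)

lemma F_cut_comp_diff:
  assumes "K \<in> \<K>" shows "F \<inter> cut (K - S) = F \<inter> cut (S \<inter> K)"
  using F_edge_comp[OF _ assms] by (fastforce simp: cut_def)

lemma F_cut_comp_empty:
  assumes "K \<in> \<K>" "F \<inter> cut (S \<inter> K) = {}" shows "K \<subseteq> S \<or> K \<inter> S = {}"
  using connected_\<K>[OF assms(1), of "S \<inter> K"] assms(2) unfolding F_def by blast

lemma F_cut_comp_empty_iff:
  assumes "K \<in> \<K>" shows "F \<inter> cut (S \<inter> K) = {} \<longleftrightarrow> K \<subseteq> S \<or> K \<inter> S = {}"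
proof
  assume "K \<subseteq> S \<or> K \<inter> S = {}"
  then show "F \<inter> cut (S \<inter> K) = {}"
  proof
    assume "K \<subseteq> S" then have "S \<inter> K = K" by blast
    then show ?thesis using closed_\<K>[OF assms] by (simp add: F_def)
  qed (auto simp: cut_def Int_commute)
qed (rule F_cut_comp_empty[OF assms])

lemma F_cut_comp_even:
  assumes "K \<in> \<K>" shows "even (card (F \<inter> cut (S \<inter> K)))"
  using \<K>_sub[OF assms] by (intro F_cut_even) auto

lemma F_cut_comp_ge2:
  assumes "K \<in> \<K>" "F \<inter> cut (S \<inter> K) \<noteq> {}" shows "2 \<le> card (F \<inter> cut (S \<inter> K))"
proof -
  have "even n \<Longrightarrow> n \<noteq> 0 \<Longrightarrow> 2 \<le> n" for n :: nat by presburger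
  moreover have "card (F \<inter> cut (S \<inter> K)) \<noteq> 0" using assms(2) by simp
  ultimately show ?thesis using F_cut_comp_even[OF assms(1)] by blast
qed

lemma F_cut_UN: "F \<inter> cut S = (\<Union>K\<in>\<K>. F \<inter> cut (S \<inter> K))"
proof
  show "F \<inter> cut S \<subseteq> (\<Union>K\<in>\<K>. F \<inter> cut (S \<inter> K))"
  proof
    fix e assume e: "e \<in> F \<inter> cut S"
    then obtain K where K: "K \<in> \<K>" "ends e \<subseteq> K" using F_edge_obtain by blast
    then have "e \<in> F \<inter> cut (S \<inter> K)" using e unfolding F_cut_comp[OF K(1)] by blast
    then show "e \<in> (\<Union>K\<in>\<K>. F \<inter> cut (S \<inter> K))" using K(1) by blast
  qed
  show "(\<Union>K\<in>\<K>. F \<inter> cut (S \<inter> K)) \<subseteq> F \<inter> cut S"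
  proof
    fix e assume "e \<in> (\<Union>K\<in>\<K>. F \<inter> cut (S \<inter> K))"
    then obtain K where "K \<in> \<K>" "e \<in> F \<inter> cut (S \<inter> K)" by blast
    then show "e \<in> F \<inter> cut S" using F_cut_comp by blast
  qed
qed

lemma F_cut_comp_disjoint:
  assumes "K \<in> \<K>" "K' \<in> \<K>" "K \<noteq> K'" shows "(F \<inter> cut (S \<inter> K)) \<inter> (F \<inter> cut (S \<inter> K')) = {}"
proof -
  have False if e: "ends e \<subseteq> K" "ends e \<subseteq> K'" "e \<in> F" for e
  proof -
    have "e \<in> E" using e(3) F_sub by blast
    then obtain a where "a \<in> ends e" using ends_obtain by blast
    then show False using disjoint_\<K>[OF assms] e(1,2) by blast
  qed
  then show ?thesis unfolding F_cut_comp[OF assms(1)] F_cut_comp[OF assms(2)] by blast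
qed

text \<open>Replaces a path from \<open>u\<close> to \<open>v\<close>. The set \<open>W\<close> of
  vertices \<open>v\<close> that admit such an \<open>S\<close> is left by no F-edge, because adding
  that edge modulo 2 would move the odd vertex across it; so \<open>W\<close> is the whole
  circuit.\<close>

lemma exists_pair_join:
  assumes K: "K \<in> \<K>" "u \<in> K" "v \<in> K"
  shows "\<exists>S\<subseteq>F. \<forall>w\<in>V. odd (deg S w) \<longleftrightarrow> (w = u) \<noteq> (w = v)"
proof -
  define W where "W = {v \<in> K. \<exists>S\<subseteq>F. \<forall>w\<in>V. odd (deg S w) \<longleftrightarrow> (w = u) \<noteq> (w = v)}"
  have "u \<in> W" using K by (auto simp: W_def deg_def intro!: exI[of _ "{}"])
  moreover have "W \<subseteq> K" by (auto simp: W_def)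
  moreover have "F \<inter> cut W = {}"
  proof (rule ccontr)
    assume "F \<inter> cut W \<noteq> {}"
    then obtain e where e: "e \<in> F" "e \<in> cut W" by blast
    obtain a b where ab: "e \<in> E" "ends e = {a, b}" "a \<noteq> b" "a \<in> W" "b \<notin> W" using cut_obtain[OF e(2)] .
    have bK: "b \<in> K" using F_edge_comp[OF e(1) K(1), of a] ab \<open>W \<subseteq> K\<close> by auto
    obtain S where S: "S \<subseteq> F" "\<And>w. w \<in> V \<Longrightarrow> odd (deg S w) \<longleftrightarrow> (w = u) \<noteq> (w = a)"
      using ab(4) by (auto simp: W_def)
    have d1: "odd (deg {e} w) \<longleftrightarrow> w = a \<or> w = b" for w
    proof -
      have "{e' \<in> {e}. w \<in> ends e'} = (if w = a \<or> w = b then {e} else {})" using ab(2) by auto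
      then show ?thesis by (simp add: deg_def)
    qed
    have "odd (deg (S - {e} \<union> ({e} - S)) w) \<longleftrightarrow> (w = u) \<noteq> (w = b)" if "w \<in> V" for w
      using deg_sym_diff[of S "{e}" w] S(1) F_sub ab(1,3) S(2)[OF that] d1[of w] by auto
    moreover have "S - {e} \<union> ({e} - S) \<subseteq> F" using S(1) e(1) by auto
    ultimately have "b \<in> W" using bK unfolding W_def by blast
    then show False using ab(5) by blast
  qed
  ultimately have "W = K" using connected_\<K>[OF K(1), of W] unfolding F_def by blast
  then show ?thesis using K(3) by (auto simp: W_def)
qed

text \<open>This is a T-join with \<open>B\<close> as its set of odd vertices. Two members of
  \<open>B\<close> on a common circuit are split off and joined; symmetric differences add the
  degree parities.\<close>

lemma exists_join:
  assumes "B \<subseteq> V" "\<And>K. K \<in> \<K> \<Longrightarrow> even (card (B \<inter> K))"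
  shows "\<exists>S\<subseteq>F. \<forall>w\<in>V. odd (deg S w) \<longleftrightarrow> w \<in> B"
  using assms
proof (induction "card B" arbitrary: B rule: less_induct)
  case less
  show ?case
  proof (cases "B = {}")
    case True
    then show ?thesis by (auto simp: deg_def intro!: exI[of _ "{}"])
  next
    case False
    then obtain u where u: "u \<in> B" by blast
    then obtain K where K: "K \<in> \<K>" "u \<in> K" using less.prems(1) union_\<K> by blast
    have fin: "finite B" using less.prems(1) finite_sub_V by blast
    have "B \<inter> K \<noteq> {u}" using less.prems(2)[OF K(1)] by force
    then obtain v where v: "v \<in> B" "v \<in> K" "v \<noteq> u" using u K by blast
    have "even (card ((B - {u, v}) \<inter> K'))" if K': "K' \<in> \<K>" for K'
    proof (cases "K' = K")
      case True
      have "(B - {u, v}) \<inter> K' = (B \<inter> K) - {u, v}" using True by auto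
      then have "card ((B - {u, v}) \<inter> K') = card (B \<inter> K) - 2"
        using u v K fin by (simp add: card_Diff_subset)
      then show ?thesis using less.prems(2)[OF K(1)] by simp
    next
      case False
      then have "u \<notin> K'" "v \<notin> K'" using \<K>_eq[OF K(1) K'] K(2) v(2) by auto
      then have "(B - {u, v}) \<inter> K' = B \<inter> K'" by auto
      then show ?thesis using less.prems(2)[OF K'] by simp
    qed
    moreover have "card (B - {u, v}) < card B" using u fin by (intro psubset_card_mono) auto
    ultimately obtain S where S: "S \<subseteq> F" "\<And>w. w \<in> V \<Longrightarrow> odd (deg S w) \<longleftrightarrow> w \<in> B - {u, v}"
      using less.hyps[of "B - {u, v}"] less.prems(1) by blast
    obtain P where P: "P \<subseteq> F" "\<And>w. w \<in> V \<Longrightarrow> odd (deg P w) \<longleftrightarrow> (w = u) \<noteq> (w = v)"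
      using exists_pair_join[OF K v(2)] by blast
    have "odd (deg (S - P \<union> (P - S)) w) \<longleftrightarrow> w \<in> B" if "w \<in> V" for w
      using deg_sym_diff[of S P w] S(1) P(1) F_sub S(2)[OF that] P(2)[OF that] u v by auto
    moreover have "S - P \<union> (P - S) \<subseteq> F" using S(1) P(1) by auto
    ultimately show ?thesis by blast
  qed
qed

definition transversal :: "'v set \<Rightarrow> bool" where
  "transversal Z \<longleftrightarrow> Z \<subseteq> V \<and> (\<forall>K\<in>\<K>. card (Z \<inter> K) = (if odd (card K) then 1 else 0))"

definition matching_off :: "'v set \<Rightarrow> 'e set \<Rightarrow> bool" where
  "matching_off Z R \<longleftrightarrow> R \<subseteq> F \<and> (\<forall>v\<in>V. deg R v = (if v \<in> Z then 0 else 1))"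

text \<open>A join for \<open>V - Z\<close> has degree 1 off \<open>Z\<close> and degree 0 or 2 on
  \<open>Z\<close>. On the circuits whose chosen vertex has degree 2 (\<open>bad\<close>) it is
  replaced by its complement within the circuit, which turns 2 into 0 and keeps 1.\<close>

lemma exists_matching_off:
  assumes Z: "transversal Z" shows "\<exists>R. matching_off Z R"
proof -
  have ZV: "Z \<subseteq> V" and Zc: "\<And>K. K \<in> \<K> \<Longrightarrow> card (Z \<inter> K) = (if odd (card K) then 1 else 0)"
    using Z by (auto simp: transversal_def)
  have "even (card ((V - Z) \<inter> K))" if K: "K \<in> \<K>" for K
  proof -
    have "(V - Z) \<inter> K = K - (Z \<inter> K)" using \<K>_sub[OF K] by auto
    moreover have "card (K - (Z \<inter> K)) = card K - card (Z \<inter> K)"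
      using finite_sub_V[OF \<K>_sub[OF K]] by (intro card_Diff_subset) auto
    ultimately show ?thesis using Zc[OF K] by (cases "odd (card K)") auto
  qed
  then obtain S where S: "S \<subseteq> F" "\<And>w. w \<in> V \<Longrightarrow> odd (deg S w) \<longleftrightarrow> w \<in> V - Z"
    using exists_join[of "V - Z"] by blast
  define bad where "bad K \<longleftrightarrow> (\<exists>x\<in>Z \<inter> K. deg S x \<noteq> 0)" for K
  define A where "A = {e \<in> F. \<exists>K\<in>\<K>. bad K \<and> ends e \<subseteq> K}"
  define R where "R = {e \<in> F. (e \<in> S) \<noteq> (e \<in> A)}"
  have deg_le: "deg S v \<le> 2" if "v \<in> V" for v using deg_mono[OF S(1) F_sub, of v] deg_F2[OF that] by simp
  have "deg R v = (if v \<in> Z then 0 else 1)" if v: "v \<in> V" for v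
  proof -
    obtain K where K: "K \<in> \<K>" "v \<in> K" using v union_\<K> by blast
    have A: "e \<in> A \<longleftrightarrow> bad K" if "e \<in> F" "v \<in> ends e" for e
    proof
      assume "e \<in> A"
      then obtain K' where "K' \<in> \<K>" "bad K'" "ends e \<subseteq> K'" by (auto simp: A_def)
      then show "bad K" using \<K>_eq[OF K(1) _ K(2)] that by blast
    next
      assume "bad K" then show "e \<in> A" using that K F_edge_comp[OF that(1) K(1) that(2) K(2)] by (auto simp: A_def)
    qed
    show ?thesis
    proof (cases "bad K")
      case True
      then obtain x where x: "x \<in> Z \<inter> K" "deg S x \<noteq> 0" by (auto simp: bad_def)
      have vx: "v \<in> Z \<longleftrightarrow> v = x"
      proof
        assume "v \<in> Z"
        have "card (Z \<inter> K) \<le> 1" using Zc[OF K(1)] by simp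
        then show "v = x" using x K \<open>v \<in> Z\<close> finite_sub_V[OF ZV]
          by (metis IntI One_nat_def card_le_Suc0_iff_eq finite_Int)
      qed (use x in blast)
      have "{e \<in> R. v \<in> ends e} = {e \<in> F - S. v \<in> ends e}" using True A by (auto simp: R_def)
      then have "deg R v = 2 - deg S v" using deg_diff[OF S(1) F_sub, of v] deg_F2[OF v] by (simp add: deg_def)
      moreover have "odd (deg S v) \<longleftrightarrow> v \<notin> Z" using S(2)[OF v] v by blast
      ultimately show ?thesis using deg_le[OF v] vx x(2)
        by (cases "v \<in> Z") (auto simp: le_Suc_eq numeral_2_eq_2)
    next
      case False
      have "{e \<in> R. v \<in> ends e} = {e \<in> S. v \<in> ends e}" using False A S(1) by (auto simp: R_def)
      then have "deg R v = deg S v" by (simp add: deg_def)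
      moreover have "odd (deg S v) \<longleftrightarrow> v \<notin> Z" using S(2)[OF v] v by blast
      moreover have "v \<in> Z \<Longrightarrow> deg S v = 0" using False K by (auto simp: bad_def)
      ultimately show ?thesis using deg_le[OF v]
        by (cases "v \<in> Z") (auto simp: le_Suc_eq numeral_2_eq_2)
    qed
  qed
  then show ?thesis by (intro exI[of _ R]) (auto simp: matching_off_def R_def)
qed

text \<open>Bichromatic edges are described by a vanishing sum, so that \<open>sum_deg\<close> can
  discard the edges inside a set directly.\<close>

definition proper :: "'e set \<Rightarrow> ('v \<Rightarrow> int) \<Rightarrow> bool" where
  "proper R \<phi> \<longleftrightarrow> (\<forall>v\<in>V. \<phi> v = 1 \<or> \<phi> v = - 1) \<and> (\<forall>e\<in>M \<union> R. sum \<phi> (ends e) = 0)"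

text \<open>The pairing \<open>\<pi>\<close> acts like extra edges between the chosen vertices:
  together with the partners in \<open>R\<close> it forms an involution of all of \<open>V\<close>,
  and the other involution comes from \<open>M\<close>.\<close>

lemma exists_proper:
  assumes Z: "Z \<subseteq> V" "matching_off Z R"
    and pi: "\<And>x. x \<in> Z \<Longrightarrow> \<pi> x \<in> Z \<and> \<pi> x \<noteq> x \<and> \<pi> (\<pi> x) = x"
  shows "\<exists>\<phi>. proper R \<phi> \<and> (\<forall>x\<in>Z. \<phi> (\<pi> x) = - \<phi> x)"
proof -
  have degM: "deg M v = (if v \<in> V then 1 else 0)" if "v \<in> V" for v using deg_M that by simp
  obtain \<mu> where mu: "\<And>v. v \<in> V \<Longrightarrow> \<mu> v \<in> V \<and> \<mu> v \<noteq> v \<and> \<mu> (\<mu> v) = v"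
    "\<And>e v. e \<in> M \<Longrightarrow> v \<in> ends e \<Longrightarrow> v \<in> V \<and> ends e = {v, \<mu> v}"
    using matching_partner[OF M_sub subset_refl degM] by blast
  have R: "R \<subseteq> E" and degR: "\<And>v. v \<in> V \<Longrightarrow> deg R v = (if v \<in> V - Z then 1 else 0)"
    using Z(2) F_sub by (auto simp: matching_off_def)
  obtain \<rho> where rho: "\<And>v. v \<in> V - Z \<Longrightarrow> \<rho> v \<in> V - Z \<and> \<rho> v \<noteq> v \<and> \<rho> (\<rho> v) = v"
    "\<And>e v. e \<in> R \<Longrightarrow> v \<in> ends e \<Longrightarrow> v \<in> V - Z \<and> ends e = {v, \<rho> v}"
    using matching_partner[OF R _ degR] by blast
  let ?r = "\<lambda>v. if v \<in> Z then \<pi> v else \<rho> v"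
  have r: "?r v \<in> V \<and> ?r v \<noteq> v \<and> ?r (?r v) = v" if "v \<in> V" for v
    using that pi[of v] rho(1)[of v] Z(1) by (cases "v \<in> Z") auto
  obtain \<phi> :: "'v \<Rightarrow> int" where phi: "\<And>v. v \<in> V \<Longrightarrow>
      (\<phi> v = 1 \<or> \<phi> v = - 1) \<and> \<phi> (\<mu> v) = - \<phi> v \<and> \<phi> (?r v) = - \<phi> v"
    using involutions_bipartite[OF finite_V mu(1) r] by blast
  have "sum \<phi> (ends e) = 0" if "e \<in> M \<union> R" for e
  proof -
    have "e \<in> E" using that M_sub R by blast
    then obtain v where v: "v \<in> ends e" using ends_obtain by blast
    show ?thesis
    proof (cases "e \<in> M")
      case True
      then show ?thesis using mu(2)[OF True v] mu(1)[of v] phi[of v] by auto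
    next
      case False
      then have "e \<in> R" using that by blast
      then show ?thesis using rho(2)[OF \<open>e \<in> R\<close> v] rho(1)[of v] phi[of v] by auto
    qed
  qed
  moreover have "\<phi> (\<pi> x) = - \<phi> x" if "x \<in> Z" for x using phi[of x] that Z(1) by auto
  ultimately show ?thesis using phi by (intro exI[of _ \<phi>]) (auto simp: proper_def)
qed

end

section \<open>Proper colourings and their violating cuts\<close>

lemma sum_signs:
  fixes g :: "'a \<Rightarrow> int"
  assumes "finite A" "\<And>a. a \<in> A \<Longrightarrow> g a = 1 \<or> g a = - 1"
  shows "sum g A \<le> int (card A)" "even (sum g A + int (card A))"
    "sum g A = int (card A) \<Longrightarrow> a \<in> A \<Longrightarrow> g a = 1"
proof -
  have le: "g a \<le> 1" if "a \<in> A" for a using assms(2)[OF that] by auto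
  then have "sum g A \<le> (\<Sum>a\<in>A. 1)" by (rule sum_mono)
  then show "sum g A \<le> int (card A)" by simp
  have "sum g A + int (card A) = (\<Sum>a\<in>A. g a + 1)" by (simp add: sum.distrib)
  also have "even \<dots>" using assms(2) by (intro dvd_sum) force
  finally show "even (sum g A + int (card A))" .
  assume "sum g A = int (card A)" "a \<in> A"
  then have "(\<Sum>a\<in>A. 1 - g a) = 0" by (simp add: sum_subtractf)
  then have "\<forall>a\<in>A. 1 - g a = 0" using le by (subst (asm) sum_nonneg_eq_0_iff[OF assms(1)]) auto
  then show "g a = 1" using \<open>a \<in> A\<close> by auto
qed

context cubic_two_factor
begin

lemma cut_V: "cut V = {}" using ends_V by (auto simp: cut_def)

text \<open>Edges inside \<open>S\<close> cancel, so only the cut contributes. \<open>M\<close>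
  covers all vertices and \<open>R\<close> covers those off \<open>Z\<close>, which yields two
  evaluations of \<phi> on \<open>S\<close> that differ by the chosen vertices.\<close>

lemma proper_sum:
  assumes "matching_off Z R" "proper R \<phi>" "S \<subseteq> V"
  shows "sum \<phi> S = (\<Sum>e\<in>M \<inter> cut S. sum \<phi> (ends e \<inter> S))"
    and "sum \<phi> (S - Z) = (\<Sum>e\<in>R \<inter> cut S. sum \<phi> (ends e \<inter> S))"
proof -
  have zero: "(\<Sum>e | e \<in> A \<and> ends e \<subseteq> S. sum \<phi> (ends e)) = 0" if "A \<subseteq> M \<union> R" for A
    using assms(2) that by (intro sum.neutral) (auto simp: proper_def)
  have "sum \<phi> S = (\<Sum>v\<in>S. \<phi> v * int (deg M v))" using deg_M assms(3) by (intro sum.cong) auto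
  then show "sum \<phi> S = (\<Sum>e\<in>M \<inter> cut S. sum \<phi> (ends e \<inter> S))"
    unfolding sum_deg[OF M_sub assms(3)] by (simp add: zero)
  have R: "R \<subseteq> E" "\<And>v. v \<in> V \<Longrightarrow> deg R v = (if v \<in> Z then 0 else 1)"
    using assms(1) F_sub by (auto simp: matching_off_def)
  have "sum \<phi> (S - Z) = (\<Sum>v\<in>S. if v \<in> Z then 0 else \<phi> v)"
    using finite_sub_V[OF assms(3)] by (simp add: sum.If_cases Diff_eq)
  also have "\<dots> = (\<Sum>v\<in>S. \<phi> v * int (deg R v))" using R(2) assms(3) by (intro sum.cong) auto
  finally show "sum \<phi> (S - Z) = (\<Sum>e\<in>R \<inter> cut S. sum \<phi> (ends e \<inter> S))"
    unfolding sum_deg[OF R(1) assms(3)] by (simp add: zero)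
qed

lemma proper_inner:
  assumes "proper R \<phi>" "e \<in> cut S" shows "sum \<phi> (ends e \<inter> S) = 1 \<or> sum \<phi> (ends e \<inter> S) = - 1"
proof -
  obtain a b where "e \<in> E" "ends e = {a, b}" "a \<noteq> b" "a \<in> S" "b \<notin> S" "a \<in> V" using cut_obtain[OF assms(2)] .
  then have "ends e \<inter> S = {a}" "\<phi> a = 1 \<or> \<phi> a = - 1" using assms(1) by (auto simp: proper_def)
  then show ?thesis by simp
qed

lemma proper_sum_Z:
  assumes "Z \<subseteq> V" "matching_off Z R" "proper R \<phi>" shows "sum \<phi> Z = 0"
proof -
  have "sum \<phi> V = 0" "sum \<phi> (V - Z) = 0" using proper_sum[OF assms(2,3), of V] cut_V by simp_all
  then show ?thesis using sum.subset_diff[OF assms(1) finite_V, of \<phi>] by simp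
qed

text \<open>Here \<open>d\<close> is the colour sum of a violating set, \<open>\<delta>\<close> the
  part from its chosen vertices, and \<open>m\<close>, \<open>c1\<close>, \<open>c2\<close> count
  the cut edges in \<open>M\<close>, \<open>F - R\<close> and \<open>R\<close>. Slack in
  \<open>d \<le> m\<close> or \<open>d - \<delta> \<le> c2\<close> would by parity be at least 2 and
  cost 6 >= 3 \<delta>, too much. With equality in both, \<open>d + 3 * c1 < 3 * \<delta>\<close>;
  parity and the absence of one-edge cuts settle the rest.\<close>

lemma violation_arith:
  fixes d \<delta> m c1 c2 :: int
  assumes "d \<le> m" "even (d + m)" "d - \<delta> \<le> c2" "even (d - \<delta> + c2)" "even (c1 + c2)"
    "3 * (m + c1 + c2) < 5 * d" "m + c1 + c2 \<noteq> 1" "\<delta> \<le> 2" "0 \<le> m" "0 \<le> c1" "0 \<le> c2"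
  shows "\<delta> = 2 \<and> c1 = 0 \<and> d = m \<and> (m = 4 \<and> c2 = 2 \<or> m = 2 \<and> c2 = 0)"
proof -
  obtain i j k where eq: "d + m = 2 * i" "d - \<delta> + c2 = 2 * j" "c1 + c2 = 2 * k"
    using assms(2,4,5) by (elim evenE) auto
  have ineq: "3 * m + 3 * c1 + 3 * c2 < 5 * d" using assms(6) by simp
  have "1 \<le> d" using assms(9-11) ineq by linarith
  have "i = d" using assms(1,3,8,10) ineq eq(1,2) \<open>1 \<le> d\<close> by linarith
  have "j = d - \<delta>" using assms(1,3,8,10) ineq eq(1,2) \<open>1 \<le> d\<close> by linarith
  then have mc: "m = d" "c2 = d - \<delta>" using eq \<open>i = d\<close> by linarith+
  have "c1 \<le> 1" using assms(8,10) ineq mc \<open>1 \<le> d\<close> by linarith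
  then consider "c1 = 0" | "c1 = 1" using assms(10) by linarith
  then show ?thesis
  proof cases
    case 1
    then have d: "d = 2 * k + \<delta>" "d < 3 * \<delta>" using eq(3) ineq mc by linarith+
    then consider "\<delta> = 1" | "\<delta> = 2" using assms(8) \<open>1 \<le> d\<close> by linarith
    then show ?thesis
    proof cases
      assume "\<delta> = 1"
      then have "k = 0" using d \<open>1 \<le> d\<close> by linarith
      then show ?thesis using 1 d mc assms(7) \<open>\<delta> = 1\<close> by simp
    next
      assume "\<delta> = 2"
      then have "k = 0 \<or> k = 1" using d \<open>1 \<le> d\<close> by linarith
      then show ?thesis using 1 d mc \<open>\<delta> = 2\<close> by auto
    qed
  next
    case 2
    then have "\<delta> = 2" using ineq mc assms(8) \<open>1 \<le> d\<close> by linarith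
    moreover have "d = 1 \<or> d = 2" using 2 ineq mc \<open>\<delta> = 2\<close> \<open>1 \<le> d\<close> by linarith
    moreover have "d = 2 * k + 1" using 2 eq(3) mc \<open>\<delta> = 2\<close> by linarith
    ultimately have "d = 1" "\<delta> = 2" by presburger+
    then show ?thesis using mc assms(11) by simp
  qed
qed

text \<open>At most two chosen vertices are positive, since the colours of \<open>Z\<close> sum to
  0, so \<open>X\<close> gains at most 2 from them. \<open>violation_arith\<close> forces this bound
  and both edge counts to be sharp; sharpness puts exactly the positive chosen vertices into
  \<open>X\<close> and makes the inner end of every cut edge positive.\<close>

lemma violation_cut:
  assumes Z: "Z \<subseteq> V" "card Z \<le> 4" and R: "matching_off Z R" and \<phi>: "proper R \<phi>" and X: "X \<subseteq> V"
    and viol: "3 * int (card (cut X)) < 5 * sum \<phi> X"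
  shows "card Z = 4" "\<forall>x\<in>Z. x \<in> X \<longleftrightarrow> \<phi> x = 1" "card (X \<inter> Z) = 2" "(F - R) \<inter> cut X = {}"
    "\<forall>e\<in>cut X. sum \<phi> (ends e \<inter> X) = 1"
    "card (M \<inter> cut X) = 4 \<and> card (R \<inter> cut X) = 2 \<or> card (M \<inter> cut X) = 2 \<and> card (R \<inter> cut X) = 0"
proof -
  have RF: "R \<subseteq> F" using R by (simp add: matching_off_def)
  note fin = finite_sub_V[OF Z(1)] finite_sub_V[OF X]
  define d where "d = sum \<phi> X"
  define \<delta> where "\<delta> = sum \<phi> (X \<inter> Z)"
  have d_diff: "sum \<phi> (X - Z) = d - \<delta>" unfolding d_def \<delta>_def
    using sum.Int_Diff[OF fin(2), of \<phi> Z] by simp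
  have sgn: "\<phi> v = 1 \<or> \<phi> v = - 1" if "v \<in> V" for v using \<phi> that by (auto simp: proper_def)
  define P N where "P = {x \<in> Z. \<phi> x = 1}" and "N = {x \<in> Z. \<phi> x = - 1}"
  have PN: "Z = P \<union> N" "P \<inter> N = {}" "finite P" "finite N" using sgn Z(1) fin(1) by (auto simp: P_def N_def)
  have sumPN: "sum \<phi> (A \<inter> Z) = int (card (A \<inter> P)) - int (card (A \<inter> N))" for A
  proof -
    have "sum \<phi> (A \<inter> Z) = sum \<phi> (A \<inter> P) + sum \<phi> (A \<inter> N)"
      unfolding PN(1) Int_Un_distrib using PN(2-4) by (intro sum.union_disjoint) auto
    also have "sum \<phi> (A \<inter> P) = (\<Sum>x\<in>A \<inter> P. 1)" by (intro sum.cong) (auto simp: P_def)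
    also have "sum \<phi> (A \<inter> N) = (\<Sum>x\<in>A \<inter> N. - 1)" by (intro sum.cong) (auto simp: N_def)
    finally show ?thesis by simp
  qed
  have "card P = card N" using sumPN[of UNIV] proper_sum_Z[OF Z(1) R \<phi>] by simp
  moreover have "card Z = card P + card N" using PN by (simp add: card_Un_disjoint)
  ultimately have card_P: "card P \<le> 2" "card Z = 2 * card P" using Z(2) by auto
  have XP: "card (X \<inter> P) \<le> card P" using PN(3) by (simp add: card_mono)
  have \<delta>2: "\<delta> \<le> 2" unfolding \<delta>_def sumPN using XP card_P by linarith
  define m c1 c2 where "m = int (card (M \<inter> cut X))" and "c1 = int (card ((F - R) \<inter> cut X))"
    and "c2 = int (card (R \<inter> cut X))"
  have "F \<inter> cut X = ((F - R) \<inter> cut X) \<union> (R \<inter> cut X)" using RF by auto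
  then have "card (F \<inter> cut X) = card (((F - R) \<inter> cut X) \<union> (R \<inter> cut X))" by simp
  also have "\<dots> = card ((F - R) \<inter> cut X) + card (R \<inter> cut X)" by (intro card_Un_disjoint) auto
  finally have F_card: "int (card (F \<inter> cut X)) = c1 + c2" by (simp add: c1_def c2_def)
  have cut_card: "int (card (cut X)) = m + c1 + c2" using card_cut_split[of X] F_card by (simp add: m_def)
  have inner: "sum \<phi> (ends e \<inter> X) = 1 \<or> sum \<phi> (ends e \<inter> X) = - 1" if "e \<in> A \<inter> cut X" for e A
    using proper_inner[OF \<phi>] that by blast
  have fin_cut: "finite (M \<inter> cut X)" "finite (R \<inter> cut X)" by auto
  note sM = sum_signs[OF fin_cut(1) inner[of _ M]]
  note sR = sum_signs[OF fin_cut(2) inner[of _ R]]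
  have dM: "d = (\<Sum>e\<in>M \<inter> cut X. sum \<phi> (ends e \<inter> X))" and dR: "d - \<delta> = (\<Sum>e\<in>R \<inter> cut X. sum \<phi> (ends e \<inter> X))"
    using proper_sum[OF R \<phi> X] d_diff by (auto simp: d_def)
  have res: "\<delta> = 2 \<and> c1 = 0 \<and> d = m \<and> (m = 4 \<and> c2 = 2 \<or> m = 2 \<and> c2 = 0)"
  proof (rule violation_arith)
    show "d \<le> m" using sM(1) by (simp only: dM m_def)
    show "even (d + m)" using sM(2) by (simp only: dM m_def)
    show "d - \<delta> \<le> c2" using sR(1) by (simp only: dR c2_def)
    show "even (d - \<delta> + c2)" using sR(2) by (simp only: dR c2_def)
    show "\<delta> \<le> 2" by (rule \<delta>2)
    show "0 \<le> m" "0 \<le> c1" "0 \<le> c2" by (simp_all add: m_def c1_def c2_def)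
    show "even (c1 + c2)" using F_cut_even[OF X] F_card by (metis even_of_nat)
    show "3 * (m + c1 + c2) < 5 * d" using viol cut_card by (simp add: d_def)
    show "m + c1 + c2 \<noteq> 1" using no_bridge[OF X] cut_card by linarith
  qed
  then have "int (card (X \<inter> P)) - int (card (X \<inter> N)) = 2" unfolding \<delta>_def sumPN by simp
  then have *: "card P = 2" "card (X \<inter> P) = 2" "card (X \<inter> N) = 0" using XP card_P(1) by linarith+
  show "card Z = 4" using * card_P(2) by simp
  have "X \<inter> P = P" using * PN(3) by (intro card_subset_eq) auto
  moreover have "X \<inter> N = {}" using * PN(4) by simp
  ultimately have XPN: "x \<in> P \<Longrightarrow> x \<in> X" "x \<in> N \<Longrightarrow> x \<notin> X" for x by blast+
  have PN_sgn: "x \<in> P \<Longrightarrow> \<phi> x = 1" "x \<in> N \<Longrightarrow> \<phi> x = - 1" for x by (simp_all add: P_def N_def)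
  show "\<forall>x\<in>Z. x \<in> X \<longleftrightarrow> \<phi> x = 1"
  proof
    fix x assume "x \<in> Z"
    then have "x \<in> P \<or> x \<in> N" using PN(1) by blast
    then show "x \<in> X \<longleftrightarrow> \<phi> x = 1" using XPN[of x] PN_sgn[of x] by auto
  qed
  have "X \<inter> Z = P" using \<open>X \<inter> P = P\<close> \<open>X \<inter> N = {}\<close> PN(1) by blast
  then show "card (X \<inter> Z) = 2" using * by simp
  show B: "(F - R) \<inter> cut X = {}" using res by (simp add: c1_def)
  show mr: "card (M \<inter> cut X) = 4 \<and> card (R \<inter> cut X) = 2 \<or> card (M \<inter> cut X) = 2 \<and> card (R \<inter> cut X) = 0"
    using res by (auto simp: m_def c2_def)
  show "\<forall>e\<in>cut X. sum \<phi> (ends e \<inter> X) = 1"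
  proof
    fix e assume e: "e \<in> cut X"
    then have "e \<in> M \<inter> cut X \<or> e \<in> R \<inter> cut X" using B cut_sub by (auto simp: F_def)
    then show "sum \<phi> (ends e \<inter> X) = 1"
    proof
      assume "e \<in> M \<inter> cut X"
      moreover have "d = m" using res by blast
      ultimately show ?thesis by (intro sM(3)) (simp_all only: dM[symmetric] m_def[symmetric])
    next
      assume "e \<in> R \<inter> cut X"
      moreover have "d - \<delta> = c2" using res by auto
      ultimately show ?thesis by (intro sR(3)) (simp_all only: dR[symmetric] c2_def[symmetric])
    qed
  qed
qed

section \<open>Balanced colourings, and the case of at most two odd circuits\<close>

definition balanced :: "('v \<Rightarrow> int) \<Rightarrow> bool" where
  "balanced \<phi> \<longleftrightarrow> (\<forall>v\<in>V. \<phi> v = 1 \<or> \<phi> v = - 1) \<and> (\<forall>S\<subseteq>V. 5 * \<bar>sum \<phi> S\<bar> \<le> 3 * int (card (cut S)))"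

lemma unbalanced_violation:
  assumes "proper R \<phi>" "matching_off Z R" "\<not> balanced \<phi>"
  obtains X where "X \<subseteq> V" "3 * int (card (cut X)) < 5 * sum \<phi> X"
proof -
  obtain S where S: "S \<subseteq> V" "3 * int (card (cut S)) < 5 * \<bar>sum \<phi> S\<bar>"
    using assms(1,3) by (auto simp: balanced_def proper_def not_le)
  show thesis
  proof (cases "sum \<phi> S \<ge> 0")
    case True
    then show thesis using that[of S] S by simp
  next
    case False
    have "sum \<phi> V = 0" using proper_sum(1)[OF assms(2,1), of V] cut_V by simp
    then have "sum \<phi> (V - S) = - sum \<phi> S" using sum_diff[OF finite_V S(1), of \<phi>] by simp
    then show thesis using that[of "V - S"] S False by (simp add: cut_compl)
  qed
qed

lemma transversal_odd:
  assumes "transversal Z" "x \<in> Z" obtains K where "K \<in> odd_comps" "x \<in> K" "Z \<inter> K = {x}"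
proof -
  have "x \<in> V" using assms by (auto simp: transversal_def)
  then obtain K where K: "K \<in> \<K>" "x \<in> K" using union_\<K> by blast
  have fin: "finite (Z \<inter> K)" using \<K>_sub[OF K(1)] finite_sub_V by blast
  then have "card (Z \<inter> K) \<noteq> 0" using assms(2) K(2) by auto
  then have "odd (card K)" "card (Z \<inter> K) = 1" using assms(1) K(1) by (auto simp: transversal_def split: if_splits)
  moreover have "Z \<inter> K = {x}"
    using \<open>card (Z \<inter> K) = 1\<close> assms(2) K(2) by (metis IntI card_1_singletonE singletonD)
  ultimately show thesis using that[of K] K by (auto simp: odd_comps_def)
qed

lemma transversal_meets:
  assumes "transversal Z" "K \<in> odd_comps" obtains x where "x \<in> Z" "x \<in> K" "Z \<inter> K = {x}"
proof -
  have "card (Z \<inter> K) = 1" using assms by (auto simp: transversal_def odd_comps_def)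
  then show thesis using that by (auto simp: card_1_singleton_iff)
qed

lemma card_transversal:
  assumes "transversal Z" shows "card Z = card odd_comps"
proof -
  have "Z = (\<Union>K\<in>\<K>. Z \<inter> K)" using assms union_\<K> by (auto simp: transversal_def)
  then have "card Z = card (\<Union>K\<in>\<K>. Z \<inter> K)" by simp
  also have "\<dots> = (\<Sum>K\<in>\<K>. card (Z \<inter> K))"
  proof (rule card_UN_disjoint[OF finite_\<K>])
    show "\<forall>K\<in>\<K>. finite (Z \<inter> K)" using \<K>_sub finite_sub_V by blast
    show "\<forall>K\<in>\<K>. \<forall>K'\<in>\<K>. K \<noteq> K' \<longrightarrow> (Z \<inter> K) \<inter> (Z \<inter> K') = {}" using disjoint_\<K> by blast
  qed
  also have "\<dots> = (\<Sum>K\<in>\<K>. if odd (card K) then 1 else 0)" using assms by (intro sum.cong) (auto simp: transversal_def)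
  also have "\<dots> = card odd_comps" using finite_\<K> by (simp add: sum.If_cases odd_comps_def Int_def)
  finally show ?thesis .
qed

lemma exists_transversal:
  assumes "\<And>K. K \<in> odd_comps \<Longrightarrow> t K \<in> K"
  shows "transversal (t ` odd_comps)"
proof -
  have "card (t ` odd_comps \<inter> K) = (if odd (card K) then 1 else 0)" if K: "K \<in> \<K>" for K
  proof -
    have "t ` odd_comps \<inter> K = (if odd (card K) then {t K} else {})"
    proof -
      have "K' = K" if "K' \<in> odd_comps" "t K' \<in> K" for K'
        using \<K>_eq[OF K odd_compsD[OF that(1)] that(2) assms[OF that(1)]] by simp
      then show ?thesis using assms K by (auto simp: odd_comps_def)
    qed
    then show ?thesis by simp
  qed
  moreover have "t ` odd_comps \<subseteq> V" using assms \<K>_sub by (auto simp: odd_comps_def)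
  ultimately show ?thesis by (auto simp: transversal_def)
qed

text \<open>The perfect matching \<open>M\<close> makes the number of vertices even, and the
  circuits partition the vertices.\<close>

lemma even_card_odd_comps: "even (card odd_comps)"
proof -
  have "card V = card (\<Union>\<K>)" by (simp add: union_\<K>)
  also have "\<dots> = (\<Sum>K\<in>\<K>. card K)"
    using disjoint_\<K> \<K>_sub finite_sub_V by (intro card_Union_disjoint) (auto simp: pairwise_def disjnt_def)
  finally have "even (\<Sum>K\<in>\<K>. card K)" using M_cut_parity[of V] cut_V by simp
  moreover have "even (sum f A) \<longleftrightarrow> even (card {a \<in> A. odd (f a)})" if "finite A" for f :: "'v set \<Rightarrow> nat" and A
    using that
  proof (induction A rule: finite_induct)
    case (insert a A)
    have "{x \<in> insert a A. odd (f x)} = (if odd (f a) then insert a {x \<in> A. odd (f x)} else {x \<in> A. odd (f x)})"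
      by auto
    then show ?case using insert by (simp split: if_splits)
  qed simp
  ultimately show ?thesis using finite_\<K> by (simp add: odd_comps_def)
qed

lemma odd_comps_nonempty: "K \<in> odd_comps \<Longrightarrow> \<exists>x. x \<in> K"
  by (metis (no_types, lifting) ex_in_conv empty_\<K> odd_compsD)

text \<open>A violating cut requires four chosen vertices, by \<open>violation_cut\<close>. Here
  there are none or two, and two are paired with each other.\<close>

theorem balanced_if_two_odd_comps:
  assumes "card odd_comps \<le> 2" shows "\<exists>\<phi>. balanced \<phi>"
proof -
  have "\<exists>t. \<forall>K\<in>odd_comps. t K \<in> K" using odd_comps_nonempty by metis
  then obtain t where t: "\<And>K. K \<in> odd_comps \<Longrightarrow> t K \<in> K" by blast
  define Z where "Z = t ` odd_comps"
  have Z: "transversal Z" using exists_transversal[OF t] by (simp add: Z_def)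
  then have ZV: "Z \<subseteq> V" by (simp add: transversal_def)
  obtain R where R: "matching_off Z R" using exists_matching_off[OF Z] by blast
  have "card Z = 0 \<or> card Z = 2" using card_transversal[OF Z] assms even_card_odd_comps
    by presburger
  then have "\<exists>\<pi>. \<forall>x\<in>Z. \<pi> x \<in> Z \<and> \<pi> x \<noteq> x \<and> \<pi> (\<pi> x) = x"
  proof
    assume "card Z = 2"
    then obtain a b where "Z = {a, b}" "a \<noteq> b" by (auto simp: card_2_iff)
    then show ?thesis by (intro exI[of _ "\<lambda>x. if x = a then b else a"]) auto
  qed (use finite_sub_V[OF ZV] in auto)
  then obtain \<pi> where "\<And>x. x \<in> Z \<Longrightarrow> \<pi> x \<in> Z \<and> \<pi> x \<noteq> x \<and> \<pi> (\<pi> x) = x" by blast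
  then obtain \<phi> where \<phi>: "proper R \<phi>" using exists_proper[OF ZV R] by blast
  have "balanced \<phi>"
  proof (rule ccontr)
    assume "\<not> balanced \<phi>"
    then obtain X where X: "X \<subseteq> V" "3 * int (card (cut X)) < 5 * sum \<phi> X"
      using unbalanced_violation[OF \<phi> R] by blast
    have "card Z \<le> 4" using card_transversal[OF Z] assms by simp
    from violation_cut(1)[OF ZV this R \<phi> X] show False using card_transversal[OF Z] assms by simp
  qed
  then show ?thesis by blast
qed

end

section \<open>Pairs of small cuts\<close>

text \<open>The situation of a counterexample; it is refuted in \<open>linked_False\<close> below.\<close>

locale linked_two_factor = cubic_two_factor +
  assumes four: "card odd_comps = 4"
    and linked: "\<lbrakk>S \<subseteq> V; K \<in> odd_comps; K' \<in> odd_comps; K \<subseteq> S; K' \<inter> S = {}\<rbrakk> \<Longrightarrow> 6 \<le> card (cut S)"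
    and unbalanced: "\<not> balanced \<phi>"
begin

text \<open>The six-edge shape of a violating cut, stated without the colouring; in this form it
  passes to complements.\<close>

definition tight :: "'b set \<Rightarrow> 'a set \<Rightarrow> bool" where
  "tight R X \<longleftrightarrow> X \<subseteq> V \<and> (F - R) \<inter> cut X = {} \<and> card (M \<inter> cut X) = 4 \<and> card (R \<inter> cut X) = 2"

text \<open>The other outcome of \<open>violation_cut\<close> is a cut of two M-edges. Then
  \<open>X\<close> is a union of circuits with chosen vertices on both sides, so two edges would
  separate odd circuits.\<close>

lemma exists_tight:
  assumes Z: "transversal Z" and R: "matching_off Z R" and \<phi>: "proper R \<phi>"
  obtains X where "tight R X" "\<And>x. x \<in> Z \<Longrightarrow> x \<in> X \<longleftrightarrow> \<phi> x = 1" "card (X \<inter> Z) = 2"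
    "\<And>e. e \<in> cut X \<Longrightarrow> sum \<phi> (ends e \<inter> X) = 1"
proof -
  have ZV: "Z \<subseteq> V" and Z4: "card Z = 4" using Z card_transversal[OF Z] four by (auto simp: transversal_def)
  obtain X where X: "X \<subseteq> V" "3 * int (card (cut X)) < 5 * sum \<phi> X"
    using unbalanced_violation[OF \<phi> R unbalanced] .
  have "card Z \<le> 4" using Z4 by simp
  note v = violation_cut[OF ZV this R \<phi> X]
  have RF: "R \<subseteq> F" using R by (simp add: matching_off_def)
  have "\<not> (card (M \<inter> cut X) = 2 \<and> card (R \<inter> cut X) = 0)"
  proof
    assume a: "card (M \<inter> cut X) = 2 \<and> card (R \<inter> cut X) = 0"
    then have "R \<inter> cut X = {}" by (simp add: finite_subset[OF _ finite_cut])
    then have F0: "F \<inter> cut X = {}" using v(4) RF by blast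
    then have c2: "card (cut X) = 2" using card_cut_split[of X] a by simp
    have whole: "K \<subseteq> X \<or> K \<inter> X = {}" if "K \<in> \<K>" for K
      using F_cut_comp_empty[OF that, of X] F0 F_cut_comp[OF that, of X] by blast
    have "X \<inter> Z \<noteq> {}" using v(3) by auto
    moreover have "Z - X \<noteq> {}"
    proof
      assume "Z - X = {}"
      then have "X \<inter> Z = Z" by blast
      then show False using v(3) Z4 by simp
    qed
    ultimately obtain x y where xy: "x \<in> Z" "x \<in> X" "y \<in> Z" "y \<notin> X" by blast
    obtain K where K: "K \<in> odd_comps" "x \<in> K" using transversal_odd[OF Z xy(1)] .
    obtain K' where K': "K' \<in> odd_comps" "y \<in> K'" using transversal_odd[OF Z xy(3)] .
    have "K \<subseteq> X" "K' \<inter> X = {}" using whole odd_compsD K K' xy by blast+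
    then show False using linked[OF X(1) K(1) K'(1)] c2 by simp
  qed
  then have "tight R X" using v(4,6) X(1) by (auto simp: tight_def)
  then show thesis using that v(2,3,5) by blast
qed

lemma tight_compl: "tight R X \<Longrightarrow> tight R (V - X)"
  by (auto simp: tight_def cut_compl)

lemma tight_F:
  assumes "tight R X" "R \<subseteq> F" shows "F \<inter> cut X = R \<inter> cut X" "card (F \<inter> cut X) = 2" "card (cut X) = 6"
proof -
  show *: "F \<inter> cut X = R \<inter> cut X" using assms by (auto simp: tight_def)
  then show "card (F \<inter> cut X) = 2" using assms by (simp add: tight_def)
  then show "card (cut X) = 6" using assms card_cut_split[of X] by (simp add: tight_def)
qed

section \<open>Crossing tight cuts and their quadrants\<close>

definition crosses :: "'a set \<Rightarrow> 'a set \<Rightarrow> bool" where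
  "crosses K S \<longleftrightarrow> \<not> K \<subseteq> S \<and> K \<inter> S \<noteq> {}"

lemma crosses_iff: "K \<in> \<K> \<Longrightarrow> crosses K S \<longleftrightarrow> F \<inter> cut (S \<inter> K) \<noteq> {}"
  using F_cut_comp_empty_iff by (auto simp: crosses_def)

lemma crosses_compl: "K \<in> \<K> \<Longrightarrow> crosses K (V - S) \<longleftrightarrow> crosses K S"
  using \<K>_sub[of K] by (auto simp: crosses_def)

text \<open>A crossed circuit contributes a positive even number of edges to the cut, so a single
  one already accounts for both F-edges.\<close>

lemma F_cut_two:
  assumes "card (F \<inter> cut X) = 2" "K \<in> \<K>" "crosses K X"
  shows "F \<inter> cut (X \<inter> K) = F \<inter> cut X"
proof (rule card_subset_eq)
  show "F \<inter> cut (X \<inter> K) \<subseteq> F \<inter> cut X" using F_cut_comp[OF assms(2)] by blast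
  then have "card (F \<inter> cut (X \<inter> K)) \<le> 2" using assms(1) by (metis card_mono finite_F_cut(1))
  then show "card (F \<inter> cut (X \<inter> K)) = card (F \<inter> cut X)"
    using F_cut_comp_ge2[OF assms(2), of X] assms crosses_iff by simp
qed simp

lemma F_cut_two_unique:
  assumes "card (F \<inter> cut X) = 2" "K \<in> \<K>" "crosses K X" "K' \<in> \<K>" "crosses K' X"
  shows "K = K'"
proof (rule ccontr)
  assume "K \<noteq> K'"
  then have "F \<inter> cut X = {}"
    using F_cut_comp_disjoint[OF assms(2,4), of X] F_cut_two[OF assms(1-3)] F_cut_two[OF assms(1,4,5)] by simp
  then show False using assms(1) by simp
qed

text \<open>The conditions are permuted when the two cuts are exchanged or one is complemented, so
  what is proved about \<open>X \<inter> Y\<close> holds for every quadrant.\<close>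

definition quad :: "'a set \<Rightarrow> 'b set \<Rightarrow> 'a set \<Rightarrow> 'a set \<Rightarrow> bool" where
  "quad Z R X Y \<longleftrightarrow> transversal Z \<and> matching_off Z R \<and> tight R X \<and> tight R Y \<and>
     card (Z \<inter> (X \<inter> Y)) = 1 \<and> card (Z \<inter> (X - Y)) = 1 \<and> card (Z \<inter> (Y - X)) = 1 \<and> card (Z \<inter> (V - (X \<union> Y))) = 1"

lemma quad_sym: "quad Z R X Y \<Longrightarrow> quad Z R Y X"
  by (auto simp: quad_def Int_commute Un_commute)

lemma quad_compl:
  assumes "quad Z R X Y" shows "quad Z R X (V - Y)"
proof -
  have "X \<subseteq> V" "Y \<subseteq> V" using assms by (auto simp: quad_def tight_def)
  then have "X \<inter> (V - Y) = X - Y" "X - (V - Y) = X \<inter> Y" "V - Y - X = V - (X \<union> Y)"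
    "V - (X \<union> (V - Y)) = Y - X" by auto
  then show ?thesis using assms tight_compl by (simp add: quad_def)
qed

text \<open>No edge of \<open>F - R\<close> leaves \<open>X\<close> or \<open>Y\<close>, hence none
  leaves the quadrant. In \<open>F - R\<close> the chosen vertex has degree 2 and every other vertex
  degree 1, so the number of vertices plus one is even.\<close>

lemma quad_odd:
  assumes "quad Z R X Y" shows "odd (card (X \<inter> Y))"
proof -
  let ?S = "X \<inter> Y"
  have S: "?S \<subseteq> V" and R: "matching_off Z R" and RF: "R \<subseteq> F" and ZS: "card (Z \<inter> ?S) = 1"
    using assms by (auto simp: quad_def tight_def matching_off_def)
  have "(F - R) \<inter> cut ?S = {}" using assms unfolding quad_def tight_def by (auto simp: cut_def)
  then have "(\<Sum>v\<in>?S. deg (F - R) v) = 2 * card {e \<in> F - R. ends e \<subseteq> ?S}"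
    using handshake[of "F - R" ?S] S F_sub by auto
  moreover have "(\<Sum>v\<in>?S. deg (F - R) v) = (\<Sum>v\<in>?S. 1 + (if v \<in> Z then 1 else 0))"
    using S R deg_diff[OF RF F_sub] deg_F2 by (intro sum.cong) (auto simp: matching_off_def subset_iff)
  moreover have "\<dots> = card ?S + card (Z \<inter> ?S)"
    unfolding sum.distrib using finite_sub_V[OF S] by (simp add: sum.If_cases Int_commute)
  ultimately have "card ?S + 1 = 2 * card {e \<in> F - R. ends e \<subseteq> ?S}" using ZS by simp
  then show ?thesis by presburger
qed

text \<open>Otherwise \<open>K\<close> lies inside the quadrant. Each of the two cuts crosses at
  most one circuit, so one of the three other odd circuits is uncrossed; its chosen vertex is in
  another quadrant, and five edges would separate it from \<open>K\<close>.\<close>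

lemma quad_crosses:
  assumes q: "quad Z R X Y" and c: "card (cut (X \<inter> Y)) \<le> 5"
    and x: "x \<in> Z" "x \<in> X" "x \<in> Y" "K \<in> odd_comps" "x \<in> K"
  shows "crosses K X \<or> crosses K Y"
proof (rule ccontr)
  assume "\<not> ?thesis"
  then have KXY: "K \<subseteq> X \<inter> Y" using x by (auto simp: crosses_def)
  have Z: "transversal Z" and RF: "R \<subseteq> F" and t: "tight R X" "tight R Y"
    and one: "card (Z \<inter> (X \<inter> Y)) = 1" using q by (auto simp: quad_def matching_off_def)
  have XV: "X \<inter> Y \<subseteq> V" using t by (auto simp: tight_def)
  define CX CY where "CX = {K' \<in> odd_comps. crosses K' X}" and "CY = {K' \<in> odd_comps. crosses K' Y}"
  have fin: "finite odd_comps" using four card.infinite by fastforce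
  have "card CX \<le> 1" "card CY \<le> 1" unfolding One_nat_def
    by (subst card_le_Suc0_iff_eq; use fin F_cut_two_unique tight_F(2)[OF _ RF] t in
      \<open>auto simp: CX_def CY_def dest!: odd_compsD\<close>)+
  then have "card ({K} \<union> CX \<union> CY) \<le> 3"
    using card_Un_le[of "{K} \<union> CX" CY] card_Un_le[of "{K}" CX] by simp
  then have "\<not> odd_comps \<subseteq> {K} \<union> CX \<union> CY"
    using card_mono[of "{K} \<union> CX \<union> CY" odd_comps] four fin by (auto simp: CX_def CY_def)
  then obtain K' where K': "K' \<in> odd_comps" "K' \<noteq> K" "\<not> crosses K' X" "\<not> crosses K' Y"
    by (auto simp: CX_def CY_def)
  obtain x' where x': "x' \<in> Z" "x' \<in> K'" using transversal_meets[OF Z K'(1)] .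
  have "x' \<noteq> x" using \<K>_eq[OF odd_compsD[OF K'(1)] odd_compsD[OF x(4)] x'(2)] K'(2) x(5) by blast
  then have "x' \<notin> X \<inter> Y" using one x x'(1) by (metis IntI card_1_singletonE singletonD)
  then have "K' \<inter> (X \<inter> Y) = {}" using K'(3,4) x'(2) by (auto simp: crosses_def)
  then show False using linked[OF XV x(4) K'(1) KXY] c by simp
qed

text \<open>
  \<open>T\<close> and \<open>N\<close> are adjacent quadrants of two crossing tight cuts. The circuit \<open>K2\<close> lies in
  \<open>T \<union> N\<close>, and \<open>K1\<close> leaves \<open>T\<close> on the side away from \<open>N\<close>.
\<close>

definition pair :: "'a set \<Rightarrow> 'a set \<Rightarrow> 'a set \<Rightarrow> 'a set \<Rightarrow> bool" where
  "pair T N K1 K2 \<longleftrightarrow> T \<subseteq> V \<and> N \<subseteq> V \<and> T \<inter> N = {} \<and> odd (card T) \<and> odd (card N) \<and>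
     K1 \<in> odd_comps \<and> K2 \<in> odd_comps \<and> K1 \<noteq> K2 \<and> card (M \<inter> cut T) = 1 \<and>
     card (F \<inter> cut (T \<inter> K1)) = 2 \<and> card (F \<inter> cut (T \<inter> K2)) = 2 \<and>
     (\<forall>K\<in>\<K> - {K1, K2}. F \<inter> cut (T \<inter> K) = {}) \<and>
     K2 \<subseteq> T \<union> N \<and> F \<inter> cut N = F \<inter> cut (T \<inter> K2) \<and> card (cut N) \<le> 5 \<and>
     (\<forall>K\<in>odd_comps - {K1, K2}. K \<inter> (T \<union> N) = {})"

text \<open>\<open>X\<close> crosses only \<open>K1\<close> and \<open>Y\<close> only
  \<open>K2\<close>, so the F-edges around \<open>X \<inter> Y\<close> are the two F-edges of each
  cut. That is four of at most five edges, and an odd quadrant is left by an odd number of M-edges,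
  hence by exactly one. Along \<open>K2\<close> the two quadrants share their F-boundary.\<close>

lemma quad_pair:
  assumes q: "quad Z R X Y" and cA: "card (cut (X \<inter> Y)) \<le> 5" and cB: "card (cut (X - Y)) \<le> 5"
    and x1: "x1 \<in> Z" "x1 \<in> X \<inter> Y" "K1 \<in> odd_comps" "x1 \<in> K1"
    and x2: "x2 \<in> Z" "x2 \<in> X - Y" "K2 \<in> odd_comps" "x2 \<in> K2"
    and cross: "crosses K1 X" "crosses K2 Y"
  shows "pair (X \<inter> Y) (X - Y) K1 K2"
proof -
  let ?A = "X \<inter> Y" and ?B = "X - Y"
  have Z: "transversal Z" and RF: "R \<subseteq> F" and t: "tight R X" "tight R Y"
    and oneA: "card (Z \<inter> ?A) = 1" and oneB: "card (Z \<inter> ?B) = 1" using q by (auto simp: quad_def matching_off_def)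
  have V: "X \<subseteq> V" "Y \<subseteq> V" using t by (auto simp: tight_def)
  have B_eq: "X \<inter> (V - Y) = ?B" using V by auto
  have odd: "odd (card ?A)" "odd (card ?B)" using quad_odd[OF q] quad_odd[OF quad_compl[OF q]] B_eq by auto
  note two = tight_F(2)[OF t(1) RF] tight_F(2)[OF t(2) RF]
  note K1 = odd_compsD[OF x1(3)] and K2 = odd_compsD[OF x2(3)]
  have ne: "K1 \<noteq> K2"
  proof
    assume "K1 = K2"
    obtain x where "Z \<inter> K1 = {x}" using transversal_meets[OF Z x1(3)] .
    then have "x1 = x" "x2 = x" using x1 x2 \<open>K1 = K2\<close> by blast+
    then show False using x1(2) x2(2) by blast
  qed
  have un: "K = K1" if "K \<in> \<K>" "crosses K X" for K using F_cut_two_unique[OF two(1) that K1 cross(1)] .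
  have un': "K = K2" if "K \<in> \<K>" "crosses K Y" for K using F_cut_two_unique[OF two(2) that K2 cross(2)] .
  have K1Y: "K1 \<subseteq> Y" using un'[OF K1] ne x1 by (auto simp: crosses_def)
  have K2X: "K2 \<subseteq> X" using un[OF K2] ne x2 by (auto simp: crosses_def)
  have AK: "?A \<inter> K1 = X \<inter> K1" "?A \<inter> K2 = Y \<inter> K2" using K1Y K2X by auto
  have F1: "F \<inter> cut (?A \<inter> K1) = F \<inter> cut X" unfolding AK by (rule F_cut_two[OF two(1) K1 cross(1)])
  have F2: "F \<inter> cut (?A \<inter> K2) = F \<inter> cut Y" unfolding AK by (rule F_cut_two[OF two(2) K2 cross(2)])
  have other: "K \<subseteq> ?A \<or> K \<inter> ?A = {}" "K \<subseteq> ?B \<or> K \<inter> ?B = {}" if "K \<in> \<K> - {K1, K2}" for K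
    using un[of K] un'[of K] that by (auto simp: crosses_def)
  have F0: "F \<inter> cut (?A \<inter> K) = {}" if "K \<in> \<K> - {K1, K2}" for K
    using other(1)[OF that] F_cut_comp_empty_iff[of K ?A] that by blast
  have F_A: "F \<inter> cut ?A = (F \<inter> cut (?A \<inter> K1)) \<union> (F \<inter> cut (?A \<inter> K2))"
    unfolding F_cut_UN[of ?A] using F0 K1 K2 by blast
  have "card (F \<inter> cut ?A) = card (F \<inter> cut (?A \<inter> K1)) + card (F \<inter> cut (?A \<inter> K2))"
    unfolding F_A by (intro card_Un_disjoint F_cut_comp_disjoint[OF K1 K2 ne]) auto
  then have F4: "card (F \<inter> cut ?A) = 4" using F1 F2 two by simp
  have "odd (card (M \<inter> cut ?A))" using M_cut_parity[of ?A] odd(1) V by auto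
  then have "card (M \<inter> cut ?A) \<noteq> 0" by (metis even_zero)
  then have M1: "card (M \<inter> cut ?A) = 1" using card_cut_split[of ?A] F4 cA by linarith
  have F_B: "F \<inter> cut ?B = F \<inter> cut (?A \<inter> K2)"
  proof -
    have K1B: "F \<inter> cut (?B \<inter> K1) = {}" using K1Y by (auto simp: cut_def)
    have oB: "F \<inter> cut (?B \<inter> K) = {}" if "K \<in> \<K> - {K1, K2}" for K
      using other(2)[OF that] F_cut_comp_empty_iff[of K ?B] that by blast
    have "F \<inter> cut ?B = F \<inter> cut (?B \<inter> K2)" unfolding F_cut_UN[of ?B] using oB K1B K2 by blast
    moreover have "?B \<inter> K2 = K2 - ?A" using K2X by auto
    ultimately show ?thesis using F_cut_comp_diff[OF K2, of ?A] by simp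
  qed
  have "K \<inter> (?A \<union> ?B) = {}" if K: "K \<in> odd_comps - {K1, K2}" for K
  proof -
    obtain x where x: "x \<in> Z" "x \<in> K" using transversal_meets[OF Z] K by blast
    have Kc: "K \<in> \<K>" using K odd_compsD by blast
    have "x \<noteq> x1" "x \<noteq> x2" using \<K>_eq[OF Kc K1 x(2)] \<K>_eq[OF Kc K2 x(2)] x1(4) x2(4) K by auto
    then have "x \<notin> ?A" "x \<notin> ?B" using oneA oneB x1(1,2) x2(1,2) x(1)
      by (metis IntI card_1_singletonE singletonD)+
    then show ?thesis using other[of K] K Kc x(2) by blast
  qed
  then show ?thesis unfolding pair_def
    using V odd x1(3) x2(3) ne M1 F1 F2 two F0 K2X F_B cB by auto
qed

text \<open>Both circuits are crossed, and no cut crosses both, so different cuts cross them. If it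
  is \<open>K2\<close> that \<open>X\<close> crosses, complementing \<open>Y\<close> exchanges the
  two quadrants.\<close>

lemma quad_pair_exists:
  assumes q: "quad Z R X Y" and cA: "card (cut (X \<inter> Y)) \<le> 5" and cB: "card (cut (X - Y)) \<le> 5"
  shows "\<exists>T N K1 K2. pair T N K1 K2"
proof -
  have Z: "transversal Z" and V: "X \<subseteq> V" "Y \<subseteq> V" and RF: "R \<subseteq> F" and t: "tight R X" "tight R Y"
    and oneA: "card (Z \<inter> (X \<inter> Y)) = 1" and oneB: "card (Z \<inter> (X - Y)) = 1"
    using q by (auto simp: quad_def tight_def matching_off_def)
  have B_eq: "X \<inter> (V - Y) = X - Y" "X - (V - Y) = X \<inter> Y" using V by auto
  obtain x1 where x1: "x1 \<in> Z" "x1 \<in> X \<inter> Y" using oneA by (auto simp: card_1_singleton_iff)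
  obtain x2 where x2: "x2 \<in> Z" "x2 \<in> X - Y" using oneB by (auto simp: card_1_singleton_iff)
  obtain K1 where K1: "K1 \<in> odd_comps" "x1 \<in> K1" "Z \<inter> K1 = {x1}" using transversal_odd[OF Z x1(1)] .
  obtain K2 where K2: "K2 \<in> odd_comps" "x2 \<in> K2" "Z \<inter> K2 = {x2}" using transversal_odd[OF Z x2(1)] .
  note K1' = odd_compsD[OF K1(1)] and K2' = odd_compsD[OF K2(1)]
  have ne: "K1 \<noteq> K2" using K1(3) K2(3) x1(2) x2(2) by auto
  note q' = quad_compl[OF q]
  have "crosses K1 X \<or> crosses K1 Y" using quad_crosses[OF q cA x1(1) _ _ K1(1,2)] x1(2) by blast
  moreover have "crosses K2 X \<or> crosses K2 Y"
    using quad_crosses[OF q' _ x2(1) _ _ K2(1,2)] x2(2) V cB crosses_compl[OF K2'] unfolding B_eq by auto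
  moreover have "\<not> (crosses K1 X \<and> crosses K2 X)" "\<not> (crosses K1 Y \<and> crosses K2 Y)"
    using F_cut_two_unique tight_F(2)[OF t(1) RF] tight_F(2)[OF t(2) RF] K1' K2' ne by blast+
  ultimately consider "crosses K1 X" "crosses K2 Y" | "crosses K2 X" "crosses K1 Y" by blast
  then show ?thesis
  proof cases
    case 1
    then show ?thesis using quad_pair[OF q cA cB x1 K1(1,2) x2 K2(1,2)] by blast
  next
    case 2
    then have "pair (X \<inter> (V - Y)) (X - (V - Y)) K2 K1"
      using quad_pair[OF q', of x2 K2 x1 K1] cA cB x1 K1(1,2) x2 K2(1,2) crosses_compl[OF K1']
      unfolding B_eq by auto
    then show ?thesis by blast
  qed
qed

lemma quad_odd_cut:
  assumes "quad Z R X Y" shows "odd (card (cut (X \<inter> Y)))"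
proof -
  have "X \<inter> Y \<subseteq> V" using assms by (auto simp: quad_def tight_def)
  then show ?thesis using quad_odd[OF assms] M_cut_parity F_cut_even card_cut_split[of "X \<inter> Y"] by auto
qed

text \<open>Submodularity bounds the two boundaries by 6 + 6 = 12 together. Both are odd, so they
  cannot both exceed 5.\<close>

lemma quad_small_diagonal:
  assumes q: "quad Z R X Y"
  shows "card (cut (X \<inter> Y)) \<le> 5 \<or> card (cut ((V - X) \<inter> (V - Y))) \<le> 5"
proof -
  have RF: "R \<subseteq> F" and t: "tight R X" "tight R Y" using q by (auto simp: quad_def matching_off_def)
  have "cut ((V - X) \<inter> (V - Y)) = cut (X \<union> Y)" using cut_compl[of "X \<union> Y"] by (simp add: Diff_Un)
  then have "card (cut (X \<inter> Y)) + card (cut ((V - X) \<inter> (V - Y))) \<le> 12"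
    using card_cut_submodular[of X Y] tight_F(3)[OF t(1) RF] tight_F(3)[OF t(2) RF] by simp
  moreover have "odd (card (cut (X \<inter> Y)))" by (rule quad_odd_cut[OF q])
  moreover have "odd (card (cut ((V - X) \<inter> (V - Y))))"
    using quad_odd_cut[OF quad_compl[OF quad_sym[OF quad_compl[OF q]]]] by (simp add: Int_commute)
  moreover have "odd m \<Longrightarrow> odd n \<Longrightarrow> m + n \<le> 12 \<Longrightarrow> m \<le> 5 \<or> n \<le> 5" for m n :: nat by presburger
  ultimately show ?thesis by blast
qed

text \<open>Each diagonal has a quadrant with at most five boundary edges, and quadrants from
  different diagonals are adjacent.\<close>

lemma quad_gives_pair:
  assumes q: "quad Z R X Y" shows "\<exists>T N K1 K2. pair T N K1 K2"
proof -
  have *: "\<exists>T N K1 K2. pair T N K1 K2" if q: "quad Z R X Y" and c: "card (cut (X \<inter> Y)) \<le> 5" for X Y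
  proof -
    have V: "X \<subseteq> V" "Y \<subseteq> V" using q by (auto simp: quad_def tight_def)
    then have eq: "X \<inter> (V - Y) = X - Y" "(V - X) \<inter> (V - (V - Y)) = Y - X" by auto
    show ?thesis using quad_small_diagonal[OF quad_compl[OF q]] unfolding eq
    proof
      assume "card (cut (X - Y)) \<le> 5"
      then show ?thesis using quad_pair_exists[OF q c] by blast
    next
      assume "card (cut (Y - X)) \<le> 5"
      then show ?thesis using quad_pair_exists[OF quad_sym[OF q]] c by (simp add: Int_commute)
    qed
  qed
  have q': "quad Z R (V - X) (V - Y)" using quad_sym[OF quad_compl[OF quad_sym[OF quad_compl[OF q]]]] .
  show ?thesis using quad_small_diagonal[OF q] *[OF q] *[OF q'] by blast
qed

text \<open>With \<open>Z\<close> and \<open>R\<close> fixed, two pairings of the chosen vertices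
  give two tight cuts. The second pairing joins vertices that lie on the same side of the first cut,
  so every quadrant receives one chosen vertex.\<close>

lemma pair_exists: "\<exists>T N K1 K2. pair T N K1 K2"
proof -
  have "\<exists>t. \<forall>K\<in>odd_comps. t K \<in> K" using odd_comps_nonempty by metis
  then obtain t where t: "\<And>K. K \<in> odd_comps \<Longrightarrow> t K \<in> K" by blast
  define Z where "Z = t ` odd_comps"
  have Z: "transversal Z" using exists_transversal[OF t] by (simp add: Z_def)
  then have ZV: "Z \<subseteq> V" by (simp add: transversal_def)
  have Z4: "card Z = 4" using card_transversal[OF Z] four by simp
  obtain R where R: "matching_off Z R" using exists_matching_off[OF Z] by blast
  obtain a b c d where abcd: "Z = {a, b, c, d}" "distinct [a, b, c, d]"
  proof -
    obtain xs where "set xs = Z" "distinct xs" "length xs = 4"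
      using Z4 finite_sub_V[OF ZV] by (metis distinct_card finite_distinct_list)
    then show thesis using that by (auto simp: numeral_eq_Suc length_Suc_conv)
  qed
  have pairing: "\<exists>X. tight R X \<and> (p \<in> X \<longleftrightarrow> q \<notin> X) \<and> (r \<in> X \<longleftrightarrow> s \<notin> X)"
    if "Z = {p, q, r, s}" "distinct [p, q, r, s]" for p q r s
  proof -
    have ne: "p \<noteq> q" "p \<noteq> r" "p \<noteq> s" "q \<noteq> r" "q \<noteq> s" "r \<noteq> s" using that(2) by auto
    have pqrs: "p \<in> Z" "q \<in> Z" "r \<in> Z" "s \<in> Z" using that(1) by auto
    define \<pi> where "\<pi> x = (if x = p then q else if x = q then p else if x = r then s else r)" for x
    have \<pi>: "\<pi> p = q" "\<pi> q = p" "\<pi> r = s" "\<pi> s = r" using ne by (simp_all add: \<pi>_def)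
    have "\<pi> x \<in> Z \<and> \<pi> x \<noteq> x \<and> \<pi> (\<pi> x) = x" if "x \<in> Z" for x
    proof -
      have "x = p \<or> x = q \<or> x = r \<or> x = s" using that \<open>Z = {p, q, r, s}\<close> by blast
      then show ?thesis using \<pi> pqrs ne by (elim disjE) simp_all
    qed
    note ex = exists_proper[OF ZV R this]
    obtain \<phi> where \<phi>: "proper R \<phi>" "\<forall>x\<in>Z. \<phi> (\<pi> x) = - \<phi> x" using ex by blast
    obtain X where X: "tight R X" "\<And>x. x \<in> Z \<Longrightarrow> x \<in> X \<longleftrightarrow> \<phi> x = 1"
      using exists_tight[OF Z R \<phi>(1)] by blast
    have sgn: "\<phi> x = 1 \<or> \<phi> x = - 1" if "x \<in> Z" for x using \<phi>(1) ZV that by (auto simp: proper_def)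
    have "\<phi> q = - \<phi> p" "\<phi> s = - \<phi> r" using \<phi>(2) \<pi> pqrs by metis+
    then have "p \<in> X \<longleftrightarrow> q \<notin> X" "r \<in> X \<longleftrightarrow> s \<notin> X"
      using sgn[OF pqrs(1)] sgn[OF pqrs(3)] X(2)[OF pqrs(1)] X(2)[OF pqrs(2)] X(2)[OF pqrs(3)] X(2)[OF pqrs(4)]
      by auto
    then show ?thesis using X(1) by blast
  qed
  obtain X where X: "tight R X" "a \<in> X \<longleftrightarrow> b \<notin> X" "c \<in> X \<longleftrightarrow> d \<notin> X"
    using pairing[of a b c d] abcd by auto
  \<comment> \<open>Exactly one of \<open>c\<close> and \<open>d\<close> is on the same side of
    \<open>X\<close> as \<open>a\<close>; it is called \<open>c'\<close>.\<close>
  obtain c' d' where cd: "Z = {a, b, c', d'}" "distinct [a, b, c', d']" "a \<in> X \<longleftrightarrow> c' \<in> X" "b \<in> X \<longleftrightarrow> d' \<in> X"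
  proof (cases "a \<in> X \<longleftrightarrow> c \<in> X")
    case True
    then show thesis using that[of c d] abcd X by auto
  next
    case False
    then show thesis using that[of d c] abcd X by auto
  qed
  obtain Y where Y: "tight R Y" "a \<in> Y \<longleftrightarrow> c' \<notin> Y" "b \<in> Y \<longleftrightarrow> d' \<notin> Y"
    using pairing[of a c' b d'] cd by auto
  have abV: "a \<in> V" "b \<in> V" "c' \<in> V" "d' \<in> V" using ZV cd(1) by auto
  have ne: "a \<noteq> b" "a \<noteq> c'" "a \<noteq> d'" "b \<noteq> c'" "b \<noteq> d'" "c' \<noteq> d'" using cd(2) by auto
  have "card ({a, b, c', d'} \<inter> (X \<inter> Y)) = 1 \<and> card ({a, b, c', d'} \<inter> (X - Y)) = 1 \<and>
    card ({a, b, c', d'} \<inter> (Y - X)) = 1 \<and> card ({a, b, c', d'} \<inter> (V - (X \<union> Y))) = 1"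
    using X(2) Y(2,3) cd(3,4) abV ne by (cases "a \<in> X"; cases "a \<in> Y"; cases "b \<in> Y") simp_all
  then have "quad Z R X Y" unfolding quad_def using Z R X(1) Y(1) cd(1) by simp
  then show ?thesis by (rule quad_gives_pair)
qed

end

section \<open>Parity tools and normalised configurations for the descent\<close>

lemma card_Un_if: "card (A \<union> (if c then {e} else {})) \<le> card A + (if c then 1 else 0)"
  using card_Un_le[of A "if c then {e} else {}"] by (simp split: if_splits)

context cubic_two_factor
begin

lemma card_comps_parity:
  assumes "S \<subseteq> V" "D \<subseteq> \<K>" "\<And>K. K \<in> \<K> - D \<Longrightarrow> even (card (S \<inter> K))"
  shows "even (card S) \<longleftrightarrow> even (\<Sum>K\<in>D. card (S \<inter> K))"
proof -
  have "S = (\<Union>K\<in>\<K>. S \<inter> K)" using assms(1) union_\<K> by blast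
  then have "card S = card (\<Union>K\<in>\<K>. S \<inter> K)" by simp
  also have "\<dots> = (\<Sum>K\<in>\<K>. card (S \<inter> K))"
  proof (rule card_UN_disjoint[OF finite_\<K>])
    show "\<forall>K\<in>\<K>. finite (S \<inter> K)" using \<K>_sub finite_sub_V by blast
    show "\<forall>K\<in>\<K>. \<forall>K'\<in>\<K>. K \<noteq> K' \<longrightarrow> (S \<inter> K) \<inter> (S \<inter> K') = {}" using disjoint_\<K> by blast
  qed
  also have "\<dots> = (\<Sum>K\<in>\<K> - D. card (S \<inter> K)) + (\<Sum>K\<in>D. card (S \<inter> K))"
    by (rule sum.subset_diff[OF assms(2) finite_\<K>])
  finally have "card S = (\<Sum>K\<in>\<K> - D. card (S \<inter> K)) + (\<Sum>K\<in>D. card (S \<inter> K))" .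
  moreover have "even (\<Sum>K\<in>\<K> - D. card (S \<inter> K))" using assms(3) by (intro dvd_sum) blast
  ultimately show ?thesis by simp
qed

lemma matching_off_cut_parity:
  assumes "matching_off Z R" "S \<subseteq> V" shows "even (card (R \<inter> cut S)) \<longleftrightarrow> even (card (S - Z))"
proof -
  have R: "R \<subseteq> E" "\<And>v. v \<in> V \<Longrightarrow> deg R v = (if v \<in> Z then 0 else 1)"
    using assms(1) F_sub by (auto simp: matching_off_def)
  have "(\<Sum>v\<in>S. deg R v) = (\<Sum>v\<in>S. if v \<in> Z then 0 else 1)" using R(2) assms(2) by (intro sum.cong) auto
  also have "\<dots> = card (S - Z)" using finite_sub_V[OF assms(2)] by (simp add: sum.If_cases Diff_eq)
  finally have "card (S - Z) = 2 * card {e \<in> R. ends e \<subseteq> S} + card (R \<inter> cut S)"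
    using handshake[OF R(1) assms(2)] by simp
  then show ?thesis by presburger
qed

lemma matching_off_not:
  assumes "matching_off Z R" "x \<in> Z" "x \<in> V" "x \<in> ends e" shows "e \<notin> R"
proof
  assume "e \<in> R"
  have "R \<subseteq> E" "deg R x = 0" using assms F_sub by (auto simp: matching_off_def)
  then show False using \<open>e \<in> R\<close> assms(4) finite_sub_E[of R] by (auto simp: deg_def)
qed

end

context linked_two_factor
begin

lemma pairD:
  assumes "pair T N K1 K2"
  shows "T \<subseteq> V" "N \<subseteq> V" "T \<inter> N = {}" "odd (card T)" "odd (card N)" "K1 \<in> odd_comps" "K2 \<in> odd_comps"
    "K1 \<noteq> K2" "card (M \<inter> cut T) = 1" "card (F \<inter> cut (T \<inter> K1)) = 2" "card (F \<inter> cut (T \<inter> K2)) = 2"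
    "K \<in> \<K> \<Longrightarrow> K \<noteq> K1 \<Longrightarrow> K \<noteq> K2 \<Longrightarrow> F \<inter> cut (T \<inter> K) = {}"
    "K2 \<subseteq> T \<union> N" "F \<inter> cut N = F \<inter> cut (T \<inter> K2)" "card (cut N) \<le> 5"
    "K \<in> odd_comps \<Longrightarrow> K \<noteq> K1 \<Longrightarrow> K \<noteq> K2 \<Longrightarrow> K \<inter> (T \<union> N) = {}"
  by (use assms[unfolded pair_def] in simp_all)

text \<open>An even circuit other than \<open>K2\<close> lies inside or outside \<open>N\<close>,
  and the same holds for \<open>T\<close>; odd circuits other than \<open>K1\<close> and
  \<open>K2\<close> avoid both sets. So the oddness of \<open>N\<close> comes from \<open>K2\<close>
  alone. As \<open>K2\<close> is odd and contained in \<open>T \<union> N\<close>, its part in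
  \<open>T\<close> is even, and the oddness of \<open>T\<close> comes from
  \<open>K1\<close>.\<close>

lemma pair_parity:
  assumes p: "pair T N K1 K2" shows "odd (card (T \<inter> K1))" "odd (card (N \<inter> K2))" "K1 \<inter> N = {}"
proof -
  note P = pairD[OF p]
  note K = odd_compsD[OF P(6)] odd_compsD[OF P(7)]
  have K1T: "K1 \<inter> T \<noteq> {}"
  proof
    assume "K1 \<inter> T = {}"
    then have "T \<inter> K1 = {}" by blast
    then have "F \<inter> cut (T \<inter> K1) = {}" by (simp add: cut_def)
    then show False using P(10) by simp
  qed
  have evT: "even (card (T \<inter> K))" if K': "K \<in> \<K> - {K1, K2}" for K
  proof (cases "K \<in> odd_comps")
    case True
    then have "T \<inter> K = {}" using P(16)[of K] K' by blast
    then show ?thesis by simp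
  next
    case False
    have "K \<subseteq> T \<or> K \<inter> T = {}" using F_cut_comp_empty[of K T] P(12)[of K] K' by blast
    then have "T \<inter> K = K \<or> T \<inter> K = {}" by blast
    moreover have "even (card K)" using False K' by (simp add: odd_comps_def)
    ultimately show ?thesis by (elim disjE) simp_all
  qed
  have Nw: "K \<subseteq> N \<or> K \<inter> N = {}" if K': "K \<in> \<K> - {K2}" for K
  proof (rule F_cut_comp_empty)
    show "K \<in> \<K>" using K' by blast
    show "F \<inter> cut (N \<inter> K) = {}"
    proof (rule ccontr)
      assume "F \<inter> cut (N \<inter> K) \<noteq> {}"
      then obtain e where e: "e \<in> F \<inter> cut N" "ends e \<subseteq> K" using F_cut_comp[OF \<open>K \<in> \<K>\<close>, of N] by blast
      then have "ends e \<subseteq> K2" using F_cut_comp[OF K(2), of T] unfolding P(14) by blast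
      moreover have "e \<in> E" using e(1) F_sub by blast
      then obtain a where "a \<in> ends e" using ends_obtain by blast
      ultimately show False using \<K>_eq[OF \<open>K \<in> \<K>\<close> K(2), of a] e(2) K' by blast
    qed
  qed
  show K1N: "K1 \<inter> N = {}" using Nw[of K1] K(1) P(3,8) K1T by blast
  have evN: "even (card (N \<inter> K))" if K': "K \<in> \<K> - {K2}" for K
  proof (cases "K \<in> odd_comps")
    case True
    then have "N \<inter> K = {}" using P(16)[of K] K1N K' by blast
    then show ?thesis by simp
  next
    case False
    have "N \<inter> K = K \<or> N \<inter> K = {}" using Nw[OF K'] by blast
    moreover have "even (card K)" using False K' by (simp add: odd_comps_def)
    ultimately show ?thesis by (elim disjE) simp_all
  qed
  show oN: "odd (card (N \<inter> K2))" 
  proof -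
    have "{K2} \<subseteq> \<K>" using K(2) by blast
    from card_comps_parity[OF P(2) this evN] show ?thesis using P(5) by simp
  qed
  have "K2 = (T \<inter> K2) \<union> (N \<inter> K2)" "(T \<inter> K2) \<inter> (N \<inter> K2) = {}" using P(3,13) by blast+
  then have "card K2 = card (T \<inter> K2) + card (N \<inter> K2)"
    using card_Un_disjoint[of "T \<inter> K2" "N \<inter> K2"] finite_sub_V[OF \<K>_sub[OF K(2)]] by simp
  moreover have "odd (card K2)" using P(7) by (simp add: odd_comps_def)
  ultimately have "even (card (T \<inter> K2))" using oN by simp
  moreover have "{K1, K2} \<subseteq> \<K>" using K by blast
  from card_comps_parity[OF P(1) this evT] have "odd (card (T \<inter> K1) + card (T \<inter> K2))" using P(4,8) by simp
  ultimately show "odd (card (T \<inter> K1))" by simp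
qed

lemma proper_uminus: "proper R \<phi> \<Longrightarrow> proper R (\<lambda>v. - \<phi> v)"
  by (auto simp: proper_def sum_negf)

text \<open>The chosen vertices on \<open>K1\<close> and \<open>K2\<close> may be any
  \<open>x1\<close>, \<open>x2\<close>. Pairing them with each other, and the remaining two
  likewise, splits both pairs along \<open>X\<close>; negating the colouring if necessary puts
  \<open>x1\<close> inside.\<close>

lemma pair_config:
  assumes p: "pair T N K1 K2" and x: "x1 \<in> K1" "x2 \<in> K2"
  obtains Z R \<phi> X where "transversal Z" "matching_off Z R" "proper R \<phi>" "Z \<inter> K1 = {x1}" "Z \<inter> K2 = {x2}"
    "tight R X" "\<forall>e\<in>cut X. sum \<phi> (ends e \<inter> X) = 1" "\<phi> x1 = 1" "x1 \<in> X" "x2 \<notin> X"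
    "\<exists>x\<in>Z - {x1, x2}. x \<in> X" "\<exists>x\<in>Z - {x1, x2}. x \<notin> X"
proof -
  note K = pairD(6-8)[OF p]
  have "\<exists>t. \<forall>K\<in>odd_comps. t K \<in> K" using odd_comps_nonempty by metis
  then obtain t0 where t0: "\<And>K. K \<in> odd_comps \<Longrightarrow> t0 K \<in> K" by blast
  define t where "t = t0(K1 := x1, K2 := x2)"
  have t: "t K \<in> K" if "K \<in> odd_comps" for K using t0[OF that] x by (auto simp: t_def)
  define Z where "Z = t ` odd_comps"
  have Z: "transversal Z" using exists_transversal[OF t] by (simp add: Z_def)
  then have ZV: "Z \<subseteq> V" by (simp add: transversal_def)
  have "t K1 = x1" "t K2 = x2" using K(3) by (simp_all add: t_def)
  then have x12: "x1 \<in> Z" "x2 \<in> Z" unfolding Z_def using K(1,2) by blast+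
  obtain z1 where "Z \<inter> K1 = {z1}" using transversal_meets[OF Z K(1)] .
  then have Z1: "Z \<inter> K1 = {x1}" using x12(1) x(1) by (metis IntI singletonD)
  obtain z2 where "Z \<inter> K2 = {z2}" using transversal_meets[OF Z K(2)] .
  then have Z2: "Z \<inter> K2 = {x2}" using x12(2) x(2) by (metis IntI singletonD)
  have ne: "x1 \<noteq> x2" using \<K>_eq[OF odd_compsD[OF K(1)] odd_compsD[OF K(2)] x(1)] x(2) K(3) by blast
  have Z4: "card Z = 4" using card_transversal[OF Z] four by simp
  have finZ: "finite Z" using finite_sub_V[OF ZV] .
  have "card (Z - {x1, x2}) = 2" using Z4 x12 ne finZ by (simp add: card_Diff_subset)
  then obtain y z where yz: "Z - {x1, x2} = {y, z}" "y \<noteq> z" by (auto simp: card_2_iff)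
  obtain R where R: "matching_off Z R" using exists_matching_off[OF Z] by blast
  define \<pi> where "\<pi> x = (if x = x1 then x2 else if x = x2 then x1 else if x = y then z else y)" for x
  have yzn: "y \<noteq> x1" "y \<noteq> x2" "z \<noteq> x1" "z \<noteq> x2" "y \<in> Z" "z \<in> Z" using yz by auto
  have \<pi>: "\<pi> x1 = x2" "\<pi> x2 = x1" "\<pi> y = z" "\<pi> z = y" using ne yz(2) yzn by (simp_all add: \<pi>_def)
  have "\<pi> x \<in> Z \<and> \<pi> x \<noteq> x \<and> \<pi> (\<pi> x) = x" if "x \<in> Z" for x
  proof -
    have "x = x1 \<or> x = x2 \<or> x = y \<or> x = z" using that yz(1) by blast
    then show ?thesis using \<pi> x12 yzn ne yz(2) by (elim disjE) simp_all
  qed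
  note ex = exists_proper[OF ZV R this]
  obtain \<phi>0 where \<phi>0: "proper R \<phi>0" "\<forall>x\<in>Z. \<phi>0 (\<pi> x) = - \<phi>0 x" using ex by blast
  have "\<phi>0 x1 = 1 \<or> \<phi>0 x1 = - 1" using \<phi>0(1) x12(1) ZV by (auto simp: proper_def)
  moreover have "\<phi>0 x2 = - \<phi>0 x1" using bspec[OF \<phi>0(2) x12(1)] \<pi>(1) by simp
  ultimately have "proper R \<phi>0 \<and> \<phi>0 x1 = 1 \<and> \<phi>0 x2 = - 1 \<or>
      proper R (\<lambda>v. - \<phi>0 v) \<and> - \<phi>0 x1 = 1 \<and> - \<phi>0 x2 = - 1"
    using \<phi>0(1) proper_uminus[OF \<phi>0(1)] by auto
  then obtain \<phi> where \<phi>: "proper R \<phi>" "\<phi> x1 = 1" "\<phi> x2 = - 1" by blast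
  obtain X where X: "tight R X" "\<And>x. x \<in> Z \<Longrightarrow> x \<in> X \<longleftrightarrow> \<phi> x = 1" "card (X \<inter> Z) = 2"
    "\<And>e. e \<in> cut X \<Longrightarrow> sum \<phi> (ends e \<inter> X) = 1" using exists_tight[OF Z R \<phi>(1)] by blast
  have x1X: "x1 \<in> X" "x2 \<notin> X" using X(2) x12 \<phi>(2,3) by auto
  have "\<exists>x\<in>Z - {x1, x2}. x \<in> X"
  proof (rule ccontr)
    assume "\<not> ?thesis"
    then have "X \<inter> Z = {x1}" using x1X x12 by blast
    then show False using X(3) by simp
  qed
  moreover have "\<exists>x\<in>Z - {x1, x2}. x \<notin> X"
  proof (rule ccontr)
    assume "\<not> ?thesis"
    then have "X \<inter> Z = Z - {x2}" using x1X x12 by blast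
    then show False using X(3) Z4 x12 finZ by simp
  qed
  moreover have "\<forall>e\<in>cut X. sum \<phi> (ends e \<inter> X) = 1" using X(4) by blast
  ultimately show thesis using that[OF Z R \<phi>(1) Z1 Z2 X(1) _ \<phi>(2) x1X] by blast
qed

end

section \<open>The descent\<close>

context linked_two_factor
begin

lemma cut_ends: "e \<in> cut S \<Longrightarrow> \<exists>a b. e \<in> E \<and> ends e = {a, b} \<and> a \<in> S \<and> b \<notin> S"
  using cut_obtain by metis

text \<open>The cut \<open>X\<close> of a suitable configuration meets \<open>T\<close> in only a
  few ways, distinguished by the R-edges of the cut inside \<open>T\<close>. In each, one of
  \<open>(T - X) \<union> N\<close>, \<open>X - T\<close>, \<open>X \<union> T\<close> separates two
  odd circuits by at most five edges, or \<open>T - X\<close> is a smaller pair with the same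
  \<open>N\<close>, \<open>K1\<close>, \<open>K2\<close>.\<close>

lemma pair_False:
  assumes p: "pair T N K1 K2" and min: "\<And>T'. pair T' N K1 K2 \<Longrightarrow> card T \<le> card T'"
  shows False
proof -
  note P = pairD[OF p] and par = pair_parity[OF p]
  note K = odd_compsD[OF P(6)] odd_compsD[OF P(7)]
  note fin = finite_sub_V[OF P(1)] finite_sub_V[OF P(2)]
  obtain f1 f2 where F1: "F \<inter> cut (T \<inter> K1) = {f1, f2}" "f1 \<noteq> f2" using P(10) by (auto simp: card_2_iff)
  obtain g1 g2 where F2: "F \<inter> cut (T \<inter> K2) = {g1, g2}" "g1 \<noteq> g2" using P(11) by (auto simp: card_2_iff)
  have f_mem: "f \<in> F \<and> f \<in> cut T \<and> ends f \<subseteq> K1" if "f \<in> {f1, f2}" for f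
    using that unfolding F1(1)[symmetric] F_cut_comp[OF K(1)] by blast
  have g_mem: "g \<in> F \<and> g \<in> cut T \<and> ends g \<subseteq> K2" if "g \<in> {g1, g2}" for g
    using that unfolding F2(1)[symmetric] F_cut_comp[OF K(2)] by blast
  have F_N: "F \<inter> cut N = {g1, g2}" using P(14) F2(1) by simp
  have disj_K: False if "v \<in> K1" "v \<in> K2" for v using \<K>_eq[OF K that] P(8) by blast
  have fg: "f \<noteq> g" if "f \<in> {f1, f2}" "g \<in> {g1, g2}" for f g
  proof
    assume "f = g"
    then have "ends f \<subseteq> K1" "ends f \<subseteq> K2" "f \<in> E" using f_mem[OF that(1)] g_mem[OF that(2)] F_sub by auto
    moreover obtain a where "a \<in> ends f" using ends_obtain[OF \<open>f \<in> E\<close>] by blast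
    ultimately show False using disj_K by blast
  qed
  \<comment> \<open>The chosen vertices lie on opposite sides of the boundary of \<open>T\<close>:
    \<open>x1\<close> is the inner end of \<open>f1\<close>, while \<open>x2\<close> is the outer
    end of \<open>g1\<close> and lies in \<open>N\<close>. As \<open>R\<close> misses both, it
    contains neither edge.\<close>
  obtain x1 b1 where x1: "ends f1 = {x1, b1}" "x1 \<in> T" "b1 \<notin> T"
    using f_mem[of f1] cut_obtain[of f1 T] by (metis insertI1)
  have x1K: "x1 \<in> K1" using f_mem[of f1] x1 by blast
  obtain h1 x2 where x2: "ends g1 = {h1, x2}" "h1 \<in> T" "x2 \<notin> T"
    using g_mem[of g1] cut_obtain[of g1 T] by (metis insertI1)
  have x2K: "x2 \<in> K2" using g_mem[of g1] x2 by blast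
  then have x2N: "x2 \<in> N" using P(13) x2 by blast
  obtain a2 b2 where f2: "ends f2 = {a2, b2}" "a2 \<in> T" "b2 \<notin> T"
    using f_mem[of f2] cut_obtain[of f2 T] by (metis insertI1 insertI2)
  obtain h2 k2 where g2: "ends g2 = {h2, k2}" "h2 \<in> T" "k2 \<notin> T"
    using g_mem[of g2] cut_obtain[of g2 T] by (metis insertI1 insertI2)
  have "k2 \<in> K2" using g_mem[of g2] g2 by blast
  then have k2N: "k2 \<in> N" using P(13) g2 by blast
  obtain m where m: "M \<inter> cut T = {m}" using P(9) by (auto simp: card_1_singleton_iff)
  then have mM: "m \<in> M" "m \<in> cut T" by blast+
  obtain s s' where s: "m \<in> E" "ends m = {s, s'}" "s \<noteq> s'" "s \<in> T" "s' \<notin> T" "s \<in> V" "s' \<in> V"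
    using cut_obtain[OF mM(2)] .
  have cut_T: "cut T = {m, f1, f2, g1, g2}"
  proof -
    have "F \<inter> cut T = (F \<inter> cut (T \<inter> K1)) \<union> (F \<inter> cut (T \<inter> K2))"
      unfolding F_cut_UN[of T] using P(12) K by blast
    then have "F \<inter> cut T = {f1, f2, g1, g2}" using F1 F2 by auto
    moreover have "cut T = (M \<inter> cut T) \<union> (F \<inter> cut T)" using cut_sub[of T] by (auto simp: F_def)
    ultimately show ?thesis using m by auto
  qed
  have mF: "m \<notin> F" using mM by (simp add: F_def)
  obtain Z R \<phi> X where Z: "transversal Z" and R: "matching_off Z R" and \<phi>: "proper R \<phi>"
    and ZK: "Z \<inter> K1 = {x1}" "Z \<inter> K2 = {x2}" and X1: "tight R X" "\<forall>e\<in>cut X. sum \<phi> (ends e \<inter> X) = 1"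
    and x1X: "\<phi> x1 = 1" "x1 \<in> X" and x2X: "x2 \<notin> X"
    and others: "\<exists>x\<in>Z - {x1, x2}. x \<in> X" "\<exists>x\<in>Z - {x1, x2}. x \<notin> X"
    using pair_config[OF p x1K x2K] .
  note X = X1(1) bspec[OF X1(2)]
  have ZV: "Z \<subseteq> V" and RF: "R \<subseteq> F" and XV: "X \<subseteq> V" and B: "(F - R) \<inter> cut X = {}"
    using Z R X(1) by (auto simp: transversal_def matching_off_def tight_def)
  have FX: "F \<inter> cut X = R \<inter> cut X" "card (F \<inter> cut X) = 2" "card (cut X) = 6" using tight_F[OF X(1) RF] by auto
  have x12: "x1 \<in> Z" "x2 \<in> Z" using ZK by auto
  have Zrest: "\<exists>C. C \<in> odd_comps \<and> C \<in> \<K> \<and> x \<in> C \<and> C \<inter> (T \<union> N) = {} \<and> C \<noteq> K1 \<and> C \<noteq> K2" if "x \<in> Z - {x1, x2}" for x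
  proof -
    have "x \<in> Z" using that by blast
    then obtain C where C: "C \<in> odd_comps" "x \<in> C" "Z \<inter> C = {x}" using transversal_odd[OF Z] by blast
    have "C \<noteq> K1" "C \<noteq> K2" using C(2) ZK that by auto
    then show ?thesis using C(1,2) P(16)[OF C(1)] odd_compsD[OF C(1)] by blast
  qed
  \<comment> \<open>\<open>Ck\<close> and \<open>Cl\<close> avoid \<open>T\<close> and
    \<open>N\<close> and have their chosen vertices on different sides of \<open>X\<close>; they are
    the circuits to be separated in most cases.\<close>
  obtain xk Ck where Ck: "xk \<in> X" "Ck \<in> odd_comps" "Ck \<in> \<K>" "xk \<in> Ck" "Ck \<inter> (T \<union> N) = {}" "Ck \<noteq> K1" "Ck \<noteq> K2"
    using others(1) Zrest by blast
  obtain xl Cl where Cl: "xl \<notin> X" "Cl \<in> odd_comps" "Cl \<in> \<K>" "xl \<in> Cl" "Cl \<inter> (T \<union> N) = {}" "Cl \<noteq> K1" "Cl \<noteq> K2"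
    using others(2) Zrest by blast
  have T_Z: "T \<inter> Z = {x1}"
  proof -
    have "x = x1" if "x \<in> T" "x \<in> Z" for x
      using that Zrest[of x] P(3) x2N by blast
    then show ?thesis using x1(2) x12(1) by blast
  qed
  have N_Z: "N \<inter> K2 \<inter> Z = {x2}" using ZK(2) x2N by blast

  have nR1: "f1 \<notin> R" "g1 \<notin> R" using matching_off_not[OF R x12(1), of f1] matching_off_not[OF R x12(2), of g1] x1 x2 x12 ZV by auto
  \<comment> \<open>\<open>R\<close> covers all of \<open>T \<inter> K1\<close> except
    \<open>x1\<close>, an even number of vertices, so an even number of R-edges leave this set. Its
    F-boundary is \<open>f1\<close>, \<open>f2\<close>, and \<open>f1\<close> is not in
    \<open>R\<close>. The same count on \<open>N \<inter> K2\<close> without \<open>x2\<close>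
    excludes \<open>g2\<close>.\<close>
  have f2R: "f2 \<notin> R"
  proof
    assume "f2 \<in> R"
    have "R \<inter> cut (T \<inter> K1) = {f1, f2} \<inter> R" using F1(1) RF by blast
    then have "R \<inter> cut (T \<inter> K1) = {f2}" using nR1 \<open>f2 \<in> R\<close> by simp
    moreover have "T \<inter> K1 \<subseteq> V" using P(1) by blast
    moreover have "T \<inter> K1 - Z = T \<inter> K1 - {x1}" using T_Z by blast
    then have "card (T \<inter> K1 - Z) = card (T \<inter> K1) - 1" using x1(2) x1K fin by simp
    ultimately show False using matching_off_cut_parity[OF R, of "T \<inter> K1"] par(1) by simp
  qed
  have F_NK: "F \<inter> cut (N \<inter> K2) = {g1, g2}"
  proof -
    have "F \<inter> cut (N \<inter> K2) = {e \<in> {g1, g2}. ends e \<subseteq> K2}" unfolding F_cut_comp[OF K(2)] F_N ..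
    then show ?thesis using g_mem by auto
  qed
  have g2R: "g2 \<notin> R"
  proof
    assume "g2 \<in> R"
    have "R \<inter> cut (N \<inter> K2) = {g1, g2} \<inter> R" using F_NK RF by blast
    then have "R \<inter> cut (N \<inter> K2) = {g2}" using nR1 \<open>g2 \<in> R\<close> by simp
    moreover have "N \<inter> K2 \<subseteq> V" using P(2) by blast
    moreover have "N \<inter> K2 - Z = N \<inter> K2 - {x2}" using N_Z by blast
    then have "card (N \<inter> K2 - Z) = card (N \<inter> K2) - 1" using x2N x2K fin by simp
    ultimately show False using matching_off_cut_parity[OF R, of "N \<inter> K2"] par(2) by simp
  qed
  have not_cut: "f1 \<notin> cut X" "f2 \<notin> cut X" "g1 \<notin> cut X" "g2 \<notin> cut X"
    using B f_mem[of f1] f_mem[of f2] g_mem[of g1] g_mem[of g2] nR1 f2R g2R by auto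
  have fE: "f1 \<in> E" "f2 \<in> E" "g1 \<in> E" "g2 \<in> E"
    using f_mem[of f1] f_mem[of f2] g_mem[of g1] g_mem[of g2] F_sub by auto
  have b1X: "b1 \<in> X" using not_cut(1) cut_iff[OF fE(1) x1(1), of X] x1X by simp
  have h1X: "h1 \<notin> X" using not_cut(3) cut_iff[OF fE(3) x2(1), of X] x2X by simp
  have f2X: "a2 \<in> X \<longleftrightarrow> b2 \<in> X" using not_cut(2) cut_iff[OF fE(2) f2(1), of X] by simp
  have g2X: "h2 \<in> X \<longleftrightarrow> k2 \<in> X" using not_cut(4) cut_iff[OF fE(4) g2(1), of X] by simp

  \<comment> \<open>With \<open>\<mu>\<close> and \<open>\<nu>\<close> edges of \<open>M\<close> and \<open>R\<close> of the violating cut inside \<open>T\<close>, the two ways of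
    summing \<open>\<phi>\<close> over \<open>X \<inter> T\<close> determine \<open>\<mu>\<close> from \<open>\<nu>\<close>; then \<open>\<nu> \<le> 2\<close> leaves three cases.\<close>
  define I where "I = {e \<in> E. ends e \<subseteq> T}"
  define \<mu> \<nu> where "\<mu> = card (M \<inter> cut X \<inter> I)" and "\<nu> = card (R \<inter> cut X \<inter> I)"
  have I_cut: "I \<inter> cut T = {}" by (auto simp: I_def cut_def)
  have E_cases: "e \<in> I \<or> e \<in> cut T \<or> ends e \<inter> T = {}" if "e \<in> E" for e
    using that by (auto simp: I_def cut_def)
  have RT: "R \<inter> cut T = {}" unfolding cut_T using nR1 f2R g2R mF RF by auto
  \<comment> \<open>Along \<open>M\<close> only \<open>m\<close> leaves \<open>T\<close>, which
    gives \<open>\<phi> s\<close>; along \<open>R\<close> nothing leaves \<open>T\<close> and only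
    \<open>x1\<close> is uncovered, which gives \<open>\<phi> x1\<close>.\<close>
  have \<phi>s: "\<phi> s = 1"
  proof -
    have "sum \<phi> T = \<phi> s" using proper_sum(1)[OF R \<phi> P(1)] m s by simp
    moreover have "sum \<phi> (T - Z) = 0" using proper_sum(2)[OF R \<phi> P(1)] RT by simp
    moreover have "sum \<phi> T = sum \<phi> (T \<inter> Z) + sum \<phi> (T - Z)" by (rule sum.Int_Diff[OF fin(1)])
    ultimately show ?thesis using T_Z x1X by simp
  qed
  have "sum \<phi> (ends m) = 0" using \<phi> mM(1) by (simp add: proper_def)
  then have ss': "\<phi> s + \<phi> s' = 0" using s(2,3) by simp
  \<comment> \<open>The inner ends of all cut edges are positive, but \<open>s'\<close> is negative,
    so it cannot be the only end of \<open>m\<close> in \<open>X\<close>.\<close>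
  have s'X: "s' \<notin> X" if "s \<notin> X"
  proof
    assume "s' \<in> X"
    with that have "m \<in> cut X" "ends m \<inter> X = {s'}" using cut_iff[OF s(1,2)] s(2) by auto
    then show False using X(2)[of m] ss' \<phi>s by simp
  qed
  have m_cut: "m \<in> cut X \<longleftrightarrow> s \<in> X \<and> s' \<notin> X" using cut_iff[OF s(1,2), of X] s'X by blast
  have XT_V: "X \<inter> T \<subseteq> V" using XV by blast
  have cut_XT: "e \<in> cut (X \<inter> T) \<longleftrightarrow> e \<in> cut X" "ends e \<inter> (X \<inter> T) = ends e \<inter> X" if "e \<in> I" for e
    using that by (auto simp: cut_def I_def)
  have M_XT: "M \<inter> cut (X \<inter> T) = (M \<inter> cut X \<inter> I) \<union> (if s \<in> X then {m} else {})"
  proof (intro set_eqI)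
    fix e
    show "e \<in> M \<inter> cut (X \<inter> T) \<longleftrightarrow> e \<in> (M \<inter> cut X \<inter> I) \<union> (if s \<in> X then {m} else {})"
    proof (cases "e \<in> M")
      case True
      then have eE: "e \<in> E" using M_sub by blast
      from E_cases[OF eE] consider "e \<in> I" | "e \<in> cut T" | "ends e \<inter> T = {}" by blast
      then show ?thesis
      proof cases
        case 1
        then have "e \<noteq> m" using I_cut mM by blast
        then show ?thesis using cut_XT(1)[OF 1] 1 True by auto
      next
        case 2
        then have "e = m" using True m by blast
        moreover have "m \<notin> I" using I_cut mM by blast
        moreover have "m \<in> cut (X \<inter> T) \<longleftrightarrow> s \<in> X" using cut_iff[OF s(1,2), of "X \<inter> T"] s(4,5) by simp
        ultimately show ?thesis using mM by auto
      next
        case 3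
        moreover obtain a where "a \<in> ends e" using ends_obtain[OF eE] by blast
        ultimately have "e \<noteq> m" "e \<notin> I" "e \<notin> cut (X \<inter> T)" using s(2,4) by (auto simp: I_def cut_def)
        then show ?thesis by auto
      qed
    qed (use mM in auto)
  qed
  have R_XT: "R \<inter> cut (X \<inter> T) = R \<inter> cut X \<inter> I"
  proof (intro set_eqI)
    fix e
    show "e \<in> R \<inter> cut (X \<inter> T) \<longleftrightarrow> e \<in> R \<inter> cut X \<inter> I"
    proof (cases "e \<in> R")
      case True
      then have eE: "e \<in> E" and "e \<notin> cut T" using RF F_sub RT by auto
      from E_cases[OF eE] this(2) consider "e \<in> I" | "ends e \<inter> T = {}" by blast
      then show ?thesis
      proof cases
        case 1
        then show ?thesis using cut_XT(1)[OF 1] by auto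
      next
        case 2
        moreover obtain a where "a \<in> ends e" using ends_obtain[OF eE] by blast
        ultimately have "e \<notin> I" "e \<notin> cut (X \<inter> T)" by (auto simp: I_def cut_def)
        then show ?thesis by auto
      qed
    qed simp
  qed
  have \<mu>\<nu>: "\<mu> + (if s \<in> X then 1 else 0) = \<nu> + 1"
  proof -
    have mI: "m \<notin> M \<inter> cut X \<inter> I" using I_cut mM by blast
    have finI: "finite (M \<inter> cut X \<inter> I)" by auto
    have 1: "(\<Sum>e\<in>A \<inter> cut X \<inter> I. sum \<phi> (ends e \<inter> (X \<inter> T))) = int (card (A \<inter> cut X \<inter> I))" for A
    proof -
      have "(\<Sum>e\<in>A \<inter> cut X \<inter> I. sum \<phi> (ends e \<inter> (X \<inter> T))) = (\<Sum>e\<in>A \<inter> cut X \<inter> I. 1)"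
        using cut_XT(2) X(2) by (intro sum.cong refl) simp
      then show ?thesis by simp
    qed
    have ms: "s \<in> X \<Longrightarrow> sum \<phi> (ends m \<inter> (X \<inter> T)) = 1"
    proof -
      assume "s \<in> X"
      then have "ends m \<inter> (X \<inter> T) = {s}" using s by auto
      then show ?thesis using \<phi>s by simp
    qed
    have "sum \<phi> (X \<inter> T) = int \<mu> + (if s \<in> X then 1 else 0)"
      unfolding proper_sum(1)[OF R \<phi> XT_V] M_XT \<mu>_def using 1[of M] mI finI ms by (cases "s \<in> X") simp_all
    moreover have "sum \<phi> (X \<inter> T - Z) = int \<nu>"
      unfolding proper_sum(2)[OF R \<phi> XT_V] R_XT \<nu>_def by (rule 1)
    moreover have "sum \<phi> (X \<inter> T) = sum \<phi> (X \<inter> T \<inter> Z) + sum \<phi> (X \<inter> T - Z)"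
      using fin by (intro sum.Int_Diff) auto
    moreover have "X \<inter> T \<inter> Z = {x1}" using T_Z x1X by blast
    ultimately show ?thesis using x1X(1) by (cases "s \<in> X") simp_all
  qed

  \<comment> \<open>The F-edges on the boundary of \<open>T\<close> do not cross \<open>X\<close>.
    So the six edges of the cut are those inside \<open>T\<close>, possibly \<open>m\<close>, and
    the rest \<open>P'\<close>, which lies outside \<open>T\<close>.\<close>
  define P' where "P' = cut X - I - {m}"
  define Q where "Q = R \<inter> cut X \<inter> I"
  have MR: "M \<inter> R = {}" using RF by (auto simp: F_def)
  have cut_X_MR: "e \<in> M \<or> e \<in> R" if "e \<in> cut X" for e
    using that FX(1) cut_sub[of X] by (auto simp: F_def)
  have card_P': "card P' + \<mu> + \<nu> + (if s \<in> X \<and> s' \<notin> X then 1 else 0) = 6"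
  proof -
    have "cut X \<inter> I = (M \<inter> cut X \<inter> I) \<union> Q" using cut_X_MR by (auto simp: Q_def)
    then have "card (cut X \<inter> I) = card ((M \<inter> cut X \<inter> I) \<union> Q)" by simp
    also have "\<dots> = \<mu> + \<nu>" unfolding \<mu>_def \<nu>_def Q_def using MR by (intro card_Un_disjoint) auto
    finally have 1: "card (cut X \<inter> I) = \<mu> + \<nu>" .
    have "card (cut X) = card (cut X \<inter> I) + card (cut X - I)"
      using card_Un_disjoint[of "cut X \<inter> I" "cut X - I"] by (simp add: Int_Diff_Un Int_Diff_disjoint)
    moreover have "card P' + (if m \<in> cut X then 1 else 0) = card (cut X - I)"
    proof -
      have "m \<notin> I" using I_cut mM by blast
      then show ?thesis unfolding P'_def using card_Suc_Diff1[of "cut X - I" m] by auto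
    qed
    ultimately show ?thesis using FX(3) 1 m_cut by simp
  qed
  have sep: "6 \<le> card (cut S)" if "S \<subseteq> V" "Ck \<subseteq> S" "Cl \<inter> S = {}" for S
    using linked[OF that(1) Ck(2) Cl(2) that(2,3)] .
  have whole: "C \<subseteq> X \<or> C \<inter> X = {}" if "C \<in> \<K>" "\<And>e. e \<in> F \<inter> cut X \<Longrightarrow> \<not> ends e \<subseteq> C" for C
    using F_cut_comp_empty[OF that(1), of X] F_cut_comp[OF that(1), of X] that(2) by blast
  have not_T: "e = m \<or> e = f1 \<or> e = f2 \<or> e = g1 \<or> e = g2" if "e \<in> E" "ends e = {a, b}" "a \<in> T" "b \<notin> T" for e a b
    using cut_iff[OF that(1,2), of T] that(3,4) cut_T by blast
  have outer: "v \<in> {x1, b1} \<Longrightarrow> v \<notin> T \<Longrightarrow> v = b1" "v \<in> {h1, x2} \<Longrightarrow> v \<notin> T \<Longrightarrow> v = x2"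
    "v \<in> {a2, b2} \<Longrightarrow> v \<notin> T \<Longrightarrow> v = b2" "v \<in> {h2, k2} \<Longrightarrow> v \<notin> T \<Longrightarrow> v = k2"
    "v \<in> {s, s'} \<Longrightarrow> v \<notin> T \<Longrightarrow> v = s'" for v
    using x1 x2 f2 g2 s by auto
  have inner: "v \<in> {x1, b1} \<Longrightarrow> v \<in> T \<Longrightarrow> v = x1" "v \<in> {h1, x2} \<Longrightarrow> v \<in> T \<Longrightarrow> v = h1"
    "v \<in> {a2, b2} \<Longrightarrow> v \<in> T \<Longrightarrow> v = a2" "v \<in> {h2, k2} \<Longrightarrow> v \<in> T \<Longrightarrow> v = h2"
    "v \<in> {s, s'} \<Longrightarrow> v \<in> T \<Longrightarrow> v = s" for v
    using x1 x2 f2 g2 s by auto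
  have P'_I: "e \<in> P'" if "e \<in> cut X" "e \<in> E" "ends e = {a, b}" "a \<notin> T" "b \<notin> T" for e a b
  proof -
    have "e \<noteq> m" using that(3-5) s by auto
    moreover have "e \<notin> I" using that(3,4) by (auto simp: I_def)
    ultimately show ?thesis using that(1) by (simp add: P'_def)
  qed
  have finP': "finite P'" by (simp add: P'_def)
  have bound4: "card S \<le> card A + (if c1 then 1 else 0) + (if c2 then 1 else 0) + (if c3 then 1 else 0) + (if c4 then 1 else 0)"
    if "S \<subseteq> A \<union> (if c1 then {e1} else {}) \<union> (if c2 then {e2} else {}) \<union> (if c3 then {e3} else {}) \<union> (if c4 then {e4} else {})"
      "finite A" for S A :: "'b set" and c1 c2 c3 c4 e1 e2 e3 e4
  proof -
    have "card S \<le> card (A \<union> (if c1 then {e1} else {}) \<union> (if c2 then {e2} else {}) \<union> (if c3 then {e3} else {}) \<union> (if c4 then {e4} else {}))"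
      using that by (intro card_mono) auto
    then show ?thesis
      using card_Un_if[of "A \<union> (if c1 then {e1} else {}) \<union> (if c2 then {e2} else {}) \<union> (if c3 then {e3} else {})" c4 e4]
        card_Un_if[of "A \<union> (if c1 then {e1} else {}) \<union> (if c2 then {e2} else {})" c3 e3]
        card_Un_if[of "A \<union> (if c1 then {e1} else {})" c2 e2] card_Un_if[of A c1 e1] by linarith
  qed
  \<comment> \<open>Of the boundary of \<open>T\<close>, \<open>f1\<close> always counts because
    \<open>b1\<close> is in \<open>X\<close>, and \<open>g1\<close> never because \<open>x2\<close>
    is not. In the bound for \<open>X \<union> T\<close> below the two exchange their roles.\<close>
  have cut_diff: "card (cut (X - T)) \<le> card P' + 1 + (if a2 \<in> X then 1 else 0) + (if h2 \<in> X then 1 else 0)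
    + (if s' \<in> X then 1 else 0)"
  proof -
    have "cut (X - T) \<subseteq> P' \<union> (if True then {f1} else {}) \<union> (if a2 \<in> X then {f2} else {}) \<union>
      (if h2 \<in> X then {g2} else {}) \<union> (if s' \<in> X then {m} else {})" (is "_ \<subseteq> ?U")
    proof
      fix e assume "e \<in> cut (X - T)"
      then obtain a b where e: "e \<in> E" "ends e = {a, b}" "a \<in> X" "a \<notin> T" "b \<notin> X - T" by (blast dest: cut_ends)
      show "e \<in> ?U"
      proof (cases "b \<in> T")
        case True
        have "ends e = {b, a}" using e(2) by auto
        from not_T[OF e(1) this True e(4)] show ?thesis
        proof (elim disjE)
          assume "e = m" then show ?thesis using outer(5)[of a] e s(2) by auto
        next
          assume "e = f2" then show ?thesis using outer(3)[of a] e f2 f2X by auto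
        next
          assume "e = g1" then show ?thesis using outer(2)[of a] e x2 x2X by auto
        next
          assume "e = g2" then show ?thesis using outer(4)[of a] e g2 g2X by auto
        qed simp
      next
        case False
        then have "e \<in> cut X" using cut_iff[OF e(1,2), of X] e by simp
        then show ?thesis using P'_I[OF _ e(1,2,4) False] by blast
      qed
    qed
    from bound4[OF this finP'] show ?thesis by simp
  qed
  have cut_union: "card (cut (X \<union> T)) \<le> card P' + 1 + (if a2 \<notin> X then 1 else 0) + (if h2 \<notin> X then 1 else 0)
    + (if s' \<notin> X then 1 else 0)"
  proof -
    have "cut (X \<union> T) \<subseteq> P' \<union> (if True then {g1} else {}) \<union> (if a2 \<notin> X then {f2} else {}) \<union>
      (if h2 \<notin> X then {g2} else {}) \<union> (if s' \<notin> X then {m} else {})" (is "_ \<subseteq> ?U")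
    proof
      fix e assume "e \<in> cut (X \<union> T)"
      then obtain a b where e: "e \<in> E" "ends e = {a, b}" "a \<in> X \<union> T" "b \<notin> X" "b \<notin> T" by (blast dest: cut_ends)
      show "e \<in> ?U"
      proof (cases "a \<in> T")
        case True
        from not_T[OF e(1,2) True e(5)] show ?thesis
        proof (elim disjE)
          assume "e = m" then show ?thesis using outer(5)[of b] e s(2) by auto
        next
          assume "e = f2" then show ?thesis using outer(3)[of b] e f2 f2X by auto
        next
          assume "e = f1" then show ?thesis using outer(1)[of b] e x1 b1X by auto
        next
          assume "e = g2" then show ?thesis using outer(4)[of b] e g2 g2X by auto
        qed simp
      next
        case False
        then have "e \<in> cut X" using cut_iff[OF e(1,2), of X] e by simp
        then show ?thesis using P'_I[OF _ e(1,2) False e(5)] by blast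
      qed
    qed
    from bound4[OF this finP'] show ?thesis by simp
  qed
  have F_XT: "F \<inter> cut (X \<inter> T) = Q \<union> {f1} \<union> (if a2 \<in> X then {f2} else {}) \<union> (if h2 \<in> X then {g2} else {})"
  proof
    show "F \<inter> cut (X \<inter> T) \<subseteq> Q \<union> {f1} \<union> (if a2 \<in> X then {f2} else {}) \<union> (if h2 \<in> X then {g2} else {})" (is "_ \<subseteq> ?U")
    proof
      fix e assume eF: "e \<in> F \<inter> cut (X \<inter> T)"
      then obtain a b where e: "e \<in> E" "ends e = {a, b}" "a \<in> X" "a \<in> T" "b \<notin> X \<inter> T" by (blast dest: cut_ends)
      show "e \<in> ?U"
      proof (cases "b \<in> T")
        case True
        then have "e \<in> I" "e \<in> cut X" using e cut_iff[OF e(1,2), of X] by (auto simp: I_def)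
        then show ?thesis using eF FX(1) by (auto simp: Q_def)
      next
        case False
        from not_T[OF e(1,2,4) False] show ?thesis
        proof (elim disjE)
          assume "e = m" then show ?thesis using eF mF by blast
        next
          assume "e = f2" then show ?thesis using inner(3)[of a] e f2 by auto
        next
          assume "e = g1" then show ?thesis using inner(2)[of a] e x2 h1X by auto
        next
          assume "e = g2" then show ?thesis using inner(4)[of a] e g2 by auto
        qed simp
      qed
    qed
    have "Q \<subseteq> F \<inter> cut (X \<inter> T)" using R_XT RF by (auto simp: Q_def)
    moreover have "f1 \<in> F \<inter> cut (X \<inter> T)" using f_mem[of f1] cut_iff[OF fE(1) x1(1), of "X \<inter> T"] x1 x1X by simp
    moreover have "a2 \<in> X \<Longrightarrow> f2 \<in> F \<inter> cut (X \<inter> T)" using f_mem[of f2] cut_iff[OF fE(2) f2(1), of "X \<inter> T"] f2 by simp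
    moreover have "h2 \<in> X \<Longrightarrow> g2 \<in> F \<inter> cut (X \<inter> T)" using g_mem[of g2] cut_iff[OF fE(4) g2(1), of "X \<inter> T"] g2 by simp
    ultimately show "Q \<union> {f1} \<union> (if a2 \<in> X then {f2} else {}) \<union> (if h2 \<in> X then {g2} else {}) \<subseteq> F \<inter> cut (X \<inter> T)"
      by auto
  qed
  have one_comp: "C = C'" if e: "e \<in> E" "ends e \<subseteq> C" "ends e \<subseteq> C'" "C \<in> \<K>" "C' \<in> \<K>" for e C C'
  proof -
    obtain a where "a \<in> ends e" using ends_obtain[OF e(1)] by blast
    then show ?thesis using \<K>_eq[OF e(4,5)] e(2,3) by blast
  qed
  have f_not: "\<not> ends f \<subseteq> C" if "f \<in> {f1, f2}" "C \<in> \<K>" "C \<noteq> K1" for f C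
    using one_comp[of f C K1] f_mem[OF that(1)] that K F_sub by blast
  have g_not: "\<not> ends g \<subseteq> C" if "g \<in> {g1, g2}" "C \<in> \<K>" "C \<noteq> K2" for g C
    using one_comp[of g C K2] g_mem[OF that(1)] that K F_sub by blast
  have K1_XT: "F \<inter> cut (X \<inter> T \<inter> K1) = {e \<in> Q. ends e \<subseteq> K1} \<union> {f1} \<union> (if a2 \<in> X then {f2} else {})"
    unfolding F_cut_comp[OF K(1), of "X \<inter> T"] F_XT using f_mem[of f1] f_mem[of f2] g_not[OF _ K(1) P(8), of g2] by auto
  have K2_XT: "F \<inter> cut (X \<inter> T \<inter> K2) = {e \<in> Q. ends e \<subseteq> K2} \<union> (if h2 \<in> X then {g2} else {})"
    unfolding F_cut_comp[OF K(2), of "X \<inter> T"] F_XT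
    using g_mem[of g2] f_not[OF _ K(2) P(8)[symmetric], of f1] f_not[OF _ K(2) P(8)[symmetric], of f2] by auto
  have C_XT: "F \<inter> cut (X \<inter> T \<inter> C) = {e \<in> Q. ends e \<subseteq> C}" if "C \<in> \<K>" "C \<noteq> K1" "C \<noteq> K2" for C
    unfolding F_cut_comp[OF that(1), of "X \<inter> T"] F_XT
    using g_not[OF _ that(1,3), of g2] f_not[OF _ that(1,2), of f1] f_not[OF _ that(1,2), of f2] by auto
  \<comment> \<open>Evenness on each circuit decides whether \<open>a2\<close> and \<open>h2\<close>
    belong to \<open>X\<close>: on \<open>K1\<close> the edge \<open>f1\<close> is always present,
    on \<open>K2\<close> only the edges of \<open>Q\<close> and possibly \<open>g2\<close>
    occur.\<close>
  note ev1 = F_cut_comp_even[OF K(1), of "X \<inter> T", unfolded K1_XT]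
  note ev2 = F_cut_comp_even[OF K(2), of "X \<inter> T", unfolded K2_XT]
  have \<nu>Q: "card Q = \<nu>" and finQ: "finite Q" by (simp_all add: Q_def \<nu>_def)
  have f_notQ: "f \<notin> Q" if "f \<in> {f1, f2, g1, g2}" for f
    using that cut_T I_cut by (auto simp: Q_def)
  have "\<nu> \<le> 2"
  proof -
    have "Q \<subseteq> R \<inter> cut X" by (auto simp: Q_def)
    then have "card Q \<le> card (R \<inter> cut X)" by (intro card_mono) auto
    then show ?thesis using FX(1,2) \<nu>Q by simp
  qed
  then consider "\<nu> = 0" | "\<nu> = 1" | "\<nu> = 2" by linarith
  then show False
  proof cases
    case 1
    then have Q0: "Q = {}" using \<nu>Q finQ by simp
    have a2X: "a2 \<in> X"
    proof (rule ccontr)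
      assume "a2 \<notin> X" then show False using ev1 Q0 by simp
    qed
    have h2X: "h2 \<notin> X"
    proof
      assume "h2 \<in> X" then show False using ev2 Q0 by simp
    qed
    \<comment> \<open>\<open>W\<close> contains \<open>K2\<close>, since \<open>X\<close> misses
      \<open>K2\<close> inside \<open>T\<close>, and it is disjoint from \<open>Ck\<close>. Both
      \<open>g1\<close> and \<open>g2\<close> now run inside \<open>W\<close>, so at most three
      edges of \<open>cut N\<close> remain; by the relation between \<mu> and \<nu>, at most two
      edges come from \<open>T\<close>.\<close>
    define W where "W = (T - X) \<union> N"
    have g_N: "{g1, g2} \<subseteq> cut N" using F_N by blast
    have "cut W \<subseteq> (M \<inter> cut X \<inter> I) \<union> (if s \<notin> X then {m} else {}) \<union> (cut N - {g1, g2})" (is "_ \<subseteq> ?U")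
    proof
      fix e assume "e \<in> cut W"
      then obtain a b where e: "e \<in> E" "ends e = {a, b}" "a \<in> W" "b \<notin> W" by (blast dest: cut_ends)
      show "e \<in> ?U"
      proof (cases "a \<in> N")
        case True
        have "e \<noteq> g1" using e True x2 h1X P(3) by (auto simp: W_def doubleton_eq_iff)
        moreover have "e \<noteq> g2" using e True g2 h2X P(3) by (auto simp: W_def doubleton_eq_iff)
        moreover have "e \<in> cut N" using cut_iff[OF e(1,2), of N] True e(4) by (simp add: W_def)
        ultimately show ?thesis by simp
      next
        case False
        then have a: "a \<in> T" "a \<notin> X" using e(3) by (auto simp: W_def)
        have b: "b \<notin> N" "b \<in> T \<Longrightarrow> b \<in> X" using e(4) by (auto simp: W_def)
        show ?thesis
        proof (cases "b \<in> T")
          case True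
          then have "e \<in> I" "e \<in> cut X" using a b e(1,2) cut_iff[OF e(1,2), of X] by (auto simp: I_def)
          moreover have "e \<notin> R" using calculation Q0 by (auto simp: Q_def)
          ultimately show ?thesis using cut_X_MR by blast
        next
          case False
          from not_T[OF e(1,2) a(1) False] show ?thesis
          proof (elim disjE)
            assume "e = m" then show ?thesis using inner(5)[of a] a e(2) s(2) by auto
          next
            assume "e = f1" then show ?thesis using inner(1)[of a] a e(2) x1 x1X by auto
          next
            assume "e = f2" then show ?thesis using inner(3)[of a] a e(2) f2 a2X by auto
          next
            assume "e = g1" then show ?thesis using outer(2)[of b] False b e(2) x2 x2N by auto
          next
            assume "e = g2" then show ?thesis using outer(4)[of b] False b e(2) g2 k2N by auto
          qed
        qed
      qed
    qed
    then have "card (cut W) \<le> card ((M \<inter> cut X \<inter> I) \<union> (if s \<notin> X then {m} else {}) \<union> (cut N - {g1, g2}))"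
      by (intro card_mono) auto
    also have "\<dots> \<le> card ((M \<inter> cut X \<inter> I) \<union> (if s \<notin> X then {m} else {})) + card (cut N - {g1, g2})"
      by (rule card_Un_le)
    also have "card (cut N - {g1, g2}) = card (cut N) - 2" using g_N F2(2) by (simp add: card_Diff_subset)
    also have "card ((M \<inter> cut X \<inter> I) \<union> (if s \<notin> X then {m} else {})) \<le> \<mu> + (if s \<notin> X then 1 else 0)"
      unfolding \<mu>_def by (rule card_Un_if)
    finally have "card (cut W) \<le> \<mu> + (if s \<notin> X then 1 else 0) + (card (cut N) - 2)" by simp
    then have W5: "card (cut W) \<le> 5" using \<mu>\<nu> 1 P(15) by (cases "s \<in> X") simp_all
    have "F \<inter> cut (X \<inter> T \<inter> K2) = {}" unfolding K2_XT using Q0 h2X by simp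
    then have "K2 \<subseteq> X \<inter> T \<or> K2 \<inter> (X \<inter> T) = {}" by (rule F_cut_comp_empty[OF K(2)])
    then have "K2 \<inter> (X \<inter> T) = {}" using x2K x2X by blast
    then have K2W: "K2 \<subseteq> W" using P(13) by (auto simp: W_def)
    have "Ck \<inter> W = {}" using Ck(5) by (auto simp: W_def)
    moreover have "W \<subseteq> V" using P(1,2) by (auto simp: W_def)
    ultimately show False using linked[of W K2 Ck] P(7) Ck(2) K2W W5 by simp
  next
    case 3
    have "Q = F \<inter> cut X"
    proof (rule card_subset_eq)
      show "Q \<subseteq> F \<inter> cut X" using FX(1) by (auto simp: Q_def)
      show "card Q = card (F \<inter> cut X)" using 3 \<nu>Q FX(2) by simp
    qed simp
    then have QI: "F \<inter> cut X \<subseteq> I" by (auto simp: Q_def)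
    \<comment> \<open>Both F-edges of the cut are inside \<open>T\<close>. If \<open>h2\<close> were
      in \<open>X\<close>, then \<open>g2\<close> would be the only F-edge leaving
      \<open>X \<inter> N\<close>, against parity.\<close>
    have h2X: "h2 \<notin> X"
    proof
      assume "h2 \<in> X"
      then have k2X: "k2 \<in> X" using g2X by blast
      have "F \<inter> cut (X \<inter> N) = {g2}"
      proof
        show "F \<inter> cut (X \<inter> N) \<subseteq> {g2}"
        proof
          fix e assume eF: "e \<in> F \<inter> cut (X \<inter> N)"
          then obtain a b where e: "e \<in> E" "ends e = {a, b}" "a \<in> X" "a \<in> N" "b \<notin> X \<inter> N" by (blast dest: cut_ends)
          show "e \<in> {g2}"
          proof (cases "b \<in> N")
            case True
            then have "e \<in> F \<inter> cut X" using eF cut_iff[OF e(1,2), of X] e(3,5) by simp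
            then have "a \<in> T" using QI e(2) by (auto simp: I_def)
            then show ?thesis using e(4) P(3) by blast
          next
            case False
            then have "e \<in> F \<inter> cut N" using eF cut_iff[OF e(1,2), of N] e(4) by simp
            moreover have "e \<noteq> g1" using e x2 x2X P(3) by (auto simp: doubleton_eq_iff)
            ultimately show ?thesis using F_N by blast
          qed
        qed
        have "h2 \<notin> N" using g2(2) P(3) by blast
        then show "{g2} \<subseteq> F \<inter> cut (X \<inter> N)"
          using cut_iff[OF fE(4) g2(1), of "X \<inter> N"] k2X k2N g_mem[of g2] by simp
      qed
      moreover have "X \<inter> N \<subseteq> V" using XV by blast
      ultimately show False using F_cut_even[of "X \<inter> N"] by simp
    qed
    have no: "\<not> ends e \<subseteq> C" if "e \<in> F \<inter> cut X" "C \<inter> (T \<union> N) = {}" for e C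
    proof
      assume "ends e \<subseteq> C"
      moreover have "ends e \<subseteq> T" "e \<in> E" using that(1) QI by (auto simp: I_def)
      moreover obtain a where "a \<in> ends e" using ends_obtain[OF \<open>e \<in> E\<close>] by blast
      ultimately show False using that(2) by blast
    qed
    \<comment> \<open>The circuits \<open>Ck\<close> and \<open>Cl\<close> contain no F-edge of the
      cut, so \<open>X - T\<close> separates them; \<open>cut_diff\<close> and the count of
      \<open>P'\<close> leave at most five edges.\<close>
    have "Ck \<subseteq> X" using whole[OF Ck(3) no[OF _ Ck(5)]] Ck(1,4) by blast
    then have "Ck \<subseteq> X - T" using Ck(5) by blast
    moreover have "Cl \<inter> X = {}" using whole[OF Cl(3) no[OF _ Cl(5)]] Cl(1,4) by blast
    then have "Cl \<inter> (X - T) = {}" by blast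
    moreover have "X - T \<subseteq> V" using XV by blast
    ultimately have "6 \<le> card (cut (X - T))" using sep by blast
    then show False using cut_diff h2X card_P' \<mu>\<nu> 3 s'X
      by (cases "s \<in> X"; cases "s' \<in> X"; cases "a2 \<in> X") simp_all
  next
    case 2
    \<comment> \<open>A single R-edge of the cut inside \<open>T\<close> can satisfy parity only on
      \<open>K1\<close> or \<open>K2\<close>. The other F-edge of the cut lies on the same circuit,
      so \<open>Ck\<close> and \<open>Cl\<close> are uncrossed.\<close>
    then obtain q where q: "Q = {q}" using \<nu>Q by (auto simp: card_1_singleton_iff)
    have qF: "q \<in> F" "q \<in> cut X" "q \<in> I" using q RF by (auto simp: Q_def)
    have qE: "q \<in> E" using qF F_sub by blast
    obtain C where C: "C \<in> \<K>" "ends q \<subseteq> C" using F_edge_obtain[OF qF(1)] .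
    have crC: "crosses C X" using C qF F_cut_comp[OF C(1), of X] crosses_iff[OF C(1)] by blast
    have C12: "C = K1 \<or> C = K2"
    proof (rule ccontr)
      assume ne: "\<not> ?thesis"
      have "{e \<in> Q. ends e \<subseteq> C} = {q}" using q C by auto
      then show False using C_XT[OF C(1)] F_cut_comp_even[OF C(1), of "X \<inter> T"] ne by simp
    qed
    have not_cross: "\<not> crosses D X" if "D \<in> \<K>" "D \<noteq> K1" "D \<noteq> K2" for D
      using F_cut_two_unique[OF FX(2) C(1) crC that(1)] that(2,3) C12 by blast
    have CkX: "Ck \<subseteq> X" using not_cross[OF Ck(3,6,7)] Ck(1,4) by (auto simp: crosses_def)
    have ClX: "Cl \<inter> X = {}" using not_cross[OF Cl(3,6,7)] Cl(1,4) by (auto simp: crosses_def)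
    from C12 show False
    proof
      assume C2: "C = K2"
      have Q1: "{e \<in> Q. ends e \<subseteq> K1} = {}" using q one_comp[OF qE _ C(2) K(1) C(1)] C2 P(8) by auto
      have a2X: "a2 \<in> X" using ev1[unfolded Q1] by (cases "a2 \<in> X") simp_all
      have Q2: "{e \<in> Q. ends e \<subseteq> K2} = {q}" using q C C2 by auto
      have h2X: "h2 \<in> X" using ev2[unfolded Q2] by (cases "h2 \<in> X") simp_all
      \<comment> \<open>With \<open>a2\<close> and \<open>h2\<close> in \<open>X\<close>, only
        \<open>g1\<close> and possibly \<open>m\<close> from the boundary of \<open>T\<close> can
        leave \<open>X \<union> T\<close>, and at most five edges remain.\<close>
      have "6 \<le> card (cut (X \<union> T))"
      proof (rule sep)
        show "X \<union> T \<subseteq> V" using XV P(1) by blast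
        show "Ck \<subseteq> X \<union> T" using CkX by blast
        show "Cl \<inter> (X \<union> T) = {}" using ClX Cl(5) by blast
      qed
      then show False using cut_union a2X h2X card_P' \<mu>\<nu> 2 s'X
        by (cases "s \<in> X"; cases "s' \<in> X") simp_all
    next
      assume C1: "C = K1"
      have Q1: "{e \<in> Q. ends e \<subseteq> K1} = {q}" using q C C1 by auto
      have "q \<noteq> f1" "q \<noteq> f2" using f_notQ[of f1] f_notQ[of f2] q by auto
      then have a2X: "a2 \<notin> X" using ev1[unfolded Q1] F1(2) by (cases "a2 \<in> X") simp_all
      have Q2: "{e \<in> Q. ends e \<subseteq> K2} = {}" using q one_comp[OF qE _ C(2) K(2) C(1)] C1 P(8) by auto
      have h2X: "h2 \<notin> X" using ev2[unfolded Q2] by (cases "h2 \<in> X") simp_all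
      have "6 \<le> card (cut (X - T))"
      proof (rule sep)
        show "X - T \<subseteq> V" using XV by blast
        show "Ck \<subseteq> X - T" using CkX Ck(5) by blast
        show "Cl \<inter> (X - T) = {}" using ClX by blast
      qed
      then have s_X: "s \<in> X" "s' \<in> X" using cut_diff a2X h2X card_P' \<mu>\<nu> 2 s'X
        by (cases "s \<in> X"; cases "s' \<in> X"; simp)+
      \<comment> \<open>The count for \<open>X - T\<close> fails to contradict only if both ends of
        \<open>m\<close> are in \<open>X\<close>. Then \<open>T - X\<close> is again a pair:
        \<open>q\<close> takes the place of \<open>f1\<close>, and the single M-edge of the cut
        inside \<open>T\<close> that of \<open>m\<close>. It is smaller because it loses
        \<open>x1\<close>.\<close>
      let ?T = "T - X"
      have \<mu>1: "\<mu> = 1" using \<mu>\<nu> 2 s_X by simp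
      have F_T: "F \<inter> cut ?T = {q, f2, g1, g2}"
      proof
        show "F \<inter> cut ?T \<subseteq> {q, f2, g1, g2}"
        proof
          fix e assume eF: "e \<in> F \<inter> cut ?T"
          then obtain a b where e: "e \<in> E" "ends e = {a, b}" "a \<in> T" "a \<notin> X" "b \<notin> ?T" by (blast dest: cut_ends)
          show "e \<in> {q, f2, g1, g2}"
          proof (cases "b \<in> T")
            case True
            then have "e \<in> I" "e \<in> cut X" using e cut_iff[OF e(1,2), of X] by (auto simp: I_def)
            then have "e \<in> Q" using eF FX(1) by (auto simp: Q_def)
            then show ?thesis using q by blast
          next
            case False
            have "e \<noteq> m" using eF mF by blast
            moreover have "e \<noteq> f1"
            proof
              assume "e = f1"
              then show False using inner(1)[of a] e x1 x1X by auto
            qed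
            ultimately show ?thesis using not_T[OF e(1,2,3) False] by blast
          qed
        qed
        obtain a b where ab: "q \<in> E" "ends q = {a, b}" "a \<in> X" "b \<notin> X" using cut_ends[OF qF(2)] by blast
        have "a \<in> T" "b \<in> T" using qF(3) ab(2) by (auto simp: I_def)
        then have "q \<in> cut ?T" using cut_iff[OF ab(1,2), of ?T] ab(3,4) by simp
        moreover have "f2 \<in> cut ?T" using cut_iff[OF fE(2) f2(1), of ?T] f2 a2X by simp
        moreover have "g1 \<in> cut ?T" using cut_iff[OF fE(3) x2(1), of ?T] x2 h1X by simp
        moreover have "g2 \<in> cut ?T" using cut_iff[OF fE(4) g2(1), of ?T] g2 h2X by simp
        ultimately show "{q, f2, g1, g2} \<subseteq> F \<inter> cut ?T" using qF(1) f_mem[of f2] g_mem[of g1] g_mem[of g2] by simp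
      qed
      have K1_T: "F \<inter> cut (?T \<inter> K1) = {q, f2}"
        unfolding F_cut_comp[OF K(1)] F_T
        using C C1 f_mem[of f2] g_not[of g1 K1] g_not[of g2 K1] K(1) P(8) by auto
      have q_not: "\<not> ends q \<subseteq> D" if "D \<in> \<K>" "D \<noteq> K1" for D using one_comp[OF qE _ C(2) that(1) C(1)] C1 that(2) by blast
      have K2_T: "F \<inter> cut (?T \<inter> K2) = {g1, g2}"
        unfolding F_cut_comp[OF K(2)] F_T
        using q_not[OF K(2)] f_not[of f2 K2] g_mem[of g1] g_mem[of g2] K(2) P(8) by auto
      have D_T: "F \<inter> cut (?T \<inter> D) = {}" if "D \<in> \<K> - {K1, K2}" for D
      proof -
        have D: "D \<in> \<K>" "D \<noteq> K1" "D \<noteq> K2" using that by auto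
        show ?thesis unfolding F_cut_comp[OF D(1)] F_T
          using q_not[OF D(1,2)] f_not[of f2 D] g_not[of g1 D] g_not[of g2 D] D by auto
      qed
      have "F \<inter> cut (X \<inter> T \<inter> K2) = {}" unfolding K2_XT Q2 using h2X by simp
      then have "K2 \<subseteq> X \<inter> T \<or> K2 \<inter> (X \<inter> T) = {}" by (rule F_cut_comp_empty[OF K(2)])
      then have "K2 \<inter> (X \<inter> T) = {}" using x2K x2X by blast
      then have K2T: "K2 \<subseteq> ?T \<union> N" using P(13) by blast
      have TV: "?T \<subseteq> V" using P(1) by blast
      have M_T: "M \<inter> cut ?T = M \<inter> cut X \<inter> I"
      proof
        show "M \<inter> cut ?T \<subseteq> M \<inter> cut X \<inter> I"
        proof
          fix e assume eM: "e \<in> M \<inter> cut ?T"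
          then obtain a b where e: "e \<in> E" "ends e = {a, b}" "a \<in> T" "a \<notin> X" "b \<notin> ?T" by (blast dest: cut_ends)
          have "b \<in> T"
          proof (rule ccontr)
            assume "b \<notin> T"
            then have "e = m" using eM m cut_iff[OF e(1,2), of T] e(3) by blast
            then show False using inner(5)[of a] e s(2) s_X(1) by auto
          qed
          then show "e \<in> M \<inter> cut X \<inter> I" using e eM cut_iff[OF e(1,2), of X] by (auto simp: I_def)
        qed
        show "M \<inter> cut X \<inter> I \<subseteq> M \<inter> cut ?T"
        proof
          fix e assume eM: "e \<in> M \<inter> cut X \<inter> I"
          then obtain a b where ab: "e \<in> E" "ends e = {a, b}" "a \<in> X" "b \<notin> X" by (blast dest: cut_ends)
          then have "a \<in> T" "b \<in> T" using eM by (auto simp: I_def)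
          then show "e \<in> M \<inter> cut ?T" using eM cut_iff[OF ab(1,2), of ?T] ab(3,4) by simp
        qed
      qed
      have M1: "card (M \<inter> cut ?T) = 1" unfolding M_T using \<mu>1 by (simp add: \<mu>_def)
      then have "odd (card ?T)" using M_cut_parity[OF TV] by simp
      moreover have "q \<noteq> f2" using f_notQ[of f2] q by auto
      moreover have "\<forall>C\<in>odd_comps - {K1, K2}. C \<inter> (?T \<union> N) = {}" using P(16) by blast
      moreover have "?T \<inter> N = {}" using P(3) by blast
      moreover have "\<forall>D\<in>\<K> - {K1, K2}. F \<inter> cut (?T \<inter> D) = {}" using D_T by blast
      ultimately have "pair ?T N K1 K2" unfolding pair_def K1_T K2_T
        using TV P(2,5-8,15) M1 F_N F2(2) K2T by (intro conjI) simp_all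
      moreover have "card ?T < card T" using fin(1) x1(2) x1X(2) by (intro psubset_card_mono) auto
      ultimately show False using min by fastforce
    qed
  qed
qed

theorem linked_False: False
proof -
  obtain T N K1 K2 where p: "pair T N K1 K2" using pair_exists by blast
  let ?P = "\<lambda>T. pair T N K1 K2"
  have "?P (arg_min card ?P)" "\<And>T'. ?P T' \<Longrightarrow> card (arg_min card ?P) \<le> card T'"
    using arg_min_nat_lemma[of ?P T card] p by auto
  then show False by (rule pair_False)
qed

end

section \<open>Bridgeless cubic graphs\<close>

lemma adjacent_sym: "(u, v) \<in> adjacent H \<Longrightarrow> (v, u) \<in> adjacent H"
  by (auto simp: adjacent_def insert_commute)

lemma adjacent_rtrancl_sym: "(u, v) \<in> (adjacent H)\<^sup>* \<Longrightarrow> (v, u) \<in> (adjacent H)\<^sup>*"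
  by (induction rule: rtrancl_induct) (auto intro: converse_rtrancl_into_rtrancl dest: adjacent_sym)

lemma equiv_connected: "equiv (verts H) ((adjacent H)\<^sup>* \<inter> verts H \<times> verts H)"
proof (rule equivI)
  show "sym ((adjacent H)\<^sup>* \<inter> verts H \<times> verts H)" using adjacent_rtrancl_sym by (auto intro!: symI)
  show "trans ((adjacent H)\<^sup>* \<inter> verts H \<times> verts H)" by (auto intro!: transI)
qed (auto simp: refl_on_def)

lemma components_iff: "K \<in> components H \<longleftrightarrow> (\<exists>v\<in>verts H. K = {w \<in> verts H. (v, w) \<in> (adjacent H)\<^sup>*})"
  by (auto simp: components_def quotient_def)

lemma components_disjoint: "K \<in> components H \<Longrightarrow> K' \<in> components H \<Longrightarrow> K \<noteq> K' \<Longrightarrow> K \<inter> K' = {}"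
  using quotient_disj[OF equiv_connected] unfolding components_def by blast

lemma Union_components: "\<Union>(components H) = verts H"
  unfolding components_def by (rule Union_quotient[OF equiv_connected])

lemma component_rtrancl:
  assumes "K \<in> components H" "u \<in> K" "v \<in> K" shows "(u, v) \<in> (adjacent H)\<^sup>*"
proof -
  obtain r where "(r, u) \<in> (adjacent H)\<^sup>*" "(r, v) \<in> (adjacent H)\<^sup>*"
    using assms unfolding components_iff by blast
  then show ?thesis using adjacent_rtrancl_sym rtrancl_trans by metis
qed

lemma component_closed:
  assumes "K \<in> components H" "u \<in> K" "(u, v) \<in> (adjacent H)\<^sup>*" "v \<in> verts H" shows "v \<in> K"
  using assms unfolding components_iff by (auto intro: rtrancl_trans)

lemma rtrancl_closed:
  assumes "(u, v) \<in> r\<^sup>*" "u \<in> X" "\<And>a b. (a, b) \<in> r \<Longrightarrow> a \<in> X \<Longrightarrow> b \<in> X" shows "v \<in> X"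
  using assms by (induction rule: rtrancl_induct) auto

context fin_multigraph
begin

definition boundary :: "'v set \<Rightarrow> 'e set" where
  "boundary X = {e \<in> edges G. ends G e \<inter> X \<noteq> {} \<and> ends G e - X \<noteq> {}}"

text \<open>Mapping each component of the graph without \<open>e\<close> to the component of
  \<open>G\<close> containing it is onto. If \<open>e\<close> is the whole boundary of
  \<open>X\<close>, its ends lie in different components after deletion but in one before, so the
  map is not injective and the number of components grows.\<close>

lemma bridgeless_boundary:
  assumes "bridgeless G" "X \<subseteq> verts G" shows "card (boundary X) \<noteq> 1"
proof
  assume "card (boundary X) = 1"
  then obtain e where e: "boundary X = {e}" by (auto simp: card_1_singleton_iff)
  then have eE: "e \<in> edges G" and meet: "ends G e \<inter> X \<noteq> {}" "ends G e - X \<noteq> {}" by (auto simp: boundary_def)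
  then obtain u v where uv: "u \<in> X" "v \<notin> X" "u \<in> ends G e" "v \<in> ends G e" by blast
  have "finite (ends G e)" using card_ends[OF eE] card.infinite by fastforce
  moreover have "u \<noteq> v" using uv by blast
  then have "{u, v} \<subseteq> ends G e" "card {u, v} = 2" using uv by auto
  ultimately have ends_e: "ends G e = {u, v}" using card_ends[OF eE] card_seteq[of "ends G e" "{u, v}"] by auto
  let ?H = "delete_edges G {e}"
  have V: "verts ?H = verts G" by (simp add: delete_edges_def)
  have uvV: "u \<in> verts G" "v \<in> verts G" using ends_in_verts[OF eE] uv by auto
  have sub: "adjacent ?H \<subseteq> adjacent G" by (auto simp: adjacent_def delete_edges_def)
  define cl where "cl H w = {z \<in> verts G. (w, z) \<in> (adjacent H)\<^sup>*}" for H :: "('v, 'e) multigraph" and w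
  have comps: "components H = cl H ` verts G" if "verts H = verts G" for H :: "('v, 'e) multigraph"
    using that by (auto simp: components_iff cl_def)
  define f where "f K = {z \<in> verts G. \<exists>w\<in>K. (w, z) \<in> (adjacent G)\<^sup>*}" for K
  have f: "f (cl ?H w) = cl G w" if "w \<in> verts G" for w
  proof
    show "f (cl ?H w) \<subseteq> cl G w" using rtrancl_mono[OF sub] by (auto simp: f_def cl_def intro: rtrancl_trans)
    show "cl G w \<subseteq> f (cl ?H w)" using that by (auto simp: f_def cl_def)
  qed
  have im: "components G = f ` components ?H"
    unfolding comps[OF refl] comps[OF V] image_image using f by (intro image_cong) auto
  have fin: "finite (components ?H)" unfolding comps[OF V] using finite_verts by simp
  have closed: "b \<in> X" if ab: "(a, b) \<in> adjacent ?H" "a \<in> X" for a b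
  proof (rule ccontr)
    assume "b \<notin> X"
    obtain e' where "e' \<in> edges G" "e' \<noteq> e" "ends G e' = {a, b}" using ab(1) by (auto simp: adjacent_def delete_edges_def)
    then have "e' \<in> boundary X" using ab(2) \<open>b \<notin> X\<close> by (auto simp: boundary_def)
    then show False using e \<open>e' \<noteq> e\<close> by blast
  qed
  have "v \<notin> cl ?H u"
  proof
    assume "v \<in> cl ?H u"
    then have "(u, v) \<in> (adjacent ?H)\<^sup>*" by (simp add: cl_def)
    then have "v \<in> X" using uv(1) closed by (rule rtrancl_closed)
    then show False using uv(2) by blast
  qed
  then have ne: "cl ?H u \<noteq> cl ?H v" using uvV by (auto simp: cl_def)
  have "(u, v) \<in> adjacent G" "(v, u) \<in> adjacent G" using ends_e eE by (auto simp: adjacent_def insert_commute)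
  then have "cl G u = cl G v"
    by (auto simp: cl_def intro: converse_rtrancl_into_rtrancl)
  then have "f (cl ?H u) = f (cl ?H v)" using f uvV by simp
  then have "\<not> inj_on f (components ?H)" using ne uvV unfolding comps[OF V] inj_on_def by blast
  then have "card (components G) \<noteq> card (components ?H)" unfolding im using fin eq_card_imp_inj_on by metis
  moreover have "card (components G) \<le> card (components ?H)" unfolding im by (rule card_image_le[OF fin])
  ultimately have "bridge G e" using eE by (simp add: bridge_def)
  then show False using assms(1) by (auto simp: bridgeless_def)
qed

end

section \<open>Transfer between the graph-theoretic definitions and the cut-based setting\<close>

locale bridgeless_cubic = fin_multigraph G for G :: "('v, 'e) multigraph" +
  assumes cubic: "cubic G" and bridgeless: "bridgeless G"
begin

lemma no_loop: assumes "e \<in> edges G" shows "card (ends G e) = 2"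
proof (rule ccontr)
  assume "card (ends G e) \<noteq> 2"
  then have "card (ends G e) = 1" using card_ends[OF assms] by blast
  then obtain v where v: "ends G e = {v}" by (auto simp: card_1_singleton_iff)
  then have vV: "v \<in> verts G" using ends_in_verts[OF assms] by auto
  define A L where "A = {e \<in> edges G. v \<in> ends G e}" and "L = {e \<in> edges G. ends G e = {v}}"
  have fin: "finite A" "finite L" "L \<subseteq> A" using finite_edges by (auto simp: A_def L_def)
  have "card A + card L = 3" using cubic vV by (simp add: cubic_def regular_def degree_def A_def L_def)
  moreover have "card L \<noteq> 0" using v assms fin by (auto simp: L_def)
  moreover have "card L \<le> card A" using fin by (simp add: card_mono)
  ultimately have "card L = 1" "card A = 2" by linarith+
  then have "card A - card L = 1" by simp
  then have "card (A - L) = 1" using fin by (simp add: card_Diff_subset)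
  moreover have "boundary {v} = A - L" by (auto simp: boundary_def A_def L_def)
  ultimately show False using bridgeless_boundary[OF bridgeless, of "{v}"] vV by simp
qed

sublocale loopless_multigraph "verts G" "edges G" "ends G"
  using finite_verts finite_edges ends_in_verts no_loop by unfold_locales

lemma degree_spanning: "A \<subseteq> edges G \<Longrightarrow> degree (spanning_subgraph G A) v = deg A v"
proof -
  assume "A \<subseteq> edges G"
  then have "{e \<in> A. ends G e = {v}} = {}" using no_loop by fastforce
  then have "card {e \<in> A. ends G e = {v}} = 0" by (simp only: card.empty)
  moreover have "degree (spanning_subgraph G A) v = card {e \<in> A. v \<in> ends G e} + card {e \<in> A. ends G e = {v}}"
    by (simp add: degree_def spanning_subgraph_def)
  ultimately show ?thesis unfolding deg_def by (simp only: add_0_right)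
qed

lemma factor_iff: "factor k G A \<longleftrightarrow> A \<subseteq> edges G \<and> (\<forall>v\<in>verts G. deg A v = k)"
  using degree_spanning by (auto simp: factor_def regular_def) (auto simp: spanning_subgraph_def)

lemma deg_edges: "v \<in> verts G \<Longrightarrow> deg (edges G) v = 3"
  using cubic degree_spanning[of "edges G" v] by (simp add: cubic_def regular_def spanning_subgraph_def)

lemma factor_compl:
  assumes "factor k G A" shows "factor (3 - k) G (edges G - A)"
  using assms deg_diff[of A "edges G"] deg_edges by (auto simp: factor_iff)

lemma two_factor_locale:
  assumes "two_factor G A"
  shows "cubic_two_factor (verts G) (edges G) (ends G) (edges G - A) (components (spanning_subgraph G A))"
proof -
  let ?H = "spanning_subgraph G A"
  have A: "A \<subseteq> edges G" "\<And>v. v \<in> verts G \<Longrightarrow> deg A v = 2" using assms by (auto simp: factor_iff)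
  have M: "\<And>v. v \<in> verts G \<Longrightarrow> deg (edges G - A) v = 1" using factor_compl[OF assms] by (auto simp: factor_iff)
  have EA: "edges G - (edges G - A) = A" using A(1) by blast
  have V: "verts ?H = verts G" by (simp add: spanning_subgraph_def)
  have adj: "(u, v) \<in> adjacent ?H \<longleftrightarrow> (\<exists>e\<in>A. ends G e = {u, v})" for u v
    by (auto simp: adjacent_def spanning_subgraph_def)
  show ?thesis
  proof (unfold_locales, unfold EA)
    show "edges G - A \<subseteq> edges G" by blast
    show "\<Union> (components ?H) = verts G" using Union_components[of ?H] V by simp
    show "{} \<notin> components ?H" by (auto simp: components_iff)
    show "card (cut S) \<noteq> 1" if "S \<subseteq> verts G" for S
      using bridgeless_boundary[OF bridgeless that] by (simp add: cut_def boundary_def)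
    show "A \<inter> cut K = {}" if K: "K \<in> components ?H" for K
    proof (rule ccontr)
      assume "A \<inter> cut K \<noteq> {}"
      then obtain e where e: "e \<in> A" "e \<in> cut K" by blast
      obtain a b where ab: "ends G e = {a, b}" "a \<in> K" "b \<notin> K" "b \<in> verts G" using cut_obtain[OF e(2)] by metis
      have "(a, b) \<in> adjacent ?H" using adj e(1) ab(1) by blast
      then show False using component_closed[OF K ab(2), of b] ab(3,4) V by auto
    qed
    show "A \<inter> cut S \<noteq> {}" if K: "K \<in> components ?H" and S: "S \<subseteq> K" "S \<noteq> {}" "S \<noteq> K" for K S
    proof
      assume c: "A \<inter> cut S = {}"
      obtain u v where uv: "u \<in> S" "v \<in> K" "v \<notin> S" using S by blast
      have "(u, v) \<in> (adjacent ?H)\<^sup>*" using component_rtrancl[OF K] uv S by blast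
      then have "v \<in> S" using uv(1)
      proof (rule rtrancl_closed)
        fix a b assume "(a, b) \<in> adjacent ?H" "a \<in> S"
        then obtain e where e: "e \<in> A" "ends G e = {a, b}" using adj by blast
        then have "e \<notin> cut S" using c by blast
        then show "b \<in> S" using cut_iff[of e a b S] e A(1) \<open>a \<in> S\<close> by blast
      qed
      then show False using uv(3) by blast
    qed
    show "K \<inter> K' = {}" if "K \<in> components ?H" "K' \<in> components ?H" "K \<noteq> K'" for K K'
      using components_disjoint that .
  qed (use A M in auto)
qed

text \<open>\<open>odd_circuits\<close> measures circuits by edges, the rest of the proof by
  vertices. The handshake lemma in a 2-regular component equates the two numbers; distinct
  components have distinct edge sets because none of these sets is empty.\<close>

lemma card_odd_circuits:
  assumes "two_factor G A"
  shows "card (odd_circuits G A) = card {K \<in> components (spanning_subgraph G A). odd (card K)}"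
    and "odd_circuits G A = induced_edges (spanning_subgraph G A) ` {K \<in> components (spanning_subgraph G A). odd (card K)}"
proof -
  let ?H = "spanning_subgraph G A"
  interpret C: cubic_two_factor "verts G" "edges G" "ends G" "edges G - A" "components ?H"
    by (rule two_factor_locale[OF assms])
  have A: "A \<subseteq> edges G" "\<And>v. v \<in> verts G \<Longrightarrow> deg A v = 2" using assms by (auto simp: factor_iff)
  have FA: "C.F = A" using A(1) by (auto simp: C.F_def)
  have ind: "induced_edges ?H K = {e \<in> A. ends G e \<subseteq> K}" for K
    by (simp add: induced_edges_def spanning_subgraph_def)
  have card: "card (induced_edges ?H K) = card K" if K: "K \<in> components ?H" for K
  proof -
    have "(\<Sum>v\<in>K. deg A v) = (\<Sum>v\<in>K. 2)" using A(2) C.\<K>_sub[OF K] by (intro sum.cong) auto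
    moreover have "A \<inter> cut K = {}" using C.closed_\<K>[OF K] FA by (simp add: C.F_def)
    ultimately show ?thesis using handshake[OF A(1) C.\<K>_sub[OF K]] by (simp add: ind)
  qed
  show im: "odd_circuits G A = induced_edges ?H ` {K \<in> components ?H. odd (card K)}"
    using card by (auto simp: odd_circuits_def circuits_def)
  have "inj_on (induced_edges ?H) (components ?H)"
  proof (rule inj_onI)
    fix K K' assume K: "K \<in> components ?H" "K' \<in> components ?H" and eq: "induced_edges ?H K = induced_edges ?H K'"
    have "K \<noteq> {}" "finite K" using C.empty_\<K> K(1) finite_sub_V[OF C.\<K>_sub[OF K(1)]] by auto
    then have "card (induced_edges ?H K) \<noteq> 0" using card[OF K(1)] by simp
    then obtain e where "e \<in> induced_edges ?H K" by fastforce
    then have "e \<in> edges G" "ends G e \<subseteq> K" "ends G e \<subseteq> K'" using eq A(1) by (auto simp: ind)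
    moreover obtain a where "a \<in> ends G e" using ends_obtain[OF \<open>e \<in> edges G\<close>] by blast
    ultimately show "K = K'" using C.\<K>_eq[OF K] by blast
  qed
  then show "card (odd_circuits G A) = card {K \<in> components ?H. odd (card K)}"
    unfolding im by (intro card_image) (auto intro: inj_on_subset)
qed

text \<open>A perfect matching such as \<open>M2\<close> leaves every odd vertex set. Only edges of
  \<open>M1\<close> leave a circuit of the complement of \<open>M1\<close>, so each odd circuit is
  left by an edge of \<open>M1 \<inter> M2\<close>, and an edge leaves at most two circuits.\<close>

lemma odd_circuits_le_intersection:
  assumes "one_factor G M1" "one_factor G M2"
  shows "card (odd_circuits G (edges G - M1)) \<le> 2 * card (M1 \<inter> M2)"
proof -
  let ?A = "edges G - M1" and ?H = "spanning_subgraph G (edges G - M1)"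
  have A: "two_factor G ?A" using factor_compl[OF assms(1)] by simp
  interpret C: cubic_two_factor "verts G" "edges G" "ends G" "edges G - ?A" "components ?H"
    by (rule two_factor_locale[OF A])
  have M: "M1 \<subseteq> edges G" "M2 \<subseteq> edges G" "\<And>v. v \<in> verts G \<Longrightarrow> deg M2 v = 1" using assms by (auto simp: factor_iff)
  have FA: "C.F = ?A" by (auto simp: C.F_def)
  let ?N = "M1 \<inter> M2"
  have finN: "finite ?N" and finO: "finite C.odd_comps" using M finite_sub_E C.finite_\<K> by (auto simp: C.odd_comps_def)
  have "1 \<le> card (?N \<inter> cut K)" if K: "K \<in> C.odd_comps" for K
  proof -
    have KV: "K \<subseteq> verts G" and Kc: "K \<in> components ?H" using C.\<K>_sub C.odd_compsD[OF K] by auto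
    have "(\<Sum>v\<in>K. deg M2 v) = (\<Sum>v\<in>K. 1)" using M(3) KV by (intro sum.cong) auto
    then have "card K = 2 * card {e \<in> M2. ends G e \<subseteq> K} + card (M2 \<inter> cut K)"
      using handshake[OF M(2) KV] by simp
    moreover have "odd (card K)" using K by (simp add: C.odd_comps_def)
    ultimately have "odd (card (M2 \<inter> cut K))" by presburger
    moreover have "M2 \<inter> cut K = ?N \<inter> cut K" using C.closed_\<K>[OF Kc] FA M(2) by (auto simp: C.F_def)
    ultimately show ?thesis by (metis even_zero less_one linorder_not_less)
  qed
  then have "card C.odd_comps \<le> (\<Sum>K\<in>C.odd_comps. card (?N \<inter> cut K))"
    using sum_mono[of C.odd_comps "\<lambda>_. 1" "\<lambda>K. card (?N \<inter> cut K)"] by simp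
  also have "\<dots> = (\<Sum>K\<in>C.odd_comps. \<Sum>e\<in>?N. if e \<in> cut K then 1 else 0)"
    using finN by (intro sum.cong refl) (simp add: sum.If_cases Int_def)
  also have "\<dots> = (\<Sum>e\<in>?N. \<Sum>K\<in>C.odd_comps. if e \<in> cut K then 1 else 0)" by (rule sum.swap)
  also have "\<dots> = (\<Sum>e\<in>?N. card {K \<in> C.odd_comps. e \<in> cut K})"
    using finO by (intro sum.cong refl) (simp add: sum.If_cases Int_def)
  also have "\<dots> \<le> (\<Sum>e\<in>?N. 2)"
  proof (rule sum_mono)
    fix e assume "e \<in> ?N"
    then have "e \<in> edges G" using M by blast
    then obtain a b where ab: "ends G e = {a, b}" "a \<in> verts G" "b \<in> verts G" using ends_obtain by metis
    obtain Ka Kb where K: "Ka \<in> components ?H" "a \<in> Ka" "Kb \<in> components ?H" "b \<in> Kb"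
      using ab(2,3) C.union_\<K> by blast
    have "{K \<in> C.odd_comps. e \<in> cut K} \<subseteq> {Ka, Kb}"
    proof
      fix K assume "K \<in> {K \<in> C.odd_comps. e \<in> cut K}"
      then have "K \<in> components ?H" "a \<in> K \<or> b \<in> K" using ab(1) C.odd_compsD by (auto simp: cut_def)
      then show "K \<in> {Ka, Kb}" using C.\<K>_eq K by blast
    qed
    then have "card {K \<in> C.odd_comps. e \<in> cut K} \<le> card {Ka, Kb}" by (intro card_mono) auto
    also have "\<dots> \<le> 2" by (simp add: card_insert_if)
    finally show "card {K \<in> C.odd_comps. e \<in> cut K} \<le> 2" .
  qed
  finally have "card C.odd_comps \<le> 2 * card ?N" by simp
  then show ?thesis using card_odd_circuits(1)[OF A] by (simp add: C.odd_comps_def)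
qed

lemma five_flow_if_balanced:
  fixes \<phi> :: "'v \<Rightarrow> int"
  assumes "\<And>v. v \<in> verts G \<Longrightarrow> \<phi> v = 1 \<or> \<phi> v = - 1"
    and "\<And>S. S \<subseteq> verts G \<Longrightarrow> 5 * \<bar>sum \<phi> S\<bar> \<le> 3 * int (card (cut S))"
  shows "has_nowhere_zero_flow G 5"
  using deg_edges by (intro nowhere_zero_5_flow_if_balanced[of G \<phi>])
    (use assms fin_multigraph_axioms no_loop in \<open>auto simp: cut_def deg_def\<close>)

text \<open>Deleting \<open>cut S\<close> keeps both circuits intact, one inside \<open>S\<close>
  and one outside, and no path joins the two sides. Fewer than six edges would thus separate odd
  circuits.\<close>

lemma m_factor_cut:
  assumes A: "two_factor G A" and m: "6 \<le> m_factor G A" and S: "S \<subseteq> verts G"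
    and K: "K \<in> components (spanning_subgraph G A)" "odd (card K)" "K \<subseteq> S"
    and K': "K' \<in> components (spanning_subgraph G A)" "odd (card K')" "K' \<inter> S = {}"
  shows "6 \<le> card (cut S)"
proof (rule ccontr)
  assume small: "\<not> 6 \<le> card (cut S)"
  let ?H = "spanning_subgraph G A" and ?D = "delete_edges G (cut S)"
  interpret C: cubic_two_factor "verts G" "edges G" "ends G" "edges G - A" "components ?H"
    by (rule two_factor_locale[OF A])
  have AE: "A \<subseteq> edges G" using A by (simp add: factor_def)
  \<comment> \<open>A supremum that is at least 6 cannot be taken over numbers up to 5 only. For
    this \<open>k\<close>, a separating cut with at most five edges has fewer than
    \<open>k\<close>.\<close>
  have "\<exists>k. 6 \<le> k \<and> \<not> (\<exists>T. edge_cut G T \<and> card T < k \<and> separates_odd_circuits G A T)"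
  proof (rule ccontr)
    assume no: "\<not> ?thesis"
    have "m_factor G A \<le> 5" unfolding m_factor_def
    proof (rule Sup_least)
      fix x assume "x \<in> {enat k |k. \<not> (\<exists>S. edge_cut G S \<and> card S < k \<and> separates_odd_circuits G A S)}"
      then obtain k where k: "x = enat k" "\<not> (\<exists>S. edge_cut G S \<and> card S < k \<and> separates_odd_circuits G A S)" by blast
      then have "\<not> 6 \<le> k" using no by blast
      then show "x \<le> 5" using k(1) by (simp add: numeral_eq_enat)
    qed
    then have "(6 :: enat) \<le> 5" using m by (rule order_trans[rotated])
    then show False by simp
  qed
  then have no_sep: "\<not> (edge_cut G (cut S) \<and> separates_odd_circuits G A (cut S))" using small by force
  have VD: "verts ?D = verts G" by (simp add: delete_edges_def)
  have nonempty: "K \<noteq> {}" "K' \<noteq> {}" using C.empty_\<K> K(1) K'(1) by auto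
  have KV: "K' \<subseteq> verts G" "K \<subseteq> verts G" using C.\<K>_sub K(1) K'(1) by auto
  have "edge_cut G (cut S)" unfolding edge_cut_def
  proof (intro exI[of _ S] conjI)
    show "S \<noteq> {}" using K(3) nonempty by blast
    show "S \<subset> verts G" using S K'(3) nonempty(2) KV by blast
    show "cut S = {e \<in> edges G. ends G e \<inter> S \<noteq> {} \<and> ends G e \<inter> (verts G - S) \<noteq> {}}"
      using ends_in_verts by (auto simp: cut_def)
  qed
  moreover have "\<exists>D \<in> components ?D. L \<subseteq> D \<and> induced_edges ?H L \<subseteq> induced_edges ?D D"
    if L: "L \<in> components ?H" "L \<subseteq> S \<or> L \<inter> S = {}" for L
  proof -
    obtain v where v: "v \<in> L" "v \<in> verts G" using C.empty_\<K> C.\<K>_sub L(1) by (metis ex_in_conv subsetD)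
    define D where "D = {w \<in> verts ?D. (v, w) \<in> (adjacent ?D)\<^sup>*}"
    have D: "D \<in> components ?D" unfolding components_iff D_def using v(2) VD by auto
    have LD: "L \<subseteq> D"
    proof
      fix w assume w: "w \<in> L"
      have "w \<in> L \<and> (v, w) \<in> (adjacent ?D)\<^sup>*"
        using component_rtrancl[OF L(1) v(1) w]
      proof (induction rule: rtrancl_induct)
        case (step y z)
        then obtain e where e: "e \<in> A" "ends G e = {y, z}" by (auto simp: adjacent_def spanning_subgraph_def)
        have "ends G e \<subseteq> L" using C.F_edge_comp[of e L y] e step.IH L(1) AE by (auto simp: C.F_def)
        then have "e \<notin> cut S" using L(2) by (auto simp: cut_def)
        then have "(y, z) \<in> adjacent ?D" using e AE by (auto simp: adjacent_def delete_edges_def)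
        then show ?case using step.IH \<open>ends G e \<subseteq> L\<close> e(2) by (auto intro: rtrancl_into_rtrancl)
      qed (use v in auto)
      then show "w \<in> D" using w C.\<K>_sub[OF L(1)] VD by (auto simp: D_def)
    qed
    have "induced_edges ?H L \<subseteq> induced_edges ?D D"
    proof
      fix e assume "e \<in> induced_edges ?H L"
      then have "e \<in> A" "ends G e \<subseteq> L" by (auto simp: induced_edges_def spanning_subgraph_def)
      moreover from this have "e \<notin> cut S" using L(2) by (auto simp: cut_def)
      ultimately show "e \<in> induced_edges ?D D" using AE LD by (auto simp: induced_edges_def delete_edges_def)
    qed
    then show ?thesis using D LD by blast
  qed
  then obtain D D' where D: "D \<in> components ?D" "K \<subseteq> D" "induced_edges ?H K \<subseteq> induced_edges ?D D"
    and D': "D' \<in> components ?D" "K' \<subseteq> D'" "induced_edges ?H K' \<subseteq> induced_edges ?D D'"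
    using K(1,3) K'(1,3) by meson
  have "D \<noteq> D'"
  proof
    assume "D = D'"
    obtain u v where uv: "u \<in> K" "v \<in> K'" using nonempty by blast
    have "(u, v) \<in> (adjacent ?D)\<^sup>*" using component_rtrancl[OF D(1)] D(2) D'(2) uv \<open>D = D'\<close> by blast
    moreover have "u \<in> S" using uv K(3) by blast
    ultimately have "v \<in> S"
    proof (rule rtrancl_closed)
      fix a b assume "(a, b) \<in> adjacent ?D" "a \<in> S"
      then obtain e where "e \<in> edges G" "e \<notin> cut S" "ends G e = {a, b}"
        by (auto simp: adjacent_def delete_edges_def)
      then show "b \<in> S" using cut_iff \<open>a \<in> S\<close> by blast
    qed
    then show False using uv K'(3) by blast
  qed
  moreover have "induced_edges ?H K \<in> odd_circuits G A" "induced_edges ?H K' \<in> odd_circuits G A"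
    unfolding card_odd_circuits(2)[OF A] using K K' by auto
  ultimately have "separates_odd_circuits G A (cut S)"
    unfolding separates_odd_circuits_def using D D' by blast
  then show False using no_sep \<open>edge_cut G (cut S)\<close> by blast
qed

lemma five_flow_if_oddness_le_2:
  assumes "two_factor G A" "card (odd_circuits G A) \<le> 2" shows "has_nowhere_zero_flow G 5"
proof -
  interpret C: cubic_two_factor "verts G" "edges G" "ends G" "edges G - A" "components (spanning_subgraph G A)"
    by (rule two_factor_locale[OF assms(1)])
  have "card C.odd_comps \<le> 2" using assms card_odd_circuits(1) by (simp add: C.odd_comps_def)
  then obtain \<phi> where "C.balanced \<phi>" using C.balanced_if_two_odd_comps by blast
  then show ?thesis by (intro five_flow_if_balanced[of \<phi>]) (auto simp: C.balanced_def)
qed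

lemma five_flow_if_oddness_4:
  assumes A: "two_factor G A" and four: "card (odd_circuits G A) = 4" and m: "6 \<le> m_factor G A"
  shows "has_nowhere_zero_flow G 5"
proof (rule ccontr)
  assume no_flow: "\<not> has_nowhere_zero_flow G 5"
  interpret C: cubic_two_factor "verts G" "edges G" "ends G" "edges G - A" "components (spanning_subgraph G A)"
    by (rule two_factor_locale[OF A])
  have "\<not> C.balanced \<phi>" for \<phi>
    using five_flow_if_balanced[of \<phi>] no_flow by (auto simp: C.balanced_def)
  moreover have "card C.odd_comps = 4" using four card_odd_circuits(1)[OF A] by (simp add: C.odd_comps_def)
  moreover have "6 \<le> card (cut S)" if "S \<subseteq> verts G" "K \<in> C.odd_comps" "K' \<in> C.odd_comps" "K \<subseteq> S" "K' \<inter> S = {}" for S K K'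
    using m_factor_cut[OF A m that(1), of K K'] that by (auto simp: C.odd_comps_def)
  ultimately have "linked_two_factor (verts G) (edges G) (ends G) (edges G - A) (components (spanning_subgraph G A))"
    by unfold_locales
  then show False by (rule linked_two_factor.linked_False)
qed

lemma even_card_odd_circuits: "two_factor G A \<Longrightarrow> even (card (odd_circuits G A))"
  using cubic_two_factor.even_card_odd_comps[OF two_factor_locale] card_odd_circuits(1)
    cubic_two_factor.odd_comps_def[OF two_factor_locale] by metis

end

theorem theorem2p6:
  fixes G :: "('v, 'e) multigraph"
  assumes "fin_multigraph G"
    and "cubic G"
    and "bridgeless G"
    and "m_star G \<ge> 6"
    and "mu2 G \<le> 2"
  shows "has_nowhere_zero_flow G 5"
proof -
  interpret bridgeless_cubic G
    using assms(1-3) by (simp add: bridgeless_cubic_def bridgeless_cubic_axioms_def)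
  let ?P = "{enat (card (M1 \<inter> M2)) |M1 M2. one_factor G M1 \<and> one_factor G M2}"
  \<comment> \<open>The infimum of the empty set is \<infinity>, so \<open>mu2 G \<le> 2\<close>
    itself provides 1-factors.\<close>
  have "?P \<noteq> {}"
  proof
    assume "?P = {}"
    then have "mu2 G = Inf {}" unfolding mu2_def by (simp only:)
    then have "mu2 G = \<infinity>" by (simp add: Inf_enat_def)
    then show False using assms(5) by simp
  qed
  then have "mu2 G \<in> ?P" unfolding mu2_def by (meson ex_in_conv wellorder_InfI)
  then obtain M1 M2 where M: "one_factor G M1" "one_factor G M2" "mu2 G = enat (card (M1 \<inter> M2))" by blast
  then have M2: "card (M1 \<inter> M2) \<le> 2" using assms(5) by (simp add: numeral_eq_enat)
  define A0 where "A0 = edges G - M1"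
  have A0: "two_factor G A0" "card (odd_circuits G A0) \<le> 4"
    using factor_compl[OF M(1)] odd_circuits_le_intersection[OF M(1,2)] M2 by (simp_all add: A0_def)
  let ?O = "{enat (card (odd_circuits G F)) |F. two_factor G F}"
  have "enat (card (odd_circuits G A0)) \<in> ?O" using A0(1) by blast
  then have "oddness G \<in> ?O" "oddness G \<le> enat (card (odd_circuits G A0))"
    unfolding oddness_def by (rule wellorder_InfI, rule Inf_lower)
  then obtain A where A: "two_factor G A" "oddness G = enat (card (odd_circuits G A))" and "card (odd_circuits G A) \<le> 4"
    using A0(2) by auto
  show ?thesis
  proof (cases "card (odd_circuits G A) \<le> 2")
    case True
    then show ?thesis using five_flow_if_oddness_le_2 A(1) by blast
  next
    case False
    then have four: "card (odd_circuits G A) = 4"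
      using even_card_odd_circuits[OF A(1)] \<open>card (odd_circuits G A) \<le> 4\<close> by presburger
    then have "oddness G \<noteq> 0" using A(2) by (simp add: zero_enat_def)
    then have m_star: "m_star G = Sup {m_factor G F |F. minimum_two_factor G F}" by (simp add: m_star_def)
    \<comment> \<open>Values below 6 are at most 5 in \<open>enat\<close>, and so is their supremum;
      hence some minimum 2-factor reaches 6.\<close>
    have "\<exists>F. minimum_two_factor G F \<and> 6 \<le> m_factor G F"
    proof (rule ccontr)
      assume no: "\<not> ?thesis"
      have "m_star G \<le> 5" unfolding m_star
      proof (rule Sup_least)
        fix x assume "x \<in> {m_factor G F |F. minimum_two_factor G F}"
        then have "x < 6" using no by (auto simp: not_le)
        then obtain k where "x = enat k" "k < 6" by (cases x) (auto simp: numeral_eq_enat)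
        then show "x \<le> 5" by (simp add: numeral_eq_enat)
      qed
      then have "(6 :: enat) \<le> 5" using assms(4) by (rule order_trans[rotated])
      then show False by simp
    qed
    then obtain F where F: "two_factor G F" "card (odd_circuits G F) = 4" "6 \<le> m_factor G F"
      using A(2) four by (auto simp: minimum_two_factor_def)
    then show ?thesis by (rule five_flow_if_oddness_4)
  qed
qed

end
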